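(* Suppose that $\kappa_1$ and $\kappa_2$ are attracting (or parabolic) parameters. Then the map $$\Phi:=\mathfrak{g}^{\kappa_2}\circ(\mathfrak{g}^{\kappa_1})^{-1}: I(E_{\kappa_1})\to I(E_{\kappa_2})$$ is a conjugacy between $E_{\kappa_1}|_{I(E_{\kappa_1})}$ and $E_{\kappa_2}|_{I(E_{\kappa_2})}$, i.e. $\Phi$ is a homeomorphism and $\Phi\circ E_{\kappa_1}=E_{\kappa_2}\circ\Phi$ on $I(E_{\kappa_1})$.
   Context: For $\kappa\in\mathbb{C}$, $E_\kappa(z)=\exp(z)+\kappa$ and $I(E_\kappa)=\{z:E_\kappa^n(z)\to\infty\}$. The parameter $\kappa$ is attracting (parabolic) if $E_\kappa$ has an attracting (parabolic) periodic cycle; in that case $\kappa\notin I(E_\kappa)$. Model. An external address is a sequence $\underline{s}=s_1s_2s_3\dots\in\mathbb{Z}^{\mathbb{N}}$; $\sigma$ is the shift map; the set of addresses carries the order topology of the lexicographic order. Let $F(t)=e^t-1$ on $[0,\infty)$, $\mathcal{F}(\underline{s},t)=(\sigma(\underline{s}),F(t)-2\pi|s_2|)$, $T(\underline{s},t)=t$, $Z(\underline{s},t)=t+2\pi i s_1$. Put $\overline{X}=\{(\underline{s},t)\in\mathbb{Z}^{\mathbb{N}}\times[0,\infty): T(\mathcal{F}^n(\underline{s},t))\ge 0\ \forall n\ge 0\}$ and $X=\{(\underline{s},t)\in\overline{X}:T(\mathcal{F}^n(\underline{s},t))\to\infty\}$ (subspaces of the product space). The map $\mathfrak{g}^\kappa$.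 Choose $K>2\pi+6$ with $|\kappa|\le K$, let $Q=\max\{\log(4(K+\pi+3)),\pi+2\}$ and $Y=\{(\underline{s},t)\in\overline{X}:T(\mathcal{F}^n(\underline{s},t))\ge Q\ \forall n\ge 0\}$. Let $L_k(w)=\operatorname{Log}(w-\kappa)+2\pi i k$ with $\operatorname{Log}$ the principal branch, $\mathfrak{g}_0=Z$, $\mathfrak{g}_{k+1}(\underline{s},t)=L_{s_1}(\mathfrak{g}_k(\mathcal{F}(\underline{s},t)))$. On $Y$ the maps $\mathfrak{g}_k$ are defined and converge uniformly to a map $\mathfrak{g}=\mathfrak{g}^\kappa$ with $\mathfrak{g}\circ\mathcal{F}=E_\kappa\circ\mathfrak{g}$. If $\kappa\notin I(E_\kappa)$, then $\mathfrak{g}|_{Y\cap X}$ extends uniquely to a map $\mathfrak{g}^\kappa:X\to I(E_\kappa)$ which satisfies $\mathfrak{g}^\kappa\circ\mathcal{F}=E_\kappa\circ\mathfrak{g}^\kappa$ and is continuous along rays (i.e. $t\mapsto\mathfrak{g}^\kappa(\underline{s},t)$ is continuous on $\{t:(\underline{s},t)\in X\}$ for each $\underline{s}$); this extension is a bijection $X\to I(E_\kappa)$. *)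

theory Defs
  imports "HOL-Analysis.Analysis"
begin

definition E :: "complex \<Rightarrow> complex \<Rightarrow> complex" where
  "E \<kappa> z = exp z + \<kappa>"

definition escaping_set :: "(complex \<Rightarrow> complex) \<Rightarrow> complex set" where
  "escaping_set f = {z. filterlim (\<lambda>n. (f ^^ n) z) at_infinity sequentially}"

text \<open>In the next two definitions \<open>n\<close> need not be the exact period. This makes no difference:
  passing to a multiple of the period replaces the multiplier by a power of it.\<close>

definition has_attracting_cycle :: "(complex \<Rightarrow> complex) \<Rightarrow> bool" where
  "has_attracting_cycle f \<longleftrightarrow>
     (\<exists>z n. n \<ge> 1 \<and> (f ^^ n) z = z \<and> norm (deriv (f ^^ n) z) < 1)"

definition has_parabolic_cycle :: "(complex \<Rightarrow> complex) \<Rightarrow> bool" where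
  "has_parabolic_cycle f \<longleftrightarrow>
     (\<exists>z n. n \<ge> 1 \<and> (f ^^ n) z = z \<and> (\<exists>m\<ge>1. deriv (f ^^ n) z ^ m = 1))"

definition attracting_parameter :: "complex \<Rightarrow> bool" where
  "attracting_parameter \<kappa> \<longleftrightarrow> has_attracting_cycle (E \<kappa>)"

definition parabolic_parameter :: "complex \<Rightarrow> bool" where
  "parabolic_parameter \<kappa> \<longleftrightarrow> has_parabolic_cycle (E \<kappa>)"

text \<open>An external address \<open>s\<^sub>1s\<^sub>2s\<^sub>3\<dots>\<close> is a function on \<open>nat\<close>, so indices are shifted:
  \<open>s 0\<close> is the first entry \<open>s\<^sub>1\<close> and \<open>s 1\<close> is the second entry \<open>s\<^sub>2\<close>.\<close>

type_synonym address = "nat \<Rightarrow> int"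

definition shift :: "address \<Rightarrow> address" where
  "shift s = (\<lambda>n. s (Suc n))"

definition F :: "real \<Rightarrow> real" where
  "F t = exp t - 1"

text \<open>The model map is total here, whereas \<open>F\<close> is meant on \<open>[0,\<infinity>)\<close> only; this is harmless,
  since a point whose orbit ever has negative height is excluded from \<open>X_bar\<close>.\<close>

definition model_map :: "address \<times> real \<Rightarrow> address \<times> real" where
  "model_map x = (shift (fst x), F (snd x) - 2 * pi * \<bar>real_of_int (fst x 1)\<bar>)"

definition T :: "address \<times> real \<Rightarrow> real" where
  "T x = snd x"

definition Z :: "address \<times> real \<Rightarrow> complex" where
  "Z x = complex_of_real (snd x) + 2 * complex_of_real pi * \<i> * of_int (fst x 0)"

text \<open>The case \<open>n = 0\<close> of the condition contains the requirement \<open>t \<ge> 0\<close>.\<close>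

definition X_bar :: "(address \<times> real) set" where
  "X_bar = {x. \<forall>n. T ((model_map ^^ n) x) \<ge> 0}"

definition X :: "(address \<times> real) set" where
  "X = {x \<in> X_bar. filterlim (\<lambda>n. T ((model_map ^^ n) x)) at_top sequentially}"

definition Q :: "real \<Rightarrow> real" where
  "Q K = max (ln (4 * (K + pi + 3))) (pi + 2)"

definition Y :: "real \<Rightarrow> (address \<times> real) set" where
  "Y K = {x \<in> X_bar. \<forall>n. T ((model_map ^^ n) x) \<ge> Q K}"

definition L :: "complex \<Rightarrow> int \<Rightarrow> complex \<Rightarrow> complex" where
  "L \<kappa> k w = Ln (w - \<kappa>) + 2 * complex_of_real pi * \<i> * of_int k"

fun g_approx :: "complex \<Rightarrow> nat \<Rightarrow> address \<times> real \<Rightarrow> complex" where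
  "g_approx \<kappa> 0 x = Z x"
| "g_approx \<kappa> (Suc k) x = L \<kappa> (fst x 0) (g_approx \<kappa> k (model_map x))"

definition g_lim :: "complex \<Rightarrow> address \<times> real \<Rightarrow> complex" where
  "g_lim \<kappa> x = lim (\<lambda>k. g_approx \<kappa> k x)"

definition is_g_extension :: "complex \<Rightarrow> real \<Rightarrow> (address \<times> real \<Rightarrow> complex) \<Rightarrow> bool" where
  "is_g_extension \<kappa> K g \<longleftrightarrow>
     (\<forall>x \<in> Y K \<inter> X. g x = g_lim \<kappa> x) \<and>
     g ` X \<subseteq> escaping_set (E \<kappa>) \<and>
     (\<forall>x \<in> X. g (model_map x) = E \<kappa> (g x)) \<and>
     (\<forall>s. continuous_on {t. (s, t) \<in> X} (\<lambda>t. g (s, t)))"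

text \<open>For \<open>\<kappa> \<notin> escaping_set (E \<kappa>)\<close>, \<open>K > 2 * pi + 6\<close> and \<open>norm \<kappa> \<le> K\<close>, the extension is
  unique as a map on \<open>X\<close>, so the choice operator only fixes the irrelevant values outside \<open>X\<close>.\<close>

definition g :: "complex \<Rightarrow> real \<Rightarrow> address \<times> real \<Rightarrow> complex" where
  "g \<kappa> K = (SOME h. is_g_extension \<kappa> K h)"

definition Phi :: "complex \<Rightarrow> real \<Rightarrow> complex \<Rightarrow> real \<Rightarrow> complex \<Rightarrow> complex" where
  "Phi \<kappa>1 K1 \<kappa>2 K2 = g \<kappa>2 K2 \<circ> inv_into X (g \<kappa>1 K1)"

end

theory Submission
  imports Defs "HOL-Complex_Analysis.Conformal_Mappings"
begin

text \<open>It suffices that each \<open>g \<kappa> K\<close> is a homeomorphism from the model \<open>X\<close> onto the escaping set. The only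
  non-elementary input about an attracting or parabolic \<open>\<kappa>\<close> is that \<open>\<kappa>\<close> lies in the immediate basin of the
  cycle (otherwise inverse branches along an orbit in the basin would contradict Bloch's theorem). Hence a
  disc around \<open>\<kappa>\<close> contains no escaping point, and \<open>\<kappa>\<close> is joined to an iterate
  \<open>E\<^sup>n \<kappa>\<close> by a path without escaping points. Pulling this path back along the singular orbit yields a
  non-escaping curve \<open>G\<close> of bounded imaginary part that runs from far left to \<open>+\<infinity>\<close>. Dynamic rays cannot cross
  the translates of \<open>G\<close> by multiples of \<open>2\<pi>\<i>\<close>, which bounds \<open>g - Z\<close> in the imaginary
  direction, and the functional equation then bounds it in the real direction. A uniform bound on \<open>g - Z\<close> on all of
  \<open>X\<close> together with the contraction of the logarithm far to the right gives continuity of \<open>g\<close> and of its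
  inverse at points with high orbits; both properties are pulled back along the dynamics to all of \<open>X\<close>.\<close>

section \<open>Exponential maps and logarithmic lifts\<close>

text \<open>Outside \<open>Y\<close> nothing about the extension is explicit: an orbit may stay low
  for arbitrarily long, and there neither the approximations nor the contraction of the logarithm
  control a ray. This is why the imaginary part is bounded by a topological barrier, and why the
  real part needs constants that reproduce themselves under each pullback: the time of entry into
  \<open>Y\<close> is unbounded. The discs in the basin shrink along an orbit that tends to a
  parabolic point, so smallness of the derivatives of the iterates is not enough; they must be small
  relative to the discs. Since \<open>g\<close> is fixed by a choice, an extension has to be
  constructed before anything can be said about it. Its lifts along rays must avoid the logarithmic
  singularity at \<kappa>, and the disc around \<kappa> guarantees this. The conjugacy acts between
  subsets of the plane, so the topology of the model enters only through convergent
  sequences.\<close>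

lemma exp_lift_unique:
  fixes u v :: "'a::topological_space \<Rightarrow> complex"
  assumes "connected S" "continuous_on S u" "continuous_on S v"
    and eq: "\<And>x. x \<in> S \<Longrightarrow> exp (u x) = exp (v x)"
    and "a \<in> S" "u a = v a" "x \<in> S"
  shows "u x = v x"
proof -
  have "(\<lambda>x. u x - v x) constant_on S"
  \<comment> \<open>The difference takes values in the multiples of 2 pi i, so distinct values are
    at distance at least 1.\<close>
  proof (rule continuous_discrete_range_constant[OF \<open>connected S\<close>])
    show "continuous_on S (\<lambda>x. u x - v x)"
      using assms by (intro continuous_intros)
    fix x assume x: "x \<in> S"
    show "\<exists>e>0. \<forall>y. y \<in> S \<and> u y - v y \<noteq> u x - v x \<longrightarrow> e \<le> norm (u y - v y - (u x - v x))"
    proof (intro exI[of _ 1] conjI allI impI)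
      fix y assume y: "y \<in> S \<and> u y - v y \<noteq> u x - v x"
      obtain m :: int where m: "u y = v y + (of_int (2 * m) * pi) * \<i>"
        using eq[of y] y unfolding exp_eq by blast
      obtain n :: int where n: "u x = v x + (of_int (2 * n) * pi) * \<i>"
        using eq[OF x] unfolding exp_eq by blast
      have "u y - v y - (u x - v x) = complex_of_real (2 * pi * of_int (m - n)) * \<i>"
        unfolding m n by (simp add: algebra_simps)
      hence *: "norm (u y - v y - (u x - v x)) = 2 * pi * \<bar>of_int (m - n)\<bar>"
        by (simp only: norm_mult norm_of_real norm_ii abs_mult) simp
      have "m \<noteq> n" using y m n by auto
      hence "1 \<le> \<bar>m - n\<bar>" by linarith
      hence "(1::real) \<le> \<bar>of_int (m - n)\<bar>" by linarith
      moreover have "(1::real) \<le> 2 * pi" using pi_gt3 by linarith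
      ultimately have "1 * 1 \<le> 2 * pi * \<bar>of_int (m - n)\<bar>" by (intro mult_mono) auto
      thus "1 \<le> norm (u y - v y - (u x - v x))" using * by simp
    qed simp
  qed
  then obtain c where "\<And>x. x \<in> S \<Longrightarrow> u x - v x = c" by (auto simp: constant_on_def)
  thus ?thesis using assms by (metis eq_iff_diff_eq_0)
qed

lemma log_lift_exists:
  fixes u :: "real \<Rightarrow> complex"
  assumes "continuous_on S u" "convex S" "\<And>t. t \<in> S \<Longrightarrow> u t \<noteq> 0"
    and "a \<in> S" "exp b = u a"
  obtains v where "continuous_on S v" "\<And>t. t \<in> S \<Longrightarrow> exp (v t) = u t" "v a = b"
proof -
  obtain w where w: "continuous_on S w" "\<And>t. t \<in> S \<Longrightarrow> u t = exp (w t)"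
    using continuous_logarithm_on_contractible[OF assms(1) convex_imp_contractible[OF assms(2)]] assms(3)
    by metis
  show thesis
  proof
    show "continuous_on S (\<lambda>t. w t + (b - w a))"
      using w by (intro continuous_intros)
    have "exp (b - w a) = 1" using w assms by (simp add: exp_diff)
    thus "exp (w t + (b - w a)) = u t" if "t \<in> S" for t
      using w that by (simp add: exp_add)
  qed simp
qed

lemma E_comp_eq: "E \<kappa> z - \<kappa> = exp z"
  by (simp add: E_def)

lemma continuous_on_E_iter: "continuous_on S (E \<kappa> ^^ n)"
proof (induction n)
  case (Suc n)
  have "continuous_on S (\<lambda>z. exp ((E \<kappa> ^^ n) z) + \<kappa>)"
    using Suc by (intro continuous_intros)
  thus ?case by (simp add: E_def[abs_def] o_def)
qed (simp add: id_def continuous_on_id)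

lemma holomorphic_E_iter: "(E \<kappa> ^^ n) holomorphic_on S"
proof (induction n)
  case (Suc n)
  have "(\<lambda>z. exp ((E \<kappa> ^^ n) z) + \<kappa>) holomorphic_on S"
    using Suc by (intro holomorphic_intros)
  thus ?case by (simp add: E_def[abs_def] o_def)
qed (simp add: id_def)

lemma escaping_E_iff: "E \<kappa> z \<in> escaping_set (E \<kappa>) \<longleftrightarrow> z \<in> escaping_set (E \<kappa>)"
proof -
  have "z \<in> escaping_set (E \<kappa>) \<longleftrightarrow> filterlim (\<lambda>n. (E \<kappa> ^^ Suc n) z) at_infinity sequentially"
    unfolding escaping_set_def mem_Collect_eq
    using filterlim_sequentially_Suc[of "\<lambda>n. (E \<kappa> ^^ n) z" at_infinity] by blast
  thus ?thesis by (simp add: escaping_set_def funpow_swap1)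
qed

lemma escaping_E_iter_iff: "(E \<kappa> ^^ n) z \<in> escaping_set (E \<kappa>) \<longleftrightarrow> z \<in> escaping_set (E \<kappa>)"
  by (induction n) (auto simp: escaping_E_iff)

text \<open>Up to the bounded shift by \<kappa>, the modulus of an iterate is the exponential of the
  real part of the preceding one, so moduli can tend to infinity only if the real parts tend to
  +infinity.\<close>

lemma escaping_iff_Re:
  "z \<in> escaping_set (E \<kappa>) \<longleftrightarrow> filterlim (\<lambda>n. Re ((E \<kappa> ^^ n) z)) at_top sequentially"
proof
  assume "z \<in> escaping_set (E \<kappa>)"
  hence "filterlim (\<lambda>n. (E \<kappa> ^^ Suc n) z) at_infinity sequentially"
    unfolding escaping_set_def mem_Collect_eq
    using filterlim_sequentially_Suc[of "\<lambda>n. (E \<kappa> ^^ n) z" at_infinity] by blast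
  hence "filterlim (\<lambda>n. norm ((E \<kappa> ^^ Suc n) z)) at_top sequentially"
    by (rule filterlim_at_infinity_imp_norm_at_top)
  hence 1: "filterlim (\<lambda>n. norm ((E \<kappa> ^^ Suc n) z) - norm \<kappa>) at_top sequentially"
    using filterlim_tendsto_add_at_top[OF tendsto_const[of "- norm \<kappa>"]] by fastforce
  show "filterlim (\<lambda>n. Re ((E \<kappa> ^^ n) z)) at_top sequentially"
    unfolding filterlim_at_top
  proof
    fix B
    have "eventually (\<lambda>n. exp B \<le> norm ((E \<kappa> ^^ Suc n) z) - norm \<kappa>) sequentially"
      using 1 unfolding filterlim_at_top by blast
    thus "eventually (\<lambda>n. B \<le> Re ((E \<kappa> ^^ n) z)) sequentially"
    proof eventually_elim
      case (elim n)
      have "norm ((E \<kappa> ^^ Suc n) z) - norm \<kappa> \<le> norm ((E \<kappa> ^^ Suc n) z - \<kappa>)"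
        by (rule norm_triangle_ineq2)
      also have "\<dots> = exp (Re ((E \<kappa> ^^ n) z))" by (simp add: E_comp_eq)
      finally show ?case using elim by (smt (verit) exp_less_cancel_iff)
    qed
  qed
next
  assume *: "filterlim (\<lambda>n. Re ((E \<kappa> ^^ n) z)) at_top sequentially"
  have "filterlim (\<lambda>n. norm ((E \<kappa> ^^ n) z)) at_top sequentially"
    by (rule filterlim_at_top_mono[OF *]) (simp add: complex_Re_le_cmod)
  thus "z \<in> escaping_set (E \<kappa>)"
    unfolding escaping_set_def mem_Collect_eq by (rule filterlim_norm_at_top_imp_at_infinity)
qed

lemma bounded_orbit_not_escaping:
  assumes "n \<ge> 1" "bounded V" "\<And>k. (E \<kappa> ^^ (n * k)) z \<in> V"
  shows "z \<notin> escaping_set (E \<kappa>)"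
proof
  assume "z \<in> escaping_set (E \<kappa>)"
  hence 1: "filterlim (\<lambda>k. norm ((E \<kappa> ^^ k) z)) at_top sequentially"
    unfolding escaping_set_def by (auto intro: filterlim_at_infinity_imp_norm_at_top)
  obtain B where B: "\<And>v. v \<in> V \<Longrightarrow> norm v \<le> B" using assms(2) by (auto simp: bounded_iff)
  obtain M where M: "\<And>k. k \<ge> M \<Longrightarrow> norm ((E \<kappa> ^^ k) z) \<ge> B + 1"
    using 1 unfolding filterlim_at_top eventually_sequentially by meson
  have "M \<le> n * M" using assms(1) by simp
  from M[OF this] B[OF assms(3)[of M]] show False by simp
qed

section \<open>The singular value lies in the immediate basin\<close>

text \<open>By Bloch's theorem a larger derivative would make the image contain a disc of radius 4 >
  pi, hence two points that differ by 2 pi i. \<open>E\<close> identifies them, but an inverse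
  branch is injective. The 48 is 4 times the Bloch constant 12.\<close>

lemma inverse_branch_deriv_bound:
  assumes hol: "\<phi> holomorphic_on ball a r" and "r > 0" and "m \<ge> 1"
    and inv: "\<And>z. z \<in> ball a r \<Longrightarrow> (E \<kappa> ^^ m) (\<phi> z) = z"
  shows "r * norm (deriv \<phi> a) \<le> 48"
proof (rule ccontr)
  assume "\<not> ?thesis"
  hence "4 \<le> r * norm (deriv \<phi> a) / 12" by simp
  from Bloch[OF hol \<open>r > 0\<close> this] obtain b where b: "ball b 4 \<subseteq> \<phi> ` ball a r" .
  have "b + pi * \<i> \<in> ball b 4" "b - pi * \<i> \<in> ball b 4"
    using pi_less_4 by (auto simp: dist_norm norm_mult)
  hence "b + pi * \<i> \<in> \<phi> ` ball a r" "b - pi * \<i> \<in> \<phi> ` ball a r"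
    using b by blast+
  then obtain x y where x: "x \<in> ball a r" "\<phi> x = b + pi * \<i>"
    and y: "y \<in> ball a r" "\<phi> y = b - pi * \<i>"
    by (elim imageE) simp
  obtain m' where m': "m = Suc m'" using \<open>m \<ge> 1\<close> by (cases m) auto
  have "exp (b + pi * \<i>) = exp (b - pi * \<i>)"
    by (simp add: exp_add exp_diff)
  hence "(E \<kappa> ^^ m) (\<phi> x) = (E \<kappa> ^^ m) (\<phi> y)"
    unfolding m' x y by (simp only: funpow_Suc_right o_def E_def)
  hence "x = y" using inv x y by metis
  hence "Im (b + pi * \<i>) = Im (b - pi * \<i>)" using x(2) y(2) by metis
  thus False using pi_gt_zero by simp
qed

lemma path_component_continuous_image:
  assumes "path_component S x y" "continuous_on S f" "f ` S \<subseteq> S'"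
  shows "path_component S' (f x) (f y)"
proof -
  obtain p where p: "path p" "path_image p \<subseteq> S" "pathstart p = x" "pathfinish p = y"
    using assms(1) unfolding path_component_def by blast
  show ?thesis
    unfolding path_component_def
    using p assms(2,3)
    by (intro exI[of _ "f \<circ> p"])
       (auto intro!: path_continuous_image intro: continuous_on_subset
         simp: path_image_compose pathstart_compose pathfinish_compose)
qed

text \<open>Attracting and parabolic cycles enter the later argument only through this
  property.\<close>

definition tame :: "complex \<Rightarrow> bool" where
  "tame \<kappa> \<longleftrightarrow> (\<exists>\<delta>>0. ball \<kappa> \<delta> \<inter> escaping_set (E \<kappa>) = {}) \<and>
     (\<exists>n\<ge>1. path_component (- escaping_set (E \<kappa>)) ((E \<kappa> ^^ n) \<kappa>) \<kappa>)"

text \<open>If \<open>\<kappa>\<close> were not joined, within the basin of \<open>V\<close>, to a forward image of \<open>V\<close>, then all inverse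
  branches along the orbit of \<open>w\<close> would exist on the discs in the last assumption. That assumption makes
  their derivatives too large for Bloch's theorem, since an injective branch cannot cover two points that
  differ by \<open>2\<pi>\<i>\<close>.\<close>

lemma tameI_singular_value_in_basin:
  assumes V: "open V" "V \<inter> escaping_set (E \<kappa>) = {}" and n: "n \<ge> 1"
    and inv: "\<And>v. v \<in> V \<Longrightarrow> path_component V v ((E \<kappa> ^^ n) v)"
    and w: "w \<in> V"
    and big: "\<And>M. \<exists>k\<ge>1. \<exists>r>0. ball ((E \<kappa> ^^ (n * k)) w) r \<subseteq> V \<and>
                M * norm (deriv (E \<kappa> ^^ (n * k)) w) < r"
  shows "tame \<kappa>"
proof -
  define A where "A = {z. \<exists>k. (E \<kappa> ^^ k) z \<in> V}"
  have "A = (\<Union>k. (E \<kappa> ^^ k) -` V)" by (auto simp: A_def)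
  hence "open A" using V by (auto intro!: open_UN open_vimage continuous_on_E_iter)
  have A_nonesc: "A \<subseteq> - escaping_set (E \<kappa>)"
    using V escaping_E_iter_iff by (fastforce simp: A_def)
  have "\<exists>i. \<exists>v\<in>V. path_component A ((E \<kappa> ^^ i) v) \<kappa>"
  proof (rule ccontr)
    assume no: "\<not> ?thesis"
    obtain k r where k: "k \<ge> 1" "r > 0" and B: "ball ((E \<kappa> ^^ (n * k)) w) r \<subseteq> V"
      and r: "48 * norm (deriv (E \<kappa> ^^ (n * k)) w) < r"
      using big by blast
    define m where "m = n * k"
    define b where "b = (E \<kappa> ^^ m) w"
    have m1: "m \<ge> 1" using n k by (simp add: m_def)
    have bB: "b \<in> ball b r" using k by simp
    have branch: "\<exists>\<phi>. \<phi> holomorphic_on ball b r \<and> (\<forall>z \<in> ball b r. (E \<kappa> ^^ i) (\<phi> z) = z) \<and>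
        \<phi> b = (E \<kappa> ^^ (m - i)) w" if "i \<le> m" for i
      using that
    proof (induction i)
      case 0
      show ?case by (intro exI[of _ id]) (auto simp: b_def id_def)
    next
      case (Suc i)
      then obtain \<phi> where \<phi>: "\<phi> holomorphic_on ball b r" "\<And>z. z \<in> ball b r \<Longrightarrow> (E \<kappa> ^^ i) (\<phi> z) = z"
        "\<phi> b = (E \<kappa> ^^ (m - i)) w" by auto
      have im: "\<phi> ` ball b r \<subseteq> A"
      proof (rule image_subsetI)
        fix z assume "z \<in> ball b r"
        moreover from this have "z \<in> V" using B by (auto simp: b_def m_def)
        ultimately show "\<phi> z \<in> A" using \<phi>(2)[of z] unfolding A_def by (intro CollectI exI[of _ i]) simp
      qed
      \<comment> \<open>The branch extends one step further back unless it takes the value \<kappa>.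
        In that case its image would join \<open>(E \<kappa> ^^ (m - i)) w\<close> to \<kappa>
        inside \<open>A\<close>, against the assumption \<open>no\<close>.\<close>
      have "\<phi> z - \<kappa> \<noteq> 0" if z: "z \<in> ball b r" for z
      proof
        assume "\<phi> z - \<kappa> = 0"
        hence z': "\<phi> z = \<kappa>" by simp
        have "path_component (ball b r) b z"
          using z bB convex_imp_path_connected[OF convex_ball] unfolding path_connected_component by blast
        hence "path_component A (\<phi> b) (\<phi> z)"
          by (rule path_component_continuous_image[OF _ holomorphic_on_imp_continuous_on[OF \<phi>(1)] im])
        thus False using no w \<phi>(3) z' by auto
      qed
      then obtain l where l: "l holomorphic_on ball b r" "\<And>z. z \<in> ball b r \<Longrightarrow> exp (l z) = \<phi> z - \<kappa>"
        using holomorphic_logarithm_exists[of "ball b r" "\<lambda>z. \<phi> z - \<kappa>" b] \<phi>(1) bB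
          holomorphic_on_diff[OF \<phi>(1) holomorphic_on_const[of \<kappa>]] by (metis convex_ball open_ball)
      define c where "c = (E \<kappa> ^^ (m - Suc i)) w"
      have "m - i = Suc (m - Suc i)" using Suc.prems by simp
      hence "E \<kappa> c = \<phi> b" unfolding c_def \<phi>(3) by simp
      \<comment> \<open>Shifting the logarithm by a period makes the new branch send
        \<open>b\<close> to the true orbit point \<open>c\<close>.\<close>
      hence c: "exp (c - l b) = 1"
        using l(2)[OF bB] exp_not_eq_zero[of "l b"] by (simp add: exp_diff E_def eq_diff_eq[symmetric])
      show ?case
      proof (intro exI[of _ "\<lambda>z. l z + (c - l b)"] conjI ballI)
        show "(\<lambda>z. l z + (c - l b)) holomorphic_on ball b r" by (intro holomorphic_intros l)
        fix z assume z: "z \<in> ball b r"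
        have "E \<kappa> (l z + (c - l b)) = \<phi> z"
          unfolding E_def exp_add c using l(2)[OF z] by simp
        thus "(E \<kappa> ^^ Suc i) (l z + (c - l b)) = z"
          using \<phi>(2)[OF z] by (simp add: funpow_swap1)
      qed (simp add: c_def)
    qed
    then obtain \<phi> where \<phi>: "\<phi> holomorphic_on ball b r" "\<And>z. z \<in> ball b r \<Longrightarrow> (E \<kappa> ^^ m) (\<phi> z) = z"
      "\<phi> b = w" using branch[of m] by auto
    have d1: "(\<phi> has_field_derivative deriv \<phi> b) (at b)"
      using \<phi>(1) bB by (meson holomorphic_derivI open_ball)
    have d2: "((E \<kappa> ^^ m) has_field_derivative deriv (E \<kappa> ^^ m) w) (at (\<phi> b))"
      unfolding \<phi>(3) by (rule holomorphic_derivI[OF holomorphic_E_iter open_UNIV]) simp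
    have "((E \<kappa> ^^ m) \<circ> \<phi> has_field_derivative deriv (E \<kappa> ^^ m) w * deriv \<phi> b) (at b)"
      by (rule DERIV_chain[OF d2 d1])
    hence "((\<lambda>z. z) has_field_derivative deriv (E \<kappa> ^^ m) w * deriv \<phi> b) (at b)"
      by (rule has_field_derivative_transform_within_open[OF _ open_ball bB]) (simp add: \<phi>)
    hence "deriv (E \<kappa> ^^ m) w * deriv \<phi> b = 1"
      using DERIV_unique DERIV_ident by blast
    hence *: "norm (deriv (E \<kappa> ^^ m) w) * norm (deriv \<phi> b) = 1"
      by (metis norm_mult norm_one)
    hence "norm (deriv \<phi> b) \<noteq> 0" by auto
    hence "norm (deriv \<phi> b) > 0" by simp
    hence "48 * norm (deriv (E \<kappa> ^^ m) w) * norm (deriv \<phi> b) < r * norm (deriv \<phi> b)"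
      using r by (simp add: m_def)
    hence "48 < r * norm (deriv \<phi> b)" using * by simp
    thus False using inverse_branch_deriv_bound[OF \<phi>(1) k(2) m1 \<phi>(2)] by simp
  qed
  then obtain i v where v: "v \<in> V" and pc: "path_component A ((E \<kappa> ^^ i) v) \<kappa>" by blast
  let ?N = "- escaping_set (E \<kappa>)"
  have EN: "(E \<kappa> ^^ j) ` ?N \<subseteq> ?N" for j by (auto simp: escaping_E_iter_iff)
  \<comment> \<open>Three pieces are concatenated: the path from \<open>(E \<kappa> ^^ i) v\<close>
    to \<kappa>, its image under \<open>E \<kappa> ^^ n\<close>, and the image under
    \<open>E \<kappa> ^^ i\<close> of the path in \<open>V\<close> from \<open>v\<close> to
    \<open>(E \<kappa> ^^ n) v\<close>, which connects the other two.\<close>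
  have pc1: "path_component ?N ((E \<kappa> ^^ i) v) \<kappa>"
    using pc A_nonesc by (rule path_component_of_subset[rotated])
  have pc2: "path_component ?N ((E \<kappa> ^^ n) ((E \<kappa> ^^ i) v)) ((E \<kappa> ^^ n) \<kappa>)"
    by (rule path_component_continuous_image[OF pc1 continuous_on_E_iter EN])
  have "path_component ?N v ((E \<kappa> ^^ n) v)"
    using inv[OF v] V(2) by (auto intro: path_component_of_subset[rotated])
  hence "path_component ?N ((E \<kappa> ^^ i) v) ((E \<kappa> ^^ i) ((E \<kappa> ^^ n) v))"
    by (rule path_component_continuous_image[OF _ continuous_on_E_iter EN])
  also have "(E \<kappa> ^^ i) ((E \<kappa> ^^ n) v) = (E \<kappa> ^^ n) ((E \<kappa> ^^ i) v)"
    by (metis add.commute comp_apply funpow_add)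
  finally have pc3: "path_component ?N ((E \<kappa> ^^ i) v) ((E \<kappa> ^^ n) ((E \<kappa> ^^ i) v))" .
  have "path_component ?N ((E \<kappa> ^^ n) \<kappa>) \<kappa>"
    by (rule path_component_trans[OF path_component_sym[OF pc2]
          path_component_trans[OF path_component_sym[OF pc3] pc1]])
  moreover have "\<kappa> \<in> A" using pc path_component_mem by blast
  then obtain \<delta> where "\<delta> > 0" "ball \<kappa> \<delta> \<subseteq> A" using \<open>open A\<close> openE by blast
  ultimately show ?thesis
    unfolding tame_def using A_nonesc n by blast
qed

section \<open>Attracting and parabolic cycles satisfy the basin criterion\<close>

lemma iterate_fixed_point_deriv:
  assumes "f p = p" "(f has_field_derivative d) (at p)"
  shows "((f ^^ k) has_field_derivative d ^ k) (at p)"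
proof (induction k)
  case (Suc k)
  have "(f ^^ k) p = p" by (induction k) (auto simp: assms(1))
  hence "(f has_field_derivative d) (at ((f ^^ k) p))" using assms(2) by simp
  from DERIV_chain[OF this Suc] show ?case by (simp add: o_def)
qed (auto simp: id_def)

text \<open>\<open>V\<close> is a disc around the periodic point \<open>p\<close> that the return
  map contracts, and \<open>w = p\<close>: the derivatives of the iterates decay geometrically while
  the disc around \<open>p\<close> keeps its radius.\<close>

lemma attracting_imp_tame:
  assumes "attracting_parameter \<kappa>"
  shows "tame \<kappa>"
proof -
  obtain p n where n: "n \<ge> 1" and p: "(E \<kappa> ^^ n) p = p" and lam: "norm (deriv (E \<kappa> ^^ n) p) < 1"
    using assms unfolding attracting_parameter_def has_attracting_cycle_def by blast
  define f where "f = E \<kappa> ^^ n"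
  define c where "c = (1 + norm (deriv f p)) / 2"
  have c: "norm (deriv f p) < c" "c < 1" "c > 0" using lam by (auto simp: c_def f_def add_pos_nonneg)
  have f_der: "(f has_field_derivative deriv f z) (at z)" for z
    unfolding f_def by (rule holomorphic_derivI[OF holomorphic_E_iter open_UNIV]) simp
  have "((\<lambda>z. (f z - f p) / (z - p)) \<longlongrightarrow> deriv f p) (at p)"
    using f_der[of p] by (simp add: has_field_derivative_iff)
  hence "((\<lambda>z. norm ((f z - f p) / (z - p))) \<longlongrightarrow> norm (deriv f p)) (at p)"
    by (rule tendsto_norm)
  hence "eventually (\<lambda>z. norm ((f z - f p) / (z - p)) < c) (at p)"
    using c(1) by (rule order_tendstoD)
  then obtain r where r: "r > 0" "\<And>z. z \<noteq> p \<Longrightarrow> dist z p < r \<Longrightarrow> norm ((f z - f p) / (z - p)) < c"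
    unfolding eventually_at by auto
  have fp: "f p = p" using p by (simp add: f_def)
  have contr: "f z \<in> ball p r" if z: "z \<in> ball p r" for z
  proof (cases "z = p")
    case False
    hence "norm (f z - p) \<le> c * norm (z - p)"
      using r(2)[of z] z fp by (auto simp: norm_divide dist_commute divide_simps split: if_splits)
    also have "\<dots> \<le> 1 * norm (z - p)" using c by (intro mult_right_mono) auto
    finally show ?thesis using z by (auto simp: dist_norm norm_minus_commute)
  qed (use fp r in auto)
  have iter: "(f ^^ k) z \<in> ball p r" if "z \<in> ball p r" for z k
    using that contr by (induction k) auto
  have fk: "E \<kappa> ^^ (n * k) = f ^^ k" for k by (simp add: f_def funpow_mult)
  have fkp: "(f ^^ k) p = p" for k by (induction k) (auto simp: fp)
  have der: "((f ^^ k) has_field_derivative deriv f p ^ k) (at p)" for k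
    by (rule iterate_fixed_point_deriv[OF fp f_der])
  show ?thesis
  proof (rule tameI_singular_value_in_basin[of "ball p r" \<kappa> n p])
    show "ball p r \<inter> escaping_set (E \<kappa>) = {}"
    proof (rule ccontr)
      assume "\<not> ?thesis"
      then obtain z where "z \<in> ball p r" "z \<in> escaping_set (E \<kappa>)" by blast
      thus False using bounded_orbit_not_escaping[OF n bounded_ball, of \<kappa> z p r] iter by (auto simp: fk)
    qed
    show "path_component (ball p r) v ((E \<kappa> ^^ n) v)" if "v \<in> ball p r" for v
      using that contr[OF that] convex_imp_path_connected[OF convex_ball, of p r]
      unfolding path_connected_component by (auto simp: f_def)
    fix M :: real
    have "(\<lambda>k. \<bar>M\<bar> * norm (deriv f p) ^ k) \<longlonglongrightarrow> \<bar>M\<bar> * 0"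
      using lam by (intro tendsto_intros LIMSEQ_power_zero) (auto simp: f_def)
    hence "eventually (\<lambda>k. \<bar>M\<bar> * norm (deriv f p) ^ k < r) sequentially"
      using r(1) by (intro order_tendstoD) auto
    hence "eventually (\<lambda>k. k \<ge> 1 \<and> \<bar>M\<bar> * norm (deriv f p) ^ k < r) sequentially"
      using eventually_ge_at_top by (rule eventually_conj[rotated])
    then obtain k where k: "k \<ge> 1" "\<bar>M\<bar> * norm (deriv f p) ^ k < r"
      unfolding eventually_sequentially by blast
    have "M * norm (deriv f p) ^ k \<le> \<bar>M\<bar> * norm (deriv f p) ^ k" by (intro mult_right_mono) auto
    hence "M * norm (deriv (f ^^ k) p) < r" using k DERIV_imp_deriv[OF der[of k]] by (simp add: norm_power)
    thus "\<exists>k\<ge>1. \<exists>r'>0. ball ((E \<kappa> ^^ (n * k)) p) r' \<subseteq> ball p r \<and>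
                M * norm (deriv (E \<kappa> ^^ (n * k)) p) < r'"
      unfolding fk using k(1) fkp r(1) by (intro exI[of _ k] conjI exI[of _ r]) auto
  qed (use n r in auto)
qed

text \<open>In the cone \<open>norm \<zeta> \<le> 3 * Re \<zeta>\<close> the real part of 1/\<zeta>
  is at least a third of its modulus \<open>t\<close>, which beats the quadratic term. Numerically,
  2/3 - 1/5 = 7/15, half of this is 7/30, and 7/30 - 1/12 = 3/20 still exceeds 1/8. The factor
  describes how the derivative of the iterates shrinks relative to the distance from the parabolic
  point.\<close>

lemma parabolic_factor_norm_le:
  fixes \<zeta> e :: complex
  assumes "norm \<zeta> \<ge> 5" "norm \<zeta> \<le> 3 * Re \<zeta>" "norm e \<le> 1 / 12"
  shows "norm (1 - (1 + e) / \<zeta>) \<le> 1 - 1 / (8 * norm \<zeta>)"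
proof -
  define t where "t = 1 / norm \<zeta>"
  have nz: "\<zeta> \<noteq> 0" using assms(1) by auto
  have t: "0 < t" "t \<le> 1 / 5" using assms(1) nz by (auto simp: t_def divide_simps)
  define y where "y = 1 / \<zeta>"
  have ny: "norm y = t" by (simp add: y_def t_def norm_divide)
  have "Re y = Re \<zeta> / (norm \<zeta>)\<^sup>2" by (simp add: y_def Re_divide cmod_power2)
  also have "\<dots> \<ge> (norm \<zeta> / 3) / (norm \<zeta>)\<^sup>2" using assms(2) by (intro divide_right_mono) auto
  also have "(norm \<zeta> / 3) / (norm \<zeta>)\<^sup>2 = t / 3" using nz by (simp add: t_def power2_eq_square)
  finally have Re: "Re y \<ge> t / 3" .
  have "(norm (1 - y))\<^sup>2 = 1 - 2 * Re y + (norm y)\<^sup>2"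
    unfolding cmod_power2 by (simp add: power2_eq_square algebra_simps)
  also have "\<dots> \<le> 1 - 2 * t / 3 + t * (1 / 5)"
  proof -
    have "t * t \<le> t * (1 / 5)" using t by (intro mult_left_mono) auto
    thus ?thesis unfolding ny power2_eq_square using Re by linarith
  qed
  also have "\<dots> \<le> (1 - 7 * t / 30)\<^sup>2" by (simp add: power2_eq_square algebra_simps)
  finally have "norm (1 - y) \<le> 1 - 7 * t / 30"
    by (rule power2_le_imp_le) (use t in simp)
  moreover have "norm (1 - (1 + e) / \<zeta>) \<le> norm (1 - y) + norm (e * y)"
    using norm_triangle_ineq4[of "1 - y" "e * y"] by (simp add: y_def add_divide_distrib algebra_simps)
  moreover have "norm (e * y) \<le> 1 / 12 * t"
    unfolding norm_mult ny using assms(3) t by (intro mult_right_mono) auto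
  moreover have "1 / (8 * norm \<zeta>) = t / 8" by (simp add: t_def)
  ultimately show ?thesis using t by linarith
qed

lemma inverse_power_deriv_at_0:
  "((\<lambda>y::complex. (inverse ((1 + y) ^ q) - 1) / y) \<longlongrightarrow> - of_nat q) (at 0)"
proof -
  have "((\<lambda>y::complex. inverse ((1 + y) ^ q)) has_field_derivative - of_nat q) (at 0)"
    by (auto intro!: derivative_eq_intros)
  thus ?thesis by (simp add: has_field_derivative_iff)
qed

lemma inverse_power_near_1:
  fixes \<epsilon> :: real assumes "\<epsilon> > 0"
  obtains c where "0 < c" "c < 1" "\<And>y::complex. norm y < c \<Longrightarrow> norm (inverse ((1 + y) ^ q) - 1) \<le> \<epsilon>"
proof -
  have "isCont (\<lambda>y::complex. inverse ((1 + y) ^ q)) 0" by (intro continuous_intros) auto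
  then obtain d where d: "d > 0" "\<And>y::complex. dist y 0 < d \<Longrightarrow> dist (inverse ((1 + y) ^ q)) (inverse ((1 + 0) ^ q)) < \<epsilon>"
    using assms unfolding continuous_at_eps_delta by meson
  show ?thesis
  proof (rule that[of "min d (1/2)"])
    fix y :: complex assume "norm y < min d (1/2)"
    thus "norm (inverse ((1 + y) ^ q) - 1) \<le> \<epsilon>" using d(2)[of y] by (simp add: dist_norm)
  qed (use d in auto)
qed

text \<open>Near a parabolic point the coordinate \<open>\<zeta> = b / u\<^sup>q\<close> turns \<open>u \<mapsto> u (1 + u\<^sup>q h)\<close> into
  \<open>\<zeta> \<mapsto> \<zeta> + 1 + o(1)\<close>, uniformly along the segment from a point to its image.\<close>

lemma parabolic_local_estimates:
  fixes h :: "complex \<Rightarrow> complex"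
  assumes h: "h holomorphic_on ball p r" "h p \<noteq> 0" and "r > 0" "q \<ge> 1"
    and b: "b = - 1 / (of_nat q * h p)"
  obtains \<rho> where "0 < \<rho>" "\<rho> < r"
    "\<And>u s. \<lbrakk>u \<noteq> 0; norm u < \<rho>; 0 \<le> s; s \<le> 1\<rbrakk> \<Longrightarrow> 1 + of_real s * (u ^ q * h (p + u)) \<noteq> 0 \<and>
        norm (b / (u * (1 + of_real s * (u ^ q * h (p + u)))) ^ q - b / u ^ q - of_real s) \<le> s / 2"
    "\<And>u. \<lbrakk>u \<noteq> 0; norm u < \<rho>\<rbrakk> \<Longrightarrow>
        norm (b * (of_nat q * h (p + u) + u * deriv h (p + u)) / (1 + u ^ q * h (p + u)) + 1) \<le> 1 / 12"
proof -
  have pb: "p \<in> ball p r" using assms by simp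
  have "isCont h p" "isCont (deriv h) p"
    using h(1) pb by (auto intro!: continuous_on_interior holomorphic_on_imp_continuous_on
       holomorphic_deriv simp: interior_open)
  hence hl: "((\<lambda>u. h (p + u)) \<longlongrightarrow> h p) (at 0)" and dl: "((\<lambda>u. deriv h (p + u)) \<longlongrightarrow> deriv h p) (at 0)"
    by (auto simp: isCont_iff)
  have q0: "of_nat q \<noteq> (0::complex)" using assms(4) by simp
  \<comment> \<open>This normalisation of \<open>b\<close> is what makes the coordinate advance by
    1.\<close>
  have bq: "b * (of_nat q * h p) = -1" using h(2) q0 by (simp add: b)
  have xl: "((\<lambda>u. u ^ q * h (p + u)) \<longlongrightarrow> 0 ^ q * h p) (at 0)"
    by (intro tendsto_intros hl)
  moreover have "(0::complex) ^ q = 0" using assms(4) by (simp add: power_0_left)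
  ultimately have x0: "((\<lambda>u. u ^ q * h (p + u)) \<longlongrightarrow> 0) (at 0)" by simp
  have "((\<lambda>u. b * (of_nat q * h (p + u) + u * deriv h (p + u)) / (1 + u ^ q * h (p + u)) + 1) \<longlongrightarrow>
      b * (of_nat q * h p + 0 * deriv h p) / (1 + 0) + 1) (at 0)"
    by (intro tendsto_intros hl dl x0) auto
  hence e1: "eventually (\<lambda>u. norm (b * (of_nat q * h (p + u) + u * deriv h (p + u)) / (1 + u ^ q * h (p + u)) + 1) < 1 / 12) (at 0)"
    using bq by (intro order_tendstoD(2)[of _ "norm (0::complex)"] tendsto_norm) auto
  have "((\<lambda>u. of_nat q * (b * h (p + u)) + 1) \<longlongrightarrow> of_nat q * (b * h p) + 1) (at 0)"
    by (intro tendsto_intros hl)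
  hence e2: "eventually (\<lambda>u. norm (of_nat q * (b * h (p + u)) + 1) < 1 / 4) (at 0)"
    using bq by (intro order_tendstoD(2)[of _ "norm (0::complex)"] tendsto_norm) (auto simp: mult_ac)
  have "eventually (\<lambda>y. dist ((inverse ((1 + y) ^ q) - 1) / y) (- of_nat q) < 1 / 8) (at (0::complex))"
    by (rule tendstoD[OF inverse_power_deriv_at_0]) simp
  then obtain \<eta> where \<eta>: "\<eta> > 0" "\<And>y::complex. y \<noteq> 0 \<Longrightarrow> norm y < \<eta> \<Longrightarrow>
      norm ((inverse ((1 + y) ^ q) - 1) / y + of_nat q) < 1 / 8"
    unfolding eventually_at by (auto simp: dist_norm)
  have e3: "eventually (\<lambda>u. norm (u ^ q * h (p + u)) < min \<eta> (1/2)) (at 0)"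
    using \<eta>(1) x0 by (intro order_tendstoD(2)[of _ "norm (0::complex)"] tendsto_norm) auto
  have e4: "eventually (\<lambda>u. h (p + u) \<noteq> 0) (at 0)"
    using hl h(2) by (rule tendsto_imp_eventually_ne)
  from eventually_conj[OF eventually_conj[OF e1 e2] eventually_conj[OF e3 e4]]
  obtain \<rho> where \<rho>: "\<rho> > 0" "\<And>u. u \<noteq> 0 \<Longrightarrow> norm u < \<rho> \<Longrightarrow>
      norm (b * (of_nat q * h (p + u) + u * deriv h (p + u)) / (1 + u ^ q * h (p + u)) + 1) < 1 / 12 \<and>
      norm (of_nat q * (b * h (p + u)) + 1) < 1 / 4 \<and>
      norm (u ^ q * h (p + u)) < min \<eta> (1/2) \<and> h (p + u) \<noteq> 0"
    unfolding eventually_at by (auto simp: dist_norm)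
  show thesis
  proof (rule that[of "min \<rho> (r/2)"])
    fix u s assume u: "u \<noteq> (0::complex)" "norm u < min \<rho> (r/2)" and s: "(0::real) \<le> s" "s \<le> 1"
    define H where "H = h (p + u)"
    define y where "y = of_real s * (u ^ q * H)"
    note \<rho>u = \<rho>(2)[OF u(1), folded H_def]
    have "norm y \<le> 1 * norm (u ^ q * H)" unfolding y_def norm_mult[of "of_real s"] using s by (intro mult_right_mono) auto
    hence ny: "norm y < \<eta>" "norm y < 1/2" using \<rho>u u by auto
    have y1: "1 + y \<noteq> 0"
    proof
      assume "1 + y = 0"
      hence "y = -1" by (simp add: eq_neg_iff_add_eq_0 add.commute)
      thus False using ny(2) by simp
    qed
    have "norm (b / (u * (1 + y)) ^ q - b / u ^ q - of_real s) \<le> s / 2"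
    proof (cases "s = 0")
      case False
      hence y0: "y \<noteq> 0" using \<rho>u u by (simp add: y_def)
      define \<psi> where "\<psi> = (inverse ((1 + y) ^ q) - 1) / y"
      have "b / (u * (1 + y)) ^ q - b / u ^ q = b / u ^ q * (inverse ((1 + y) ^ q) - 1)"
        unfolding power_mult_distrib using u y1 by (simp add: field_simps)
      also have "\<dots> = b / u ^ q * (\<psi> * y)" using y0 by (simp add: \<psi>_def)
      also have "\<dots> = of_real s * (b * H * \<psi>)" using u by (simp add: y_def)
      finally have eq: "b / (u * (1 + y)) ^ q - b / u ^ q - of_real s = of_real s * (b * H * (\<psi> + of_nat q) - (of_nat q * (b * H) + 1))"
        by (simp add: algebra_simps)
      \<comment> \<open>Two errors remain: the Taylor error of the inverse power, at most 2 * 1/8,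
        and the deviation of \<open>of_nat q * (b * H)\<close> from -1, at most 1/4. Together they
        give the claimed 1/2.\<close>
      have q1: "norm (of_nat q * (b * H) + 1) < 1 / 4" using \<rho>u u by simp
      have "norm (of_nat q * (b * H)) \<le> norm (of_nat q * (b * H) + 1) + 1"
        using norm_triangle_ineq4[of "of_nat q * (b * H) + 1" 1] by simp
      hence "real q * norm (b * H) \<le> 2" using q1 by (simp add: norm_mult)
      moreover have "1 * norm (b * H) \<le> real q * norm (b * H)" using assms(4) by (intro mult_right_mono) auto
      ultimately have bH: "norm (b * H) \<le> 2" by linarith
      have "norm (b * H * (\<psi> + of_nat q)) \<le> 2 * (1 / 8)"
        unfolding norm_mult[of "b * H"] using bH \<eta>(2)[OF y0 ny(1)]
        by (intro mult_mono) (auto simp: \<psi>_def)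
      hence "norm (b * H * (\<psi> + of_nat q) - (of_nat q * (b * H) + 1)) \<le> 1 / 2"
        using q1 norm_triangle_ineq4[of "b * H * (\<psi> + of_nat q)" "of_nat q * (b * H) + 1"] by linarith
      hence "s * norm (b * H * (\<psi> + of_nat q) - (of_nat q * (b * H) + 1)) \<le> s * (1 / 2)"
        using s by (intro mult_left_mono)
      thus ?thesis unfolding eq norm_mult[of "of_real s"] using s by simp
    qed (simp add: y_def)
    thus "1 + of_real s * (u ^ q * h (p + u)) \<noteq> 0 \<and>
        norm (b / (u * (1 + of_real s * (u ^ q * h (p + u)))) ^ q - b / u ^ q - of_real s) \<le> s / 2"
      using y1 by (simp add: y_def H_def)
  next
    fix u :: complex assume "u \<noteq> 0" "norm u < min \<rho> (r/2)"
    thus "norm (b * (of_nat q * h (p + u) + u * deriv h (p + u)) / (1 + u ^ q * h (p + u)) + 1) \<le> 1 / 12"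
      using \<rho>(2)[of u] by auto
  qed (use \<rho> \<open>r > 0\<close> in auto)
qed

text \<open>\<open>V\<close> is the preimage of a half-plane under \<zeta>, that is, all
  \<open>q\<close> attracting petals at once. Along an orbit in it \<zeta> moves to the right at
  roughly unit speed, \<open>V\<close> contains discs of radius comparable to the distance from
  \<open>p\<close>, and the derivative of the iterates is of smaller order than this
  distance.\<close>

lemma parabolic_imp_tame:
  assumes "parabolic_parameter \<kappa>"
  shows "tame \<kappa>"
proof -
  obtain p n0 m where n0: "n0 \<ge> 1" and p0: "(E \<kappa> ^^ n0) p = p" and m: "m \<ge> 1"
    and root: "deriv (E \<kappa> ^^ n0) p ^ m = 1"
    using assms unfolding parabolic_parameter_def has_parabolic_cycle_def by blast
  \<comment> \<open>Going round the cycle \<open>m\<close> times turns the multiplier, a root of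
    unity, into 1.\<close>
  define n where "n = n0 * m"
  define f where "f = E \<kappa> ^^ n"
  have n: "n \<ge> 1" using n0 m by (simp add: n_def)
  have fpow: "f = (E \<kappa> ^^ n0) ^^ m" by (simp add: f_def n_def funpow_mult)
  have f_der: "(f has_field_derivative deriv f z) (at z)" for z
    unfolding f_def by (rule holomorphic_derivI[OF holomorphic_E_iter open_UNIV]) simp
  have "((E \<kappa> ^^ n0) has_field_derivative deriv (E \<kappa> ^^ n0) p) (at p)"
    by (rule holomorphic_derivI[OF holomorphic_E_iter open_UNIV]) simp
  from iterate_fixed_point_deriv[OF p0 this, of m] have fd1: "(f has_field_derivative 1) (at p)"
    by (simp add: fpow root)
  have fp: "f p = p" unfolding fpow by (induction m) (auto simp: p0)
  have fk: "E \<kappa> ^^ (n * k) = f ^^ k" for k by (simp add: f_def funpow_mult)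

  define d where "d = (\<lambda>z. f z - z)"
  have d_hol: "d holomorphic_on UNIV" unfolding d_def f_def by (intro holomorphic_intros holomorphic_E_iter)
  \<comment> \<open>A constant difference would make \<open>f\<close> the identity, but
    \<open>f\<close> has period 2 pi i.\<close>
  have nonconst: "\<not> d constant_on UNIV"
  proof
    assume "d constant_on UNIV"
    hence "d (p + 2 * pi * \<i>) = d p" by (auto simp: constant_on_def)
    hence "f (p + 2 * pi * \<i>) = p + 2 * pi * \<i>" using fp by (simp add: d_def)
    moreover have "f (p + 2 * pi * \<i>) = f p"
    proof -
      obtain n' where "n = Suc n'" using n by (cases n) auto
      moreover have "exp (p + 2 * pi * \<i>) = exp p" by (simp add: exp_add mult_ac)
      ultimately show ?thesis unfolding f_def by (simp only: funpow_Suc_right o_def E_def)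
    qed
    ultimately show False using fp by simp
  qed
  have dp: "d p = 0" using fp by (simp add: d_def)
  obtain h r N where N: "0 < N" and r: "0 < r" and h: "h holomorphic_on ball p r"
    and dh: "\<And>z. z \<in> ball p r \<Longrightarrow> d z = (z - p) ^ N * h z" and h0: "\<And>z. z \<in> ball p r \<Longrightarrow> h z \<noteq> 0"
    using holomorphic_factor_zero_nonconstant[OF d_hol open_UNIV connected_UNIV UNIV_I dp nonconst] by metis
  have pb: "p \<in> ball p r" using r by simp
  have hder: "(h has_field_derivative deriv h z) (at z)" if "z \<in> ball p r" for z
    using h that by (meson holomorphic_derivI open_ball)
  have "N \<noteq> 1"
  proof
    assume N1: "N = 1"
    have "((\<lambda>z. (z - p) * h z) has_field_derivative h p) (at p)"
      using hder[OF pb] by (auto intro!: derivative_eq_intros)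
    hence "(d has_field_derivative h p) (at p)"
      by (rule has_field_derivative_transform_within_open[OF _ open_ball pb]) (simp add: dh N1)
    moreover have "(d has_field_derivative 1 - 1) (at p)" unfolding d_def by (intro derivative_intros fd1)
    ultimately have "h p = 1 - 1" by (rule DERIV_unique)
    thus False using h0[OF pb] by simp
  qed
  define q where "q = N - 1"
  have q: "q \<ge> 1" "N = Suc q" using N \<open>N \<noteq> 1\<close> by (auto simp: q_def)
  have fh: "f z = z + (z - p) ^ Suc q * h z" if "z \<in> ball p r" for z
    using dh[OF that] by (simp add: d_def q(2) algebra_simps)

  define b where "b = - 1 / (of_nat q * h p)"
  have b0: "b \<noteq> 0" using h0[OF pb] q by (simp add: b_def)
  obtain \<rho> where \<rho>: "0 < \<rho>" "\<rho> < r"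
    and seg: "\<And>u s. \<lbrakk>u \<noteq> 0; norm u < \<rho>; 0 \<le> s; s \<le> 1\<rbrakk> \<Longrightarrow> 1 + of_real s * (u ^ q * h (p + u)) \<noteq> 0 \<and>
        norm (b / (u * (1 + of_real s * (u ^ q * h (p + u)))) ^ q - b / u ^ q - of_real s) \<le> s / 2"
    and ratio: "\<And>u. \<lbrakk>u \<noteq> 0; norm u < \<rho>\<rbrakk> \<Longrightarrow>
        norm (b * (of_nat q * h (p + u) + u * deriv h (p + u)) / (1 + u ^ q * h (p + u)) + 1) \<le> 1 / 12"
    using parabolic_local_estimates[OF h h0[OF pb] r q(1) b_def] by blast
  \<comment> \<open>The quotient forces \<open>V\<close> into the disc of radius \<rho>; the added 5
    keeps \<open>norm (\<zeta> z)\<close> above the bound required by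
    \<open>parabolic_factor_norm_le\<close>.\<close>
  define R where "R = norm b / \<rho> ^ q + 5"
  have R: "R \<ge> 5" using \<rho> by (simp add: R_def)
  define \<zeta> where "\<zeta> = (\<lambda>z. b / (z - p) ^ q)"
  define V where "V = {z \<in> - {p}. \<zeta> z \<in> {w. R < Re w}}"
  have "continuous_on (- {p}) \<zeta>" unfolding \<zeta>_def by (intro continuous_intros) auto
  hence openV: "open V" 
    using continuous_open_preimage[of "- {p}" \<zeta> "{w. R < Re w}"] open_halfspace_Re_gt
      open_Compl[OF closed_singleton[of p]]
    by (simp add: V_def vimage_def Int_def)
  have V_small: "norm (z - p) < \<rho>" if "z \<in> V" for z
  proof -
    have zp: "z \<noteq> p" and "R < Re (\<zeta> z)" using that by (auto simp: V_def)
    hence "R < norm (\<zeta> z)" using complex_Re_le_cmod[of "\<zeta> z"] by linarith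
    hence "norm b / \<rho> ^ q < norm b / norm (z - p) ^ q" by (simp add: R_def \<zeta>_def norm_divide norm_power)
    moreover have "norm b / norm (z - p) ^ q \<le> norm b / \<rho> ^ q" if "\<rho> ^ q \<le> norm (z - p) ^ q"
      using that \<rho>(1) zp by (intro divide_left_mono mult_pos_pos) auto
    ultimately have "norm (z - p) ^ q < \<rho> ^ q" by linarith
    thus ?thesis by (rule power_less_imp_less_base) (use \<rho>(1) in simp)
  qed
  have segment: "z + of_real s * (f z - z) \<in> V \<and> norm (\<zeta> (z + of_real s * (f z - z)) - \<zeta> z - of_real s) \<le> s / 2"
    if z: "z \<in> V" and s: "0 \<le> s" "s \<le> 1" for z s
  proof -
    define u where "u = z - p"
    have u: "u \<noteq> 0" "norm u < \<rho>" "p + u = z" using z V_small[OF z] by (auto simp: u_def V_def)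
    have "z \<in> ball p r" using V_small[OF z] \<rho> by (simp add: dist_norm norm_minus_commute)
    from fh[OF this] have fz: "f z - z = u * (u ^ q * h z)" by (simp add: u_def)
    have zs: "z + of_real s * (f z - z) - p = u * (1 + of_real s * (u ^ q * h z))"
      unfolding fz by (simp add: u_def distrib_left mult_ac)
    note sg = seg[OF u(1,2) s, unfolded u(3)]
    have est: "norm (\<zeta> (z + of_real s * (f z - z)) - \<zeta> z - of_real s) \<le> s / 2"
      using sg unfolding \<zeta>_def zs u_def[symmetric] by blast
    hence "\<bar>Re (\<zeta> (z + of_real s * (f z - z)) - \<zeta> z - of_real s)\<bar> \<le> s / 2"
      by (rule order_trans[OF abs_Re_le_cmod])
    moreover have "R < Re (\<zeta> z)" using z by (simp add: V_def)
    ultimately have "R < Re (\<zeta> (z + of_real s * (f z - z)))"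
      using s unfolding minus_complex.sel Re_complex_of_real by linarith
    moreover have "u * (1 + of_real s * (u ^ q * h z)) \<noteq> 0" using sg u by simp
    hence "z + of_real s * (f z - z) \<noteq> p" unfolding zs[symmetric] by auto
    ultimately show ?thesis using est by (simp add: V_def)
  qed
  have fV: "f z \<in> V" "norm (\<zeta> (f z) - \<zeta> z - 1) \<le> 1 / 2" if "z \<in> V" for z
    using segment[OF that, of 1] by auto
  have iterV: "(f ^^ k) z \<in> V" if "z \<in> V" for z k using that fV by (induction k) auto

  \<comment> \<open>Starting beyond twice \<open>R\<close> leaves room for the discs in
    \<open>ballV\<close>, on which \<open>Re (\<zeta> z)\<close> may drop to half its central
    value.\<close>
  define a where "a = 2 * R + 2"
  have a: "a \<ge> 10" "R < a / 2" using R by (auto simp: a_def)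
  obtain u0 where u0: "b / of_real a = u0 ^ q"
    using exists_complex_root[of q "b / of_real a"] q(1) by auto
  define w where "w = p + u0"
  have u0n: "u0 \<noteq> 0" using u0 b0 a q(1) by (auto simp: power_0_left)
  have \<zeta>w: "\<zeta> w = of_real a" using u0 b0 a u0n by (simp add: \<zeta>_def w_def flip: u0)
  have wV: "w \<in> V" using \<zeta>w u0n R by (simp add: V_def w_def a_def)
  define x where "x = (\<lambda>k. (f ^^ k) w)"
  have xV: "x k \<in> V" for k using iterV wV by (simp add: x_def)
  have xS: "x (Suc k) = f (x k)" for k by (simp add: x_def)
  have Re_x: "Re (\<zeta> (x k)) \<ge> a + k / 2" for k
  proof (induction k)
    case (Suc k)
    have "\<bar>Re (\<zeta> (x (Suc k)) - \<zeta> (x k) - 1)\<bar> \<le> 1/2"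
      unfolding xS by (rule order_trans[OF abs_Re_le_cmod fV(2)[OF xV]])
    hence "Re (\<zeta> (x (Suc k))) \<ge> Re (\<zeta> (x k)) + 1 / 2"
      unfolding minus_complex.sel one_complex.sel by linarith
    thus ?case using Suc by (simp add: field_simps)
  qed (simp add: x_def \<zeta>w)
  have norm_x: "norm (\<zeta> (x k)) \<le> a + 3 * k / 2" for k
  proof (induction k)
    case (Suc k)
    have "norm (\<zeta> (x (Suc k))) \<le> norm (\<zeta> (x (Suc k)) - \<zeta> (x k) - 1) + norm (\<zeta> (x k) + 1)"
      using norm_triangle_ineq[of "\<zeta> (x (Suc k)) - \<zeta> (x k) - 1" "\<zeta> (x k) + 1"] by simp
    moreover have "norm (\<zeta> (x k) + 1) \<le> norm (\<zeta> (x k)) + 1"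
      using norm_triangle_ineq[of "\<zeta> (x k)" 1] by simp
    ultimately have "norm (\<zeta> (x (Suc k))) \<le> norm (\<zeta> (x k)) + 3 / 2"
      using fV(2)[OF xV[of k]] unfolding xS by linarith
    thus ?case using Suc by (simp add: field_simps)
  qed (use a in \<open>simp add: x_def \<zeta>w\<close>)
  \<comment> \<open>The modulus grows at rate at most 3/2 and the real part at rate at least 1/2,
    both from \<open>a\<close>; this is the origin of the 3.\<close>
  have cone: "norm (\<zeta> (x k)) \<le> 3 * Re (\<zeta> (x k))" for k
    using Re_x[of k] norm_x[of k] a by (simp add: field_simps)

  \<comment> \<open>In the cone, a relative change of 1/6 in \<zeta> costs at most 3 * 1/6 = 1/2 of
    its real part.\<close>
  obtain c where c: "0 < c" "c < 1" and c_near: "\<And>y::complex. norm y < c \<Longrightarrow> norm (inverse ((1 + y) ^ q) - 1) \<le> 1 / 6"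
    using inverse_power_near_1[of "1/6" q] by auto
  have ballV: "ball (x k) (c * norm (x k - p)) \<subseteq> V" for k
  proof
    fix z assume z: "z \<in> ball (x k) (c * norm (x k - p))"
    have xp: "x k - p \<noteq> 0" using xV[of k] by (auto simp: V_def)
    define y where "y = (z - x k) / (x k - p)"
    have ny: "norm y < c" using z xp by (simp add: y_def norm_divide divide_simps dist_norm norm_minus_commute)
    have zp: "z - p = (x k - p) * (1 + y)" using xp by (simp add: y_def field_simps)
    have y1: "1 + y \<noteq> 0"
    proof
      assume "1 + y = 0"
      hence "y = -1" by (simp add: eq_neg_iff_add_eq_0 add.commute)
      thus False using ny c by simp
    qed
    have "\<zeta> z - \<zeta> (x k) = \<zeta> (x k) * (inverse ((1 + y) ^ q) - 1)"
      unfolding \<zeta>_def zp power_mult_distrib using xp y1 by (simp add: field_simps)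
    hence "norm (\<zeta> z - \<zeta> (x k)) \<le> norm (\<zeta> (x k)) * (1 / 6)"
      using mult_left_mono[OF c_near[OF ny] norm_ge_zero[of "\<zeta> (x k)"]] by (simp only: norm_mult)
    hence "norm (\<zeta> z - \<zeta> (x k)) \<le> Re (\<zeta> (x k)) / 2" using cone[of k] by simp
    hence "\<bar>Re (\<zeta> z - \<zeta> (x k))\<bar> \<le> Re (\<zeta> (x k)) / 2" by (rule order_trans[OF abs_Re_le_cmod])
    hence "Re (\<zeta> z) \<ge> Re (\<zeta> (x k)) / 2" unfolding minus_complex.sel by linarith
    moreover have "Re (\<zeta> (x k)) \<ge> a" using Re_x[of k] by linarith
    moreover have "z \<noteq> p" using zp xp y1 by auto
    ultimately show "z \<in> V" using a by (simp add: V_def)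
  qed

  \<comment> \<open>The discs available in \<open>V\<close> have radius
    \<open>c * norm (x k - p)\<close>, so the derivative is measured against this distance; the aim
    is that \<open>D\<close> tends to 0.\<close>
  define D where "D = (\<lambda>k. norm (deriv (f ^^ k) w) / norm (x k - p))"
  have derk: "((f ^^ k) has_field_derivative deriv (f ^^ k) w) (at w)" for k
    unfolding fk[symmetric] by (rule holomorphic_derivI[OF holomorphic_E_iter open_UNIV]) simp
  have D_step: "D (Suc k) \<le> D k * (1 - 1 / (8 * norm (\<zeta> (x k))))" for k
  proof -
    define u where "u = x k - p"
    define H where "H = h (x k)"
    define H' where "H' = deriv h (x k)"
    have u: "u \<noteq> 0" "norm u < \<rho>" "p + u = x k" using xV[of k] V_small[OF xV[of k]] by (auto simp: u_def V_def)
    have xb: "x k \<in> ball p r" using V_small[OF xV[of k]] \<rho> by (simp add: dist_norm norm_minus_commute)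
    have pw: "(x k - p) ^ q = (x k - p) * (x k - p) ^ (q - 1)" using q(1) by (simp add: power_eq_if)
    have "((\<lambda>z. z + (z - p) ^ Suc q * h z) has_field_derivative
        (1 + (of_nat (Suc q) * (x k - p) ^ q * h (x k) + (x k - p) ^ Suc q * deriv h (x k)))) (at (x k))"
      using hder[OF xb] by (auto intro!: derivative_eq_intros simp: pw algebra_simps)
    hence fder: "(f has_field_derivative
        (1 + (of_nat (Suc q) * (x k - p) ^ q * h (x k) + (x k - p) ^ Suc q * deriv h (x k)))) (at (x k))"
      by (rule has_field_derivative_transform_within_open[OF _ open_ball xb]) (simp add: fh)
    define G where "G = 1 + (of_nat (Suc q) * u ^ q * H + u ^ Suc q * H')"
    have "((f ^^ Suc k) has_field_derivative G * deriv (f ^^ k) w) (at w)"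
      using DERIV_chain[OF fder[unfolded x_def] derk[of k]] by (simp add: o_def G_def u_def H_def H'_def x_def)
    hence dS: "deriv (f ^^ Suc k) w = G * deriv (f ^^ k) w" by (rule DERIV_imp_deriv)
    have xSp: "x (Suc k) - p = u * (1 + u ^ q * H)"
      unfolding xS using fh[OF xb] by (simp add: u_def H_def algebra_simps)
    have uH: "1 + u ^ q * H \<noteq> 0" using seg[OF u(1,2), of 1] by (simp add: u(3) H_def)
    \<comment> \<open>\<open>G\<close> is the factor gained by the derivative and
      \<open>1 + u ^ q * H\<close> the one gained by the distance. As 1/\<zeta> equals
      \<open>u ^ q / b\<close>, their quotient has the form 1 - (1 + e) / \<zeta>, and
      \<open>ratio\<close> makes \<open>e\<close> small.\<close>
    define e where "e = - (b * (of_nat q * H + u * H') / (1 + u ^ q * H) + 1)"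
    have ne: "norm e \<le> 1 / 12" unfolding e_def norm_minus_cancel
      using ratio[OF u(1,2)] by (simp add: u(3) H_def H'_def)
    have \<zeta>x: "\<zeta> (x k) = b / u ^ q" by (simp add: \<zeta>_def u_def)
    have "1 - (1 + e) / \<zeta> (x k) = 1 + u ^ q * ((of_nat q * H + u * H') / (1 + u ^ q * H))"
      using b0 u by (simp add: \<zeta>x e_def)
    also have "\<dots> = G / (1 + u ^ q * H)" using uH by (simp add: G_def field_simps)
    finally have GM: "norm (G / (1 + u ^ q * H)) = norm (1 - (1 + e) / \<zeta> (x k))" by simp
    have "D (Suc k) = D k * norm (G / (1 + u ^ q * H))"
      unfolding D_def dS xSp u_def[symmetric] by (simp add: norm_mult norm_divide)
    also have "\<dots> \<le> D k * (1 - 1 / (8 * norm (\<zeta> (x k))))"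
    proof (rule mult_left_mono)
      have "norm (\<zeta> (x k)) \<ge> 5" using Re_x[of k] complex_Re_le_cmod[of "\<zeta> (x k)"] a by linarith
      thus "norm (G / (1 + u ^ q * H)) \<le> 1 - 1 / (8 * norm (\<zeta> (x k)))"
        unfolding GM using parabolic_factor_norm_le[OF _ cone ne] by blast
    qed (simp add: D_def)
    finally show ?thesis .
  qed
  \<comment> \<open>\<open>(1 - 1/(8y)) (y + 2)\<^sup>1\<^sup>/\<^sup>1\<^sup>6 \<le> y\<^sup>1\<^sup>/\<^sup>1\<^sup>6\<close> turns the divergence of the sum of \<open>1/y\<close> into a telescoping bound.\<close>
  have D_decay: "D k * (a + 2 * k) powr (1/16) \<le> D 0 * a powr (1/16)" for k
  proof (induction k)
    case (Suc k)
    define y where "y = a + 2 * k"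
    have y: "y \<ge> 10" using a by (simp add: y_def)
    have "norm (\<zeta> (x k)) \<le> y" using norm_x[of k] by (simp add: y_def)
    moreover have "norm (\<zeta> (x k)) > 0" using Re_x[of k] complex_Re_le_cmod[of "\<zeta> (x k)"] a by linarith
    ultimately have 1: "1 - 1 / (8 * norm (\<zeta> (x k))) \<le> 1 - 1 / (8 * y)" by (simp add: frac_le)
    have 2: "(1 - 1 / (8 * y)) * (y + 2) powr (1/16) \<le> y powr (1/16)"
    proof -
      have "1 - 1 / (8 * y) \<le> exp (- (1 / (8 * y)))" using exp_ge_add_one_self[of "- (1 / (8 * y))"] by simp
      moreover have "(y + 2) powr (1/16) \<le> y powr (1/16) * exp (1 / (8 * y))"
      proof -
        have "y + 2 = y * (1 + 2 / y)" using y by (simp add: field_simps)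
        hence "ln (y + 2) = ln (y * (1 + 2 / y))" by simp
        also have "\<dots> = ln y + ln (1 + 2 / y)" using y by (intro ln_mult_pos add_pos_nonneg) auto
        also have "ln (1 + 2 / y) \<le> 2 / y" using y by (intro ln_add_one_self_le_self) auto
        finally have "exp (ln (y + 2) / 16) \<le> exp (ln y / 16 + 1 / (8 * y))" by simp
        thus ?thesis using y by (simp add: powr_def exp_add)
      qed
      ultimately have "(1 - 1 / (8 * y)) * (y + 2) powr (1/16) \<le> exp (- (1 / (8 * y))) * (y powr (1/16) * exp (1 / (8 * y)))"
        using y by (intro mult_mono) auto
      thus ?thesis by (simp add: exp_minus field_simps)
    qed
    have D0: "D k \<ge> 0" by (simp add: D_def)
    have "D (Suc k) \<le> D k * (1 - 1 / (8 * y))"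
      by (rule order_trans[OF D_step mult_left_mono[OF 1 D0]])
    hence "D (Suc k) * (y + 2) powr (1/16) \<le> D k * (1 - 1 / (8 * y)) * (y + 2) powr (1/16)"
      by (rule mult_right_mono) simp
    moreover have "a + real (2 * Suc k) = y + 2" by (simp add: y_def)
    ultimately have "D (Suc k) * (a + 2 * Suc k) powr (1/16) \<le> D k * (1 - 1 / (8 * y)) * (y + 2) powr (1/16)"
      by (simp only:)
    also have "\<dots> \<le> D k * y powr (1/16)" using mult_left_mono[OF 2 D0] by (simp add: mult_ac)
    finally show ?case using Suc by (simp add: y_def)
  qed simp

  show ?thesis
  proof (rule tameI_singular_value_in_basin[OF openV _ n _ wV])
    show "V \<inter> escaping_set (E \<kappa>) = {}"
    proof (rule ccontr)
      assume "\<not> ?thesis"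
      then obtain z where z: "z \<in> V" "z \<in> escaping_set (E \<kappa>)" by blast
      have "V \<subseteq> ball p \<rho>" using V_small by (auto simp: dist_norm norm_minus_commute)
      hence "bounded V" using bounded_ball bounded_subset by blast
      thus False using bounded_orbit_not_escaping[OF n, of V \<kappa> z] iterV z by (auto simp: fk)
    qed
    show "path_component V v ((E \<kappa> ^^ n) v)" if "v \<in> V" for v
      unfolding path_component_def f_def[symmetric]
    proof (intro exI conjI)
      show "path_image (linepath v (f v)) \<subseteq> V"
      proof
        fix z assume "z \<in> path_image (linepath v (f v))"
        then obtain s where s: "0 \<le> s" "s \<le> 1" "z = (1 - s) *\<^sub>R v + s *\<^sub>R f v"
          by (auto simp: closed_segment_def)
        have "z = v + of_real s * (f v - v)" unfolding s by (simp add: scaleR_conv_of_real algebra_simps)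
        thus "z \<in> V" using segment[OF that s(1,2)] by simp
      qed
    qed auto
    fix M :: real
    \<comment> \<open>Once \<open>(a + 2 * k) powr (1/16)\<close> reaches \<open>B\<close>, the
      decay of \<open>D\<close> gives \<open>\<bar>M\<bar> * D k < c\<close>.\<close>
    define B where "B = (\<bar>M\<bar> * (D 0 * a powr (1/16)) + 1) / c"
    have "B > 0" using c a by (simp add: B_def D_def add_nonneg_pos)
    define k where "k = max 1 (nat \<lceil>B powr 16\<rceil>)"
    have "B powr 16 \<le> a + 2 * real k" using a unfolding k_def by linarith
    hence "(B powr 16) powr (1/16) \<le> (a + 2 * real k) powr (1/16)" by (intro powr_mono2) auto
    moreover have "(B powr 16) powr (1/16) = B" unfolding powr_powr using \<open>B > 0\<close> by simp
    ultimately have k: "(\<bar>M\<bar> * (D 0 * a powr (1/16)) + 1) / c \<le> (a + 2 * real k) powr (1/16)" "k \<ge> 1"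
      unfolding B_def[symmetric] by (auto simp: k_def)
    define y where "y = (a + 2 * real k) powr (1/16)"
    have y: "y > 0" using a by (simp add: y_def)
    have "(\<bar>M\<bar> * D k) * y \<le> \<bar>M\<bar> * (D 0 * a powr (1/16))"
      using mult_left_mono[OF D_decay[of k], of "\<bar>M\<bar>"] by (simp add: y_def mult_ac)
    also have "\<dots> < c * y" using k(1) c by (simp add: y_def divide_simps mult_ac)
    finally have "\<bar>M\<bar> * D k < c" using y by simp
    moreover have "M * D k \<le> \<bar>M\<bar> * D k" by (intro mult_right_mono) (auto simp: D_def)
    moreover have xp: "norm (x k - p) > 0" using xV[of k] by (auto simp: V_def)
    ultimately have "M * norm (deriv (f ^^ k) w) < c * norm (x k - p)"
      by (simp add: D_def divide_simps)
    thus "\<exists>k\<ge>1. \<exists>r>0. ball ((E \<kappa> ^^ (n * k)) w) r \<subseteq> V \<and> M * norm (deriv (E \<kappa> ^^ (n * k)) w) < r"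
      using k(2) ballV[of k] xp c unfolding fk
      by (intro exI[of _ k] conjI exI[of _ "c * norm (x k - p)"]) (auto simp: x_def)
  qed
qed

section \<open>A barrier curve in the non-escaping set\<close>

text \<open>From some time on \<open>Re (\<gamma> t)\<close> differs from
  \<open>Re \<kappa>\<close>, so the exponential of the lift has nonzero real part and
  \<open>Im (v t)\<close> cannot cross a zero of the cosine; these are spaced by pi. The time before
  is handled by compactness. The real part of the lift is the logarithm of an unbounded
  modulus.\<close>

lemma unbounded_curve_log_lift:
  fixes \<gamma> :: "real \<Rightarrow> complex"
  assumes cont: "continuous_on {a..} \<gamma>" and ne: "\<And>t. t \<ge> a \<Longrightarrow> \<gamma> t \<noteq> \<kappa>"
    and lim: "filterlim (\<lambda>t. \<bar>Re (\<gamma> t)\<bar>) at_top at_top" and b: "exp b = \<gamma> a - \<kappa>"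
  obtains v H where "continuous_on {a..} v" "v a = b" "\<And>t. t \<ge> a \<Longrightarrow> exp (v t) = \<gamma> t - \<kappa>"
    "\<And>t. t \<ge> a \<Longrightarrow> \<bar>Im (v t)\<bar> \<le> H" "filterlim (\<lambda>t. Re (v t)) at_top at_top"
proof -
  obtain v where v: "continuous_on {a..} v" "\<And>t. t \<in> {a..} \<Longrightarrow> exp (v t) = \<gamma> t - \<kappa>" "v a = b"
  proof (rule log_lift_exists[of "{a..}" "\<lambda>t. \<gamma> t - \<kappa>" a b])
    show "continuous_on {a..} (\<lambda>t. \<gamma> t - \<kappa>)" by (intro continuous_intros cont)
  qed (use ne b in auto)
  have Re_v: "exp (Re (v t)) \<ge> \<bar>Re (\<gamma> t)\<bar> - norm \<kappa>" if "t \<ge> a" for t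
  proof -
    have "\<bar>Re (\<gamma> t)\<bar> - norm \<kappa> \<le> norm (\<gamma> t) - norm \<kappa>" using abs_Re_le_cmod[of "\<gamma> t"] by simp
    also have "\<dots> \<le> norm (\<gamma> t - \<kappa>)" by (rule norm_triangle_ineq2)
    also have "\<dots> = exp (Re (v t))" using v(2)[of t] that norm_exp_eq_Re[of "v t"] by simp
    finally show ?thesis .
  qed
  have lim_v: "filterlim (\<lambda>t. Re (v t)) at_top at_top"
    unfolding filterlim_at_top
  proof
    fix B
    have "eventually (\<lambda>t. exp B + norm \<kappa> \<le> \<bar>Re (\<gamma> t)\<bar>) at_top"
      using lim unfolding filterlim_at_top by blast
    thus "eventually (\<lambda>t. B \<le> Re (v t)) at_top"
      using eventually_ge_at_top[of a]
    proof eventually_elim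
      case (elim t)
      hence "exp B \<le> exp (Re (v t))" using Re_v[of t] by linarith
      thus ?case by simp
    qed
  qed
  have "eventually (\<lambda>t. norm \<kappa> + 1 \<le> \<bar>Re (\<gamma> t)\<bar> \<and> a \<le> t) at_top"
    using lim eventually_ge_at_top[of a] unfolding filterlim_at_top by (intro eventually_conj) auto
  then obtain t1 where t1: "a \<le> t1" "\<And>t. t \<ge> t1 \<Longrightarrow> norm \<kappa> + 1 \<le> \<bar>Re (\<gamma> t)\<bar>"
    unfolding eventually_at_top_linorder by (metis order_refl)
  have cos_ne: "cos (Im (v t)) \<noteq> 0" if "t \<ge> t1" for t
  proof
    assume "cos (Im (v t)) = 0"
    hence "Re (exp (v t)) = 0" by (simp add: Re_exp)
    hence "Re (\<gamma> t) = Re \<kappa>" using v(2)[of t] t1(1) that by simp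
    thus False using t1(2)[OF that] abs_Re_le_cmod[of \<kappa>] by simp
  qed
  have far: "\<bar>Im (v t) - Im (v t1)\<bar> \<le> pi" if t: "t \<ge> t1" for t
  proof (rule ccontr)
    assume *: "\<not> ?thesis"
    define lo where "lo = min (Im (v t)) (Im (v t1))"
    \<comment> \<open>This makes \<open>y\<close> a zero of the cosine in the interval
      [lo, lo + pi], which a change of more than pi would have to traverse.\<close>
    define k where "k = \<lceil>(lo - pi / 2) / pi\<rceil>"
    define y where "y = pi / 2 + k * pi"
    have "(lo - pi / 2) / pi \<le> k" "k < (lo - pi / 2) / pi + 1" unfolding k_def by linarith+
    hence y: "lo \<le> y" "y \<le> lo + pi" by (auto simp: y_def field_simps)
    have contIm: "continuous_on {t1..t} (\<lambda>t. Im (v t))"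
      using v(1) t1 by (intro continuous_intros continuous_on_subset[OF v(1)]) auto
    have "\<exists>x. t1 \<le> x \<and> x \<le> t \<and> Im (v x) = y"
    proof (cases "Im (v t1) \<le> Im (v t)")
      case True
      hence "lo = Im (v t1)" "Im (v t) > Im (v t1) + pi" using * by (auto simp: lo_def)
      thus ?thesis using IVT'[of "\<lambda>t. Im (v t)" t1 y t] contIm t y by auto
    next
      case False
      hence "lo = Im (v t)" "Im (v t1) > Im (v t) + pi" using * by (auto simp: lo_def)
      thus ?thesis using IVT2'[of "\<lambda>t. Im (v t)" t y t1] contIm t y by auto
    qed
    then obtain x where x: "t1 \<le> x" "Im (v x) = y" by blast
    have "cos y = 0" by (simp add: y_def cos_add mult.commute)
    thus False using cos_ne[OF x(1)] x(2) by simp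
  qed
  have "compact (v ` {a..t1})" by (intro compact_continuous_image continuous_on_subset[OF v(1)]) auto
  hence "bounded (v ` {a..t1})" by (rule compact_imp_bounded)
  then obtain B where "\<forall>x \<in> v ` {a..t1}. norm x \<le> B" unfolding bounded_iff by blast
  hence B: "\<And>t. t \<in> {a..t1} \<Longrightarrow> norm (v t) \<le> B" by blast
  have "\<bar>Im (v t)\<bar> \<le> B + pi" if "t \<ge> a" for t
  proof (cases "t \<le> t1")
    case True
    hence "\<bar>Im (v t)\<bar> \<le> B" using B[of t] abs_Im_le_cmod[of "v t"] that by auto
    thus ?thesis using pi_ge_zero by linarith
  next
    case False
    thus ?thesis using far[of t] B[of t1] t1 abs_Im_le_cmod[of "v t1"] by auto
  qed
  thus thesis using that v lim_v by auto
qed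

text \<open>The absolute value admits both ends: lifting a path that ends at \<kappa> gives a curve
  to the left, whereas lifting an unbounded curve that avoids \<kappa> gives one to the
  right.\<close>

definition unbounded_curve_from :: "complex \<Rightarrow> complex \<Rightarrow> (real \<Rightarrow> complex) \<Rightarrow> bool" where
  "unbounded_curve_from \<kappa> z \<gamma> \<longleftrightarrow> continuous_on {0..} \<gamma> \<and> \<gamma> 0 = z \<and>
     (\<forall>t\<ge>0. \<gamma> t \<notin> escaping_set (E \<kappa>)) \<and> filterlim (\<lambda>t. \<bar>Re (\<gamma> t)\<bar>) at_top at_top"

text \<open>The path is lifted until shortly before its first visit to \<kappa>, when it is already
  in the disc of radius \<delta>. From there the lift continues horizontally to the left;
  \<open>E\<close> sends this half-line into the radius towards \<kappa>, where nothing
  escapes.\<close>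

lemma unbounded_curve_from_path:
  assumes pc: "path_component (- escaping_set (E \<kappa>)) (E \<kappa> z) \<kappa>"
    and \<delta>: "\<delta> > 0" "ball \<kappa> \<delta> \<inter> escaping_set (E \<kappa>) = {}"
  shows "\<exists>\<gamma>. unbounded_curve_from \<kappa> z \<gamma>"
proof -
  obtain p where p: "path p" "path_image p \<subseteq> - escaping_set (E \<kappa>)" "p 0 = E \<kappa> z" "p 1 = \<kappa>"
    using pc unfolding path_component_def pathstart_def pathfinish_def by blast
  have contp: "continuous_on {0..1} p" using p(1) by (simp add: path_def)
  have pN: "p t \<notin> escaping_set (E \<kappa>)" if "t \<in> {0..1}" for t
    using p(2) that unfolding path_image_def by blast
  define C where "C = {t \<in> {0..1}. p t = \<kappa>}"
  have "compact C" unfolding C_def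
    using continuous_closed_preimage_constant[OF contp, of \<kappa>] bounded_subset[OF bounded_closed_interval, of "{t \<in> {0..1}. p t = \<kappa>}" 0 1]
    by (simp add: compact_eq_bounded_closed subset_iff)
  moreover have "1 \<in> C" using p by (simp add: C_def)
  ultimately obtain t2 where t2: "t2 \<in> C" "\<And>t. t \<in> C \<Longrightarrow> t2 \<le> t" using compact_attains_inf[of C] by blast
  have "p 0 \<noteq> \<kappa>" using p by (simp add: E_def)
  hence t2': "0 < t2" "t2 \<le> 1" "p t2 = \<kappa>" using t2(1) by (auto simp: C_def less_le)
  obtain e where e: "e > 0" "\<And>t. t \<in> {0..1} \<Longrightarrow> dist t t2 < e \<Longrightarrow> dist (p t) (p t2) < \<delta>"
    using contp t2' \<delta>(1) unfolding continuous_on_iff by (metis atLeastAtMost_iff less_eq_real_def)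
  define t1 where "t1 = max 0 (t2 - e / 2)"
  have t1: "0 \<le> t1" "t1 < t2" using t2' e by (auto simp: t1_def)
  have "dist t1 t2 < e" using e t2' by (auto simp: t1_def dist_real_def)
  hence pt1: "dist (p t1) \<kappa> < \<delta>" using e(2)[of t1] t1 t2' by auto
  have ne: "p t - \<kappa> \<noteq> 0" if "t \<in> {0..t1}" for t
    using t2(2)[of t] that t1 t2' by (auto simp: C_def)
  obtain v where v: "continuous_on {0..t1} v" "\<And>t. t \<in> {0..t1} \<Longrightarrow> exp (v t) = p t - \<kappa>" "v 0 = z"
  proof (rule log_lift_exists[of "{0..t1}" "\<lambda>t. p t - \<kappa>" 0 z])
    show "continuous_on {0..t1} (\<lambda>t. p t - \<kappa>)"
      using t1 t2' by (intro continuous_intros continuous_on_subset[OF contp]) auto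
    show "exp z = p 0 - \<kappa>" by (simp add: p(3) E_comp_eq)
  qed (use ne t1 in auto)
  define \<gamma> where "\<gamma> = (\<lambda>t. v (min t t1) - of_real (max 0 (t - t1)))"
  have "compact (v ` {0..t1})" by (intro compact_continuous_image v) auto
  hence "bounded (v ` {0..t1})" by (rule compact_imp_bounded)
  then obtain B where "\<forall>x \<in> v ` {0..t1}. norm x \<le> B" unfolding bounded_iff by blast
  hence B: "\<And>t. t \<in> {0..t1} \<Longrightarrow> norm (v t) \<le> B" by blast
  have "unbounded_curve_from \<kappa> z \<gamma>"
    unfolding unbounded_curve_from_def
  proof (intro conjI allI impI)
    show "continuous_on {0..} \<gamma>" unfolding \<gamma>_def
      using t1 by (intro continuous_intros continuous_on_compose2[OF v(1)]) auto
    show "\<gamma> 0 = z" using t1 v by (simp add: \<gamma>_def min_def)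
    fix t :: real assume t: "0 \<le> t"
    have "E \<kappa> (\<gamma> t) \<notin> escaping_set (E \<kappa>)"
    proof (cases "t \<le> t1")
      case True
      hence "E \<kappa> (\<gamma> t) = p t" using v(2)[of t] t by (simp add: \<gamma>_def E_def)
      thus ?thesis using pN t True t1 t2' by auto
    next
      case False
      hence "exp (\<gamma> t) = (p t1 - \<kappa>) * of_real (exp (- (t - t1)))"
        using v(2)[of t1] t1 by (simp add: \<gamma>_def exp_diff exp_minus divide_simps flip: exp_of_real)
      hence "norm (E \<kappa> (\<gamma> t) - \<kappa>) = norm (p t1 - \<kappa>) * exp (- (t - t1))"
        by (simp add: E_comp_eq norm_mult)
      also have "\<dots> \<le> norm (p t1 - \<kappa>) * 1" using False by (intro mult_left_mono) auto
      finally have "E \<kappa> (\<gamma> t) \<in> ball \<kappa> \<delta>" using pt1 by (simp add: dist_norm norm_minus_commute)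
      thus ?thesis using \<delta>(2) by blast
    qed
    thus "\<gamma> t \<notin> escaping_set (E \<kappa>)" by (simp add: escaping_E_iff)
  next
    show "filterlim (\<lambda>t. \<bar>Re (\<gamma> t)\<bar>) at_top at_top"
      unfolding filterlim_at_top eventually_at_top_linorder
    proof (intro allI exI impI)
      fix M t :: real assume t: "\<bar>M\<bar> + B + t1 \<le> t"
      have "\<bar>Re (v t1)\<bar> \<le> B" using t1 by (intro order_trans[OF abs_Re_le_cmod B]) auto
      moreover from this have "t1 \<le> t" using t by linarith
      hence "Re (\<gamma> t) = Re (v t1) - (t - t1)" by (simp add: \<gamma>_def)
      ultimately show "M \<le> \<bar>Re (\<gamma> t)\<bar>" using t by linarith
    qed
  qed
  thus ?thesis by blast
qed

text \<open>A curve that meets \<kappa> is cut there and lifted as a path ending at \<kappa>;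
  otherwise the whole curve has a logarithmic lift.\<close>

lemma unbounded_curve_pullback:
  assumes \<gamma>: "unbounded_curve_from \<kappa> (E \<kappa> z) \<gamma>"
    and \<delta>: "\<delta> > 0" "ball \<kappa> \<delta> \<inter> escaping_set (E \<kappa>) = {}"
  shows "\<exists>\<gamma>'. unbounded_curve_from \<kappa> z \<gamma>'"
proof (cases "\<exists>t\<ge>0. \<gamma> t = \<kappa>")
  case True
  then obtain t where t: "t \<ge> 0" "\<gamma> t = \<kappa>" by blast
  have "path_component {0..t} 0 t"
    using convex_imp_path_connected[of "{0..t}"] t unfolding path_connected_component by auto
  hence "path_component (- escaping_set (E \<kappa>)) (\<gamma> 0) (\<gamma> t)"
    by (rule path_component_continuous_image)
       (use \<gamma> in \<open>auto simp: unbounded_curve_from_def intro: continuous_on_subset\<close>)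
  thus ?thesis using unbounded_curve_from_path[OF _ \<delta>] \<gamma> t by (simp add: unbounded_curve_from_def)
next
  case False
  obtain v H where v: "continuous_on {0..} v" "v 0 = z" "\<And>t. t \<ge> 0 \<Longrightarrow> exp (v t) = \<gamma> t - \<kappa>"
    "\<And>t. t \<ge> 0 \<Longrightarrow> \<bar>Im (v t)\<bar> \<le> H" "filterlim (\<lambda>t. Re (v t)) at_top at_top"
    using unbounded_curve_log_lift[of 0 \<gamma> \<kappa> z] \<gamma> False
    unfolding unbounded_curve_from_def by (auto simp: E_def)
  have "E \<kappa> (v t) = \<gamma> t" if "t \<ge> 0" for t using v(3)[OF that] by (simp add: E_def)
  hence "\<And>t. t \<ge> 0 \<Longrightarrow> v t \<notin> escaping_set (E \<kappa>)"
    using \<gamma> escaping_E_iff unfolding unbounded_curve_from_def by metis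
  moreover have "filterlim (\<lambda>t. \<bar>Re (v t)\<bar>) at_top at_top"
    by (rule filterlim_at_top_mono[OF v(5)]) (intro always_eventually allI abs_ge_self)
  ultimately show ?thesis using v unfolding unbounded_curve_from_def by blast
qed

text \<open>Lifting back along the singular orbit yields an unbounded curve that starts at \<kappa>.
  A last lift is taken of its part after the final visit to \<kappa>, begun within \<delta> of
  \<kappa>. Hence \<open>G\<close> starts left of \<open>ln \<delta>\<close>, while every escaping
  point has real part at least \<open>ln \<delta>\<close>: no ray can slip past the left end of
  \<open>G\<close>.\<close>

lemma tame_barrier:
  assumes "tame \<kappa>"
  obtains \<delta> H :: real and G :: "real \<Rightarrow> complex" where "\<delta> > 0" "ball \<kappa> \<delta> \<inter> escaping_set (E \<kappa>) = {}"
    "continuous_on {0..} G" "Re (G 0) < ln \<delta>" "\<And>t. t \<ge> 0 \<Longrightarrow> G t \<notin> escaping_set (E \<kappa>)"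
    "\<And>t. t \<ge> 0 \<Longrightarrow> \<bar>Im (G t)\<bar> \<le> H" "filterlim (\<lambda>t. Re (G t)) at_top at_top"
proof -
  obtain \<delta> n where \<delta>: "\<delta> > 0" "ball \<kappa> \<delta> \<inter> escaping_set (E \<kappa>) = {}" and n: "n \<ge> 1"
    and pc: "path_component (- escaping_set (E \<kappa>)) ((E \<kappa> ^^ n) \<kappa>) \<kappa>"
    using assms unfolding tame_def by blast
  obtain n' where n': "n = Suc n'" using n by (cases n) auto
  have "\<exists>\<gamma>. unbounded_curve_from \<kappa> ((E \<kappa> ^^ n') \<kappa>) \<gamma>"
    using pc by (intro unbounded_curve_from_path[OF _ \<delta>]) (simp add: n')
  hence "\<exists>\<gamma>. unbounded_curve_from \<kappa> \<kappa> \<gamma>"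
  proof (induction n')
    case (Suc k)
    thus ?case using unbounded_curve_pullback[OF _ \<delta>] by auto
  qed auto
  then obtain \<gamma> :: "real \<Rightarrow> complex" where \<gamma>: "continuous_on {0..} \<gamma>" "\<gamma> 0 = \<kappa>" "\<And>t. t \<ge> 0 \<Longrightarrow> \<gamma> t \<notin> escaping_set (E \<kappa>)"
    "filterlim (\<lambda>t. \<bar>Re (\<gamma> t)\<bar>) at_top at_top"
    unfolding unbounded_curve_from_def by blast
  define C where "C = {t \<in> {0..}. \<gamma> t = \<kappa>}"
  have "eventually (\<lambda>t. norm \<kappa> + 1 \<le> \<bar>Re (\<gamma> t)\<bar>) at_top" using \<gamma>(4) unfolding filterlim_at_top by blast
  then obtain t0 where t0: "\<And>t. t \<ge> t0 \<Longrightarrow> norm \<kappa> + 1 \<le> \<bar>Re (\<gamma> t)\<bar>" unfolding eventually_at_top_linorder by blast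
  have "C \<subseteq> {0..t0}"
  proof
    fix t assume "t \<in> C"
    thus "t \<in> {0..t0}" using t0[of t] abs_Re_le_cmod[of \<kappa>] by (cases "t0 \<le> t") (auto simp: C_def)
  qed
  hence "compact C" unfolding C_def
    using continuous_closed_preimage_constant[OF \<gamma>(1) closed_atLeast] bounded_subset[of "{0..t0}"]
    by (auto simp: compact_eq_bounded_closed)
  moreover have "0 \<in> C" using \<gamma> by (simp add: C_def)
  ultimately obtain t2 where t2: "t2 \<in> C" "\<And>t. t \<in> C \<Longrightarrow> t \<le> t2" using compact_attains_sup[of C] by blast
  obtain e where e: "e > 0" "\<And>t. t \<in> {0..} \<Longrightarrow> dist t t2 < e \<Longrightarrow> dist (\<gamma> t) (\<gamma> t2) < \<delta>"
    using \<gamma>(1) t2(1) \<delta>(1) unfolding continuous_on_iff C_def by blast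
  define a where "a = t2 + e / 2"
  have a: "a > t2" "a \<ge> 0" using e t2 by (auto simp: a_def C_def)
  have ga: "norm (\<gamma> a - \<kappa>) < \<delta>" using e(2)[of a] a e(1) t2(1) by (auto simp: a_def dist_norm C_def)
  have ne: "\<gamma> t \<noteq> \<kappa>" if "t \<ge> a" for t using t2(2)[of t] a that by (auto simp: C_def)
  obtain v H where v: "continuous_on {a..} v" "v a = Ln (\<gamma> a - \<kappa>)" "\<And>t. t \<ge> a \<Longrightarrow> exp (v t) = \<gamma> t - \<kappa>"
    "\<And>t. t \<ge> a \<Longrightarrow> \<bar>Im (v t)\<bar> \<le> H" "filterlim (\<lambda>t. Re (v t)) at_top at_top"
    using unbounded_curve_log_lift[of a \<gamma> \<kappa> "Ln (\<gamma> a - \<kappa>)"] ne \<gamma>(4) continuous_on_subset[OF \<gamma>(1), of "{a..}"] a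
    by auto
  show thesis
  proof (rule that[OF \<delta>])
    show "continuous_on {0..} (\<lambda>t. v (a + t))"
      by (intro continuous_on_compose2[OF v(1)] continuous_intros) auto
    show "Re (v (a + 0)) < ln \<delta>" using v(2) ga ne[of a] \<delta>(1) by simp
    fix t :: real assume t: "t \<ge> 0"
    have "E \<kappa> (v (a + t)) = \<gamma> (a + t)" using v(3)[of "a + t"] t by (simp add: E_def)
    thus "v (a + t) \<notin> escaping_set (E \<kappa>)" using \<gamma>(3)[of "a + t"] a t escaping_E_iff by (metis add_nonneg_nonneg)
    show "\<bar>Im (v (a + t))\<bar> \<le> H" using v(4) t by simp
  next
    show "filterlim (\<lambda>t. Re (v (a + t))) at_top at_top"
      by (rule filterlim_compose[OF v(5)]) (auto intro: filterlim_tendsto_add_at_top filterlim_ident)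
  qed
qed

text \<open>Clamping both paths to the rectangle makes Fashoda's theorem applicable without passing to
  subpaths; the strict bounds ensure that a common point of the clamped paths is a genuine one.\<close>

lemma crossing_paths_meet:
  fixes u v :: "real \<Rightarrow> complex"
  assumes u: "continuous_on {0..1} u" and v: "continuous_on {0..1} v"
    and u_Re: "\<And>t. t \<in> {0..1} \<Longrightarrow> a < Re (u t) \<and> Re (u t) < R"
    and v_Im: "\<And>t. t \<in> {0..1} \<Longrightarrow> c < Im (v t) \<and> Im (v t) < d"
    and "Im (u 0) \<le> c" "d \<le> Im (u 1)" "Re (v 0) \<le> a" "R \<le> Re (v 1)"
  obtains s t where "s \<in> {0..1}" "t \<in> {0..1}" "u s = v t"
proof -
  have cd: "c < d" using v_Im[of 0] by auto
  have aR: "a < R" using u_Re[of 0] by auto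
  define f :: "real \<Rightarrow> real^2" where "f = (\<lambda>t. vector [min R (max a (Re (v t))), Im (v t)])"
  define g' :: "real \<Rightarrow> real^2" where "g' = (\<lambda>t. vector [Re (u t), min d (max c (Im (u t)))])"
  define A :: "real^2" where "A = vector [a, c]"
  define B :: "real^2" where "B = vector [R, d]"
  have vec: "continuous_on S (\<lambda>t. vector [x t, y t] :: real^2)"
    if "continuous_on S x" "continuous_on S y" for x y :: "real \<Rightarrow> real" and S
  proof -
    have "(\<lambda>t. vector [x t, y t] :: real^2) = (\<lambda>t. \<chi> i. if i = 1 then x t else y t)"
      by (auto simp: vec_eq_iff forall_2)
    moreover have "continuous_on S (\<lambda>t. \<chi> i::2. if i = 1 then x t else y t)"
    proof (rule continuous_on_vec_lambda)
      fix i :: 2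
      show "continuous_on S (\<lambda>t. if i = 1 then x t else y t)" using that by (cases "i = 1") auto
    qed
    ultimately show ?thesis by (simp only:)
  qed
  have "path f" "path g'" unfolding path_def f_def g'_def
    by (intro vec continuous_intros u v)+
  moreover have "path_image f \<subseteq> cbox A B" "path_image g' \<subseteq> cbox A B"
    using cd aR u_Re v_Im by (auto simp: path_image_def f_def g'_def A_def B_def mem_box_cart forall_2 less_imp_le)
  moreover have "vec_nth (pathstart f) 1 = vec_nth A 1" "vec_nth (pathfinish f) 1 = vec_nth B 1" "vec_nth (pathstart g') 2 = vec_nth A 2" "vec_nth (pathfinish g') 2 = vec_nth B 2"
    using assms aR cd by (auto simp: pathstart_def pathfinish_def f_def g'_def A_def B_def)
  ultimately obtain z where "z \<in> path_image f" "z \<in> path_image g'" by (rule fashoda)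
  then obtain s t where st: "s \<in> {0..1}" "t \<in> {0..1}" "f t = g' s" by (auto simp: path_image_def)
  have "min R (max a (Re (v t))) = Re (u s)" "Im (v t) = min d (max c (Im (u s)))"
    using arg_cong[OF st(3), of "\<lambda>x. vec_nth x 1"] arg_cong[OF st(3), of "\<lambda>x. vec_nth x 2"] by (auto simp: f_def g'_def)
  hence "u s = v t" using u_Re[OF st(1)] v_Im[OF st(2)]
    by (auto simp: complex_eq_iff min_def max_def split: if_splits)
  thus thesis using that st by blast
qed

section \<open>The model and the limit map on high orbits\<close>

definition height :: "nat \<Rightarrow> address \<Rightarrow> real \<Rightarrow> real" where
  "height n s t = T ((model_map ^^ n) (s, t))"

lemma height_0 [simp]: "height 0 s t = t"
  by (simp add: height_def T_def)

lemma model_map_pair: "model_map (s, t) = (shift s, F t - 2 * pi * \<bar>real_of_int (s 1)\<bar>)"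
  by (simp add: model_map_def)

lemma model_map_iter: "(model_map ^^ n) (s, t) = ((\<lambda>k. s (k + n)), height n s t)"
proof (induction n)
  case (Suc n)
  have "fst ((model_map ^^ Suc n) (s, t)) = (\<lambda>k. s (k + Suc n))"
    by (simp add: Suc model_map_def shift_def)
  moreover have "snd ((model_map ^^ Suc n) (s, t)) = height (Suc n) s t" by (simp add: height_def T_def)
  ultimately show ?case by (metis prod.collapse)
qed (simp add: height_def T_def)

lemma height_Suc: "height (Suc n) s t = exp (height n s t) - 1 - 2 * pi * \<bar>real_of_int (s (Suc n))\<bar>"
proof -
  have "height (Suc n) s t = T (model_map ((model_map ^^ n) (s, t)))" by (simp add: height_def)
  thus ?thesis unfolding model_map_iter by (simp add: model_map_def T_def F_def)
qed

lemma height_shift: "height n (shift s) (F t - 2 * pi * \<bar>real_of_int (s 1)\<bar>) = height (Suc n) s t"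
  unfolding height_def funpow_Suc_right o_def model_map_pair ..

lemma height_add: "height m (\<lambda>k. s (k + n)) (height n s t) = height (m + n) s t"
  unfolding height_def[of m] model_map_iter[symmetric] by (simp add: height_def funpow_add)

lemma mem_X_bar: "(s, t) \<in> X_bar \<longleftrightarrow> (\<forall>n. 0 \<le> height n s t)"
  by (simp add: X_bar_def height_def)

lemma mem_X: "(s, t) \<in> X \<longleftrightarrow> (\<forall>n. 0 \<le> height n s t) \<and> filterlim (\<lambda>n. height n s t) at_top sequentially"
  by (simp add: X_def mem_X_bar height_def)

lemma mem_Y: "(s, t) \<in> Y K \<longleftrightarrow> (\<forall>n. 0 \<le> height n s t) \<and> (\<forall>n. Q K \<le> height n s t)"
  by (simp add: Y_def mem_X_bar height_def)

lemma Q_pos: "Q K \<ge> pi + 2" "Q K > 0"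
proof -
  show "Q K \<ge> pi + 2" unfolding Q_def by (rule max.cobounded2)
  thus "Q K > 0" using pi_gt_zero by linarith
qed

lemma mem_Y_iff: "(s, t) \<in> Y K \<longleftrightarrow> (\<forall>n. Q K \<le> height n s t)"
  using Q_pos(2)[of K] by (auto simp: mem_Y intro: order_trans[OF less_imp_le])

lemma exp_diff_ge:
  fixes a b :: real
  assumes "0 \<le> a" "0 \<le> b" shows "exp (a + b) - exp a \<ge> b"
proof -
  have "exp a * exp b \<ge> exp a * (1 + b)" by (intro mult_left_mono exp_ge_add_one_self) simp
  moreover have "exp a * b \<ge> 1 * b" using assms by (intro mult_right_mono) auto
  ultimately show ?thesis by (simp add: exp_add algebra_simps)
qed

text \<open>The exponential has slope at least 1 on the nonnegative reals and the subtracted terms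
  depend on the address only, so a gap between two points of a ray never shrinks.\<close>

lemma height_plus_ge:
  assumes "\<And>n. 0 \<le> height n s t" "0 \<le> \<tau>"
  shows "height n s t + \<tau> \<le> height n s (t + \<tau>)"
proof (induction n)
  case (Suc n)
  have "exp (height n s t + \<tau>) - exp (height n s t) \<ge> \<tau>" by (rule exp_diff_ge[OF assms])
  moreover have "exp (height n s (t + \<tau>)) \<ge> exp (height n s t + \<tau>)" using Suc by simp
  ultimately show ?case unfolding height_Suc by linarith
qed simp

lemma X_plus: assumes "(s, t) \<in> X" "0 \<le> \<tau>" shows "(s, t + \<tau>) \<in> X"
proof -
  have 1: "\<And>n. height n s t + \<tau> \<le> height n s (t + \<tau>)" "\<And>n. 0 \<le> height n s t"
    using height_plus_ge assms by (auto simp: mem_X)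
  have "height n s t \<le> height n s (t + \<tau>)" for n using 1(1)[of n] assms(2) by linarith
  hence "filterlim (\<lambda>n. height n s (t + \<tau>)) at_top sequentially"
    using assms(1) by (auto simp: mem_X intro: filterlim_at_top_mono)
  moreover have "0 \<le> height n s (t + \<tau>)" for n using 1(1)[of n] 1(2)[of n] assms(2) by linarith
  ultimately show ?thesis by (auto simp: mem_X)
qed

text \<open>However low its orbit, an ascent by \<open>Q K\<close> carries a point into
  \<open>Y\<close>. The points reached are the anchors at which lifts along rays are compared with
  \<open>g_lim\<close>.\<close>

lemma X_plus_Y: assumes "(s, t) \<in> X" "Q K \<le> \<tau>" shows "(s, t + \<tau>) \<in> Y K \<inter> X"
proof -
  have "0 \<le> \<tau>" using assms(2) Q_pos(2)[of K] by linarith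
  moreover have "Q K \<le> height n s (t + \<tau>)" for n
    using height_plus_ge[of s t \<tau> n] assms \<open>0 \<le> \<tau>\<close> by (auto simp: mem_X intro: order_trans)
       (smt (verit))
  ultimately show ?thesis using X_plus[OF assms(1)] by (simp add: mem_Y_iff)
qed

lemma X_nonneg: "(s, t) \<in> X \<Longrightarrow> 0 \<le> t"
  using mem_X[of s t] by (metis height_0)

lemma X_model_map: assumes "x \<in> X" shows "model_map x \<in> X"
proof -
  obtain s t where x: "x = (s, t)" by (cases x)
  show ?thesis using assms unfolding x model_map_pair mem_X height_shift
    using filterlim_sequentially_Suc[of "\<lambda>n. height n s t" at_top] by auto
qed

lemma Y_model_map: assumes "x \<in> Y K" shows "model_map x \<in> Y K"
proof -
  obtain s t where x: "x = (s, t)" by (cases x)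
  show ?thesis using assms unfolding x model_map_pair mem_Y_iff height_shift by blast
qed

lemma model_map_iter_mem:
  "x \<in> X \<Longrightarrow> (model_map ^^ n) x \<in> X" "x \<in> Y K \<Longrightarrow> (model_map ^^ n) x \<in> Y K"
  by (induction n) (auto simp: X_model_map Y_model_map)

lemma X_eventually_high:
  assumes "(s, t) \<in> X" obtains n where "\<And>m. m \<ge> n \<Longrightarrow> B \<le> height m s t"
proof -
  have "eventually (\<lambda>m. B \<le> height m s t) sequentially"
    using assms unfolding mem_X filterlim_at_top by blast
  thus thesis using that unfolding eventually_sequentially by blast
qed

lemma X_eventually_Y:
  assumes "x \<in> X" obtains n where "(model_map ^^ n) x \<in> Y K"
proof -
  obtain s t where x: "x = (s, t)" by (cases x)
  obtain n where "\<And>m. m \<ge> n \<Longrightarrow> Q K \<le> height m s t" using X_eventually_high assms x by metis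
  hence "(model_map ^^ n) x \<in> Y K" unfolding x model_map_iter mem_Y_iff height_add by simp
  thus thesis by (rule that)
qed

lemma continuous_on_height: "continuous_on S (height n s)"
proof (induction n)
  case (Suc n)
  have "continuous_on S (\<lambda>t. exp (height n s t) - 1 - 2 * pi * \<bar>real_of_int (s (Suc n))\<bar>)"
    using Suc by (intro continuous_intros)
  thus ?case by (simp add: height_Suc[abs_def])
qed (simp add: height_0[abs_def])

section \<open>Changing or prepending the first entry of an address\<close>

lemma model_map_eqI: "(\<And>n. n > 0 \<Longrightarrow> s n = s' n) \<Longrightarrow> model_map (s, t) = model_map (s', t)"
  by (auto simp: model_map_def shift_def)

lemma model_map_upd0: "model_map (s(0 := j), t) = model_map (s, t)"
  by (rule model_map_eqI) simp

lemma height_upd0: "height n (s(0 := j)) t = height n s t"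
proof (cases n)
  case (Suc m)
  show ?thesis unfolding height_def Suc funpow_Suc_right o_def model_map_upd0 by (rule refl)
qed simp

lemma X_upd0: "(s(0 := j), t) \<in> X \<longleftrightarrow> (s, t) \<in> X"
  by (simp add: mem_X height_upd0)

lemma Y_upd0: "(s(0 := j), t) \<in> Y K \<longleftrightarrow> (s, t) \<in> Y K"
  by (simp add: mem_Y height_upd0)

definition prepend :: "int \<Rightarrow> address \<Rightarrow> address" where
  "prepend j s = (\<lambda>n. case n of 0 \<Rightarrow> j | Suc m \<Rightarrow> s m)"

lemma model_map_prepend:
  assumes "0 \<le> t"
  shows "model_map (prepend j s, ln (1 + t + 2 * pi * \<bar>real_of_int (s 0)\<bar>)) = (s, t)"
proof -
  have "0 < 1 + t + 2 * pi * \<bar>real_of_int (s 0)\<bar>" using assms by (intro add_pos_nonneg) auto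
  thus ?thesis by (simp add: model_map_def shift_def prepend_def F_def)
qed

lemma X_prepend:
  assumes "(s, t) \<in> X"
  shows "(prepend j s, ln (1 + t + 2 * pi * \<bar>real_of_int (s 0)\<bar>)) \<in> X"
proof -
  have t: "0 \<le> t" using assms by (rule X_nonneg)
  let ?t = "ln (1 + t + 2 * pi * \<bar>real_of_int (s 0)\<bar>)"
  have Suc: "height (Suc n) (prepend j s) ?t = height n s t" for n
    unfolding height_def funpow_Suc_right o_def model_map_prepend[OF t] ..
  have "0 \<le> ?t" using t by simp
  hence "0 \<le> height n (prepend j s) ?t" for n
    using assms Suc by (cases n) (auto simp: mem_X)
  moreover have "filterlim (\<lambda>n. height (Suc n) (prepend j s) ?t) at_top sequentially"
    unfolding Suc using assms by (simp add: mem_X)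
  ultimately show ?thesis unfolding mem_X using filterlim_sequentially_Suc by blast
qed

section \<open>Inverse branches and convergence of the approximations on \<open>Y\<close>\<close>

lemma log_branch_contraction:
  assumes "convex S" "\<And>w. w \<in> S \<Longrightarrow> w - \<kappa> \<notin> \<real>\<^sub>\<le>\<^sub>0" "\<And>w. w \<in> S \<Longrightarrow> 2 \<le> norm (w - \<kappa>)"
    and "w \<in> S" "w' \<in> S"
  shows "norm (L \<kappa> j w - L \<kappa> j w') \<le> (1 / 2) * norm (w - w')"
proof -
  have "norm (Ln (w - \<kappa>) - Ln (w' - \<kappa>)) \<le> (1 / 2) * norm (w - w')"
  proof (rule field_differentiable_bound[OF \<open>convex S\<close> _ _ assms(4,5)])
    fix z assume z: "z \<in> S"
    show "((\<lambda>w. Ln (w - \<kappa>)) has_field_derivative (1 / (z - \<kappa>))) (at z within S)"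
      using assms(2)[OF z] by (auto intro!: derivative_eq_intros simp: inverse_eq_divide)
    show "norm (1 / (z - \<kappa>)) \<le> 1 / 2"
      using assms(3)[OF z] by (simp add: norm_divide divide_simps)
  qed
  thus ?thesis by (simp add: L_def)
qed

lemma E_L: "w \<noteq> \<kappa> \<Longrightarrow> E \<kappa> (L \<kappa> j w) = w"
  by (simp add: E_def L_def exp_add exp_eq_1) (use exp_integer_2pi[of "of_int j"] in \<open>simp add: mult_ac\<close>)

locale exp_parameter =
  fixes \<kappa> :: complex and K :: real
  assumes norm_le_K: "norm \<kappa> \<le> K"
begin

lemma K_nonneg: "0 \<le> K"
  using norm_le_K norm_ge_zero order_trans by blast

lemma exp_ge_if_Y: assumes "(s, t) \<in> Y K" shows "exp t \<ge> 4 * (K + pi + 3)"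
proof -
  have "Q K \<le> t" using assms by (metis mem_Y_iff height_0)
  hence "ln (4 * (K + pi + 3)) \<le> t" by (simp add: Q_def)
  hence "exp (ln (4 * (K + pi + 3))) \<le> exp t" by simp
  moreover have "0 < K + pi + 3" using K_nonneg pi_gt_zero by linarith
  ultimately show ?thesis by simp
qed

text \<open>Balls of radius pi + 1 around the model reproduce themselves under the inverse branches:
  the principal logarithm contributes at most pi to the imaginary part, and the real part errs by at
  most 1 because \<open>norm (w - \<kappa>)\<close> is within a factor e of \<open>exp t\<close>. In
  \<open>Q\<close>, the term pi + 2 keeps the ball in Re \<ge> 1, and the logarithm lets
  \<open>exp t\<close> dominate \<open>K\<close> and pi.\<close>

lemma Y_ball_estimates:
  assumes "(s, t) \<in> Y K" "w \<in> cball (Z (model_map (s, t))) (pi + 1)"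
  shows "w - \<kappa> \<notin> \<real>\<^sub>\<le>\<^sub>0" "2 \<le> norm (w - \<kappa>)" "norm (L \<kappa> (s 0) w - Z (s, t)) \<le> pi + 1"
proof -
  define t1 where "t1 = F t - 2 * pi * \<bar>real_of_int (s 1)\<bar>"
  define b where "b = 2 * pi * \<bar>real_of_int (s 1)\<bar>"
  define z where "z = Z (model_map (s, t))"
  have z: "Re z = t1" "\<bar>Im z\<bar> = b"
    by (simp_all add: z_def Z_def model_map_def t1_def b_def shift_def abs_mult)
  have "model_map (s, t) \<in> Y K" using assms(1) by (rule Y_model_map)
  hence t1: "Q K \<le> t1" unfolding model_map_pair t1_def[symmetric] mem_Y_iff by (metis height_0)
  hence t1': "pi + 2 \<le> t1" using Q_pos(1)[of K] by linarith
  have b0: "0 \<le> b" by (simp add: b_def)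
  have sum: "t1 + b = exp t - 1" by (simp add: t1_def b_def F_def)
  have et: "exp t \<ge> 4 * (K + pi + 3)" using assms(1) by (rule exp_ge_if_Y)
  have "(norm z)\<^sup>2 = t1\<^sup>2 + b\<^sup>2" unfolding cmod_power2 z(1) using z(2) by (metis power2_abs)
  \<comment> \<open>7/10 is a rational number just below 1 / sqrt 2.\<close>
  moreover have "(7/10 * (t1 + b))\<^sup>2 \<le> t1\<^sup>2 + b\<^sup>2"
    using zero_le_power2[of "t1 - b"] b0 t1' zero_le_power2[of "t1 + b"] by (simp add: power2_eq_square algebra_simps)
  ultimately have nz: "7/10 * (exp t - 1) \<le> norm z" using sum by (metis norm_ge_zero power2_le_imp_le)
  have nz': "norm z \<le> exp t - 1" using cmod_le[of z] z t1' sum pi_gt_zero by linarith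
  have wz: "norm (w - z) \<le> pi + 1" using assms(2) by (simp add: z_def dist_norm norm_minus_commute)
  have "norm z - norm (w - z) \<le> norm w" by (metis norm_diff_triangle_ineq norm_triangle_sub add.commute diff_le_eq norm_minus_commute)
  hence nw: "7/10 * (exp t - 1) - (pi + 1) \<le> norm w" using nz wz by linarith
  have nw': "norm w \<le> exp t - 1 + (pi + 1)" using norm_triangle_sub[of w z] nz' wz by linarith
  have "\<bar>Re (w - z)\<bar> \<le> pi + 1" using abs_Re_le_cmod[of "w - z"] wz by linarith
  hence Rew: "1 \<le> Re w" using t1' z by simp
  have wK: "K < norm w" using nw et K_nonneg pi_gt_zero by argo
  show 1: "w - \<kappa> \<notin> \<real>\<^sub>\<le>\<^sub>0"
  proof
    assume "w - \<kappa> \<in> \<real>\<^sub>\<le>\<^sub>0"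
    hence im: "Im w = Im \<kappa>" and re: "Re w \<le> Re \<kappa>" by (auto simp: complex_nonpos_Reals_iff)
    have "(norm w)\<^sup>2 \<le> (norm \<kappa>)\<^sup>2" unfolding cmod_power2 im using re Rew by (simp add: power_mono)
    hence "norm w \<le> norm \<kappa>" by (rule power2_le_imp_le) simp
    thus False using wK norm_le_K by linarith
  qed
  have lower: "norm w - K \<le> norm (w - \<kappa>)" using norm_triangle_ineq2[of w \<kappa>] norm_le_K by linarith
  have upper: "norm (w - \<kappa>) \<le> norm w + K" using norm_triangle_ineq4[of w \<kappa>] norm_le_K by linarith
  \<comment> \<open>The two factors 45/100 and 2 lie between exp (-1) and exp 1.\<close>
  have low: "45/100 * exp t \<le> norm (w - \<kappa>)" using lower nw et K_nonneg pi_gt_zero by argo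
  have up: "norm (w - \<kappa>) \<le> 2 * exp t" using upper nw' et K_nonneg pi_gt_zero by argo
  show "2 \<le> norm (w - \<kappa>)" using low et K_nonneg pi_gt3 by argo
  have pos: "norm (w - \<kappa>) > 0" using low exp_gt_zero[of t] by linarith
  have e2: "(2::real) \<le> exp 1" using exp_ge_add_one_self[of "1::real"] by simp
  have e3: "exp (-1::real) \<le> 45/100"
  proof -
    have "(5/2::real) \<le> exp 1" using exp_lower_Taylor_quadratic[of "1::real"] by simp
    thus ?thesis by (simp add: exp_minus field_simps)
  qed
  have "ln (norm (w - \<kappa>)) \<le> ln (exp (t + 1))"
  proof (subst ln_le_cancel_iff)
    have "norm (w - \<kappa>) \<le> exp t * 2" using up by simp
    also have "\<dots> \<le> exp t * exp 1" using e2 by (intro mult_left_mono) auto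
    finally show "norm (w - \<kappa>) \<le> exp (t + 1)" by (simp add: exp_add)
  qed (use pos in auto)
  moreover have "ln (exp (t - 1)) \<le> ln (norm (w - \<kappa>))"
  proof (subst ln_le_cancel_iff)
    have "exp (t - 1) = exp t * exp (- 1)" by (simp flip: exp_add)
    also have "\<dots> \<le> exp t * (45/100)" using e3 by (intro mult_left_mono) auto
    also have "\<dots> \<le> norm (w - \<kappa>)" using low by simp
    finally show "exp (t - 1) \<le> norm (w - \<kappa>)" .
  qed (use pos in auto)
  ultimately have "\<bar>ln (norm (w - \<kappa>)) - t\<bar> \<le> 1" by simp
  moreover have "\<bar>Im (Ln (w - \<kappa>))\<bar> \<le> pi" using mpi_less_Im_Ln[of "w - \<kappa>"] Im_Ln_le_pi[of "w - \<kappa>"] pos by auto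
  moreover have "L \<kappa> (s 0) w - Z (s, t) = Ln (w - \<kappa>) - of_real t" by (simp add: L_def Z_def)
  moreover have "norm (Ln (w - \<kappa>) - of_real t) \<le> \<bar>Re (Ln (w - \<kappa>) - of_real t)\<bar> + \<bar>Im (Ln (w - \<kappa>) - of_real t)\<bar>"
    by (rule cmod_le)
  ultimately show "norm (L \<kappa> (s 0) w - Z (s, t)) \<le> pi + 1" using pos by simp
qed

lemma g_approx_near: "x \<in> Y K \<Longrightarrow> norm (g_approx \<kappa> k x - Z x) \<le> pi + 1"
proof (induction k arbitrary: x)
  case (Suc k)
  obtain s t where x: "x = (s, t)" by (cases x)
  have "norm (g_approx \<kappa> k (model_map x) - Z (model_map x)) \<le> pi + 1"
    using Suc Y_model_map by blast
  hence "g_approx \<kappa> k (model_map x) \<in> cball (Z (model_map x)) (pi + 1)"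
    by (simp add: dist_norm norm_minus_commute)
  thus ?case using Y_ball_estimates(3)[of s t] Suc.prems unfolding x by simp
qed (use pi_gt_zero in simp)

lemma L_contraction_Y:
  assumes "(s, t) \<in> Y K" "w \<in> cball (Z (model_map (s, t))) (pi + 1)" "w' \<in> cball (Z (model_map (s, t))) (pi + 1)"
  shows "norm (L \<kappa> j w - L \<kappa> j w') \<le> (1 / 2) * norm (w - w')"
  by (rule log_branch_contraction[OF convex_cball _ _ assms(2,3)])
     (use Y_ball_estimates[OF assms(1)] in auto)

lemma g_approx_cauchy: "x \<in> Y K \<Longrightarrow> norm (g_approx \<kappa> (Suc k) x - g_approx \<kappa> k x) \<le> (pi + 1) * (1 / 2) ^ k"
proof (induction k arbitrary: x)
  case 0
  thus ?case using g_approx_near[OF 0, of 1] by simp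
next
  case (Suc k)
  obtain s t where x: "x = (s, t)" by (cases x)
  have Y': "model_map x \<in> Y K" using Suc.prems by (rule Y_model_map)
  have "norm (g_approx \<kappa> (Suc (Suc k)) x - g_approx \<kappa> (Suc k) x) \<le>
      (1 / 2) * norm (g_approx \<kappa> (Suc k) (model_map x) - g_approx \<kappa> k (model_map x))"
    unfolding g_approx.simps(2)[of \<kappa> "Suc k"] g_approx.simps(2)[of \<kappa> k x]
    using L_contraction_Y[of s t] Suc.prems g_approx_near[OF Y'] unfolding x
    by (simp add: dist_norm norm_minus_commute del: g_approx.simps)
  also have "\<dots> \<le> (1 / 2) * ((pi + 1) * (1 / 2) ^ k)" using Suc.IH[OF Y'] by (intro mult_left_mono) auto
  finally show ?case by simp
qed

lemma g_lim_uniform: "uniform_limit (Y K) (g_approx \<kappa>) (g_lim \<kappa>) sequentially"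
proof -
  let ?d = "\<lambda>k x. g_approx \<kappa> (Suc k) x - g_approx \<kappa> k x"
  have "uniform_limit (Y K) (\<lambda>n x. \<Sum>i<n. ?d i x) (\<lambda>x. suminf (\<lambda>i. ?d i x)) sequentially"
  proof (rule Weierstrass_m_test)
    show "summable (\<lambda>k. (pi + 1) * (1 / 2) ^ k)" by (intro summable_mult summable_geometric) simp
  qed (use g_approx_cauchy in blast)
  moreover have "(\<Sum>i<n. ?d i x) = g_approx \<kappa> n x - Z x" for n x
    by (subst sum_lessThan_telescope) simp
  ultimately have ul: "uniform_limit (Y K) (\<lambda>n x. g_approx \<kappa> n x - Z x) (\<lambda>x. suminf (\<lambda>i. ?d i x)) sequentially"
    by simp
  have "uniform_limit (Y K) (\<lambda>n x. (g_approx \<kappa> n x - Z x) + Z x) (\<lambda>x. suminf (\<lambda>i. ?d i x) + Z x) sequentially"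
    by (intro uniform_limit_intros ul)
  hence ul2: "uniform_limit (Y K) (g_approx \<kappa>) (\<lambda>x. suminf (\<lambda>i. ?d i x) + Z x) sequentially" by simp
  have "g_lim \<kappa> x = suminf (\<lambda>i. ?d i x) + Z x" if "x \<in> Y K" for x
    unfolding g_lim_def using tendsto_uniform_limitI[OF ul2 that] by (rule limI)
  thus ?thesis using ul2 by (subst uniform_limit_cong'[where g = "g_approx \<kappa>"]) auto
qed

lemma g_lim_tendsto: "x \<in> Y K \<Longrightarrow> (\<lambda>k. g_approx \<kappa> k x) \<longlonglongrightarrow> g_lim \<kappa> x"
  using tendsto_uniform_limitI[OF g_lim_uniform] by blast

lemma g_lim_near: assumes "x \<in> Y K" shows "norm (g_lim \<kappa> x - Z x) \<le> pi + 1"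
proof (rule tendsto_upperbound)
  show "(\<lambda>k. norm (g_approx \<kappa> k x - Z x)) \<longlonglongrightarrow> norm (g_lim \<kappa> x - Z x)"
    by (intro tendsto_intros g_lim_tendsto assms)
qed (use g_approx_near[OF assms] in auto)

lemma g_lim_mem_cball: "x \<in> Y K \<Longrightarrow> g_lim \<kappa> x \<in> cball (Z x) (pi + 1)"
  using g_lim_near by (simp add: dist_norm norm_minus_commute)

lemma g_lim_eq_L: assumes "x \<in> Y K" shows "g_lim \<kappa> x = L \<kappa> (fst x 0) (g_lim \<kappa> (model_map x))"
proof -
  obtain s t where x: "x = (s, t)" by (cases x)
  have Y': "model_map x \<in> Y K" using assms by (rule Y_model_map)
  have "g_lim \<kappa> (model_map x) - \<kappa> \<notin> \<real>\<^sub>\<le>\<^sub>0"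
    using Y_ball_estimates(1)[of s t] assms g_lim_mem_cball[OF Y'] unfolding x by blast
  hence "(\<lambda>k. g_approx \<kappa> (Suc k) x) \<longlonglongrightarrow> L \<kappa> (fst x 0) (g_lim \<kappa> (model_map x))"
    unfolding g_approx.simps L_def by (intro tendsto_intros g_lim_tendsto Y') 
  moreover have "(\<lambda>k. g_approx \<kappa> (Suc k) x) \<longlonglongrightarrow> g_lim \<kappa> x"
    using g_lim_tendsto[OF assms] by (rule LIMSEQ_Suc)
  ultimately show ?thesis using LIMSEQ_unique by blast
qed

lemma g_lim_E: assumes "x \<in> Y K" shows "E \<kappa> (g_lim \<kappa> x) = g_lim \<kappa> (model_map x)"
proof -
  obtain s t where x: "x = (s, t)" by (cases x)
  have "g_lim \<kappa> (model_map x) \<in> cball (Z (model_map x)) (pi + 1)"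
    using assms Y_model_map g_lim_mem_cball by blast
  hence "g_lim \<kappa> (model_map x) \<noteq> \<kappa>" using Y_ball_estimates(2)[of s t] assms unfolding x by fastforce
  thus ?thesis using g_lim_eq_L[OF assms] E_L by metis
qed

lemma g_lim_E_iter: "x \<in> Y K \<Longrightarrow> (E \<kappa> ^^ n) (g_lim \<kappa> x) = g_lim \<kappa> ((model_map ^^ n) x)"
  by (induction n) (auto simp: g_lim_E model_map_iter_mem)

lemma g_approx_continuous: "continuous_on {t. (s, t) \<in> Y K} (\<lambda>t. g_approx \<kappa> k (s, t))"
proof (induction k arbitrary: s)
  case 0
  show ?case by (simp add: Z_def) (intro continuous_intros)
next
  case (Suc k)
  let ?f = "\<lambda>t. F t - 2 * pi * \<bar>real_of_int (s 1)\<bar>"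
  have cont: "continuous_on {t. (s, t) \<in> Y K} (\<lambda>t. g_approx \<kappa> k (shift s, ?f t))"
  proof (rule continuous_on_compose2[OF Suc])
    show "continuous_on {t. (s, t) \<in> Y K} ?f" unfolding F_def by (intro continuous_intros)
    show "?f ` {t. (s, t) \<in> Y K} \<subseteq> {t. (shift s, t) \<in> Y K}"
      using Y_model_map[of "(s, _)"] by (auto simp: model_map_pair)
  qed
  have "g_approx \<kappa> k (shift s, ?f t) - \<kappa> \<notin> \<real>\<^sub>\<le>\<^sub>0" if "(s, t) \<in> Y K" for t
    using Y_ball_estimates(1)[OF that] g_approx_near[OF Y_model_map[OF that], of k]
    unfolding model_map_pair by (simp add: dist_norm norm_minus_commute)
  hence "continuous_on {t. (s, t) \<in> Y K} (\<lambda>t. L \<kappa> (s 0) (g_approx \<kappa> k (shift s, ?f t)))"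
    unfolding L_def by (intro continuous_intros cont) auto
  thus ?case by (simp add: model_map_pair)
qed

lemma g_lim_continuous: "continuous_on {t. (s, t) \<in> Y K} (\<lambda>t. g_lim \<kappa> (s, t))"
proof (rule uniform_limit_theorem)
  show "\<forall>\<^sub>F n in sequentially. continuous_on {t. (s, t) \<in> Y K} (\<lambda>t. g_approx \<kappa> n (s, t))"
    using g_approx_continuous by simp
  show "uniform_limit {t. (s, t) \<in> Y K} (\<lambda>n t. g_approx \<kappa> n (s, t)) (\<lambda>t. g_lim \<kappa> (s, t)) sequentially"
    using g_lim_uniform unfolding uniform_limit_iff by (auto elim!: eventually_mono)
qed simp

lemma g_lim_escaping: assumes "x \<in> Y K \<inter> X" shows "g_lim \<kappa> x \<in> escaping_set (E \<kappa>)"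
proof -
  obtain s t where x: "x = (s, t)" by (cases x)
  have "filterlim (\<lambda>n. - (pi + 1) + height n s t) at_top sequentially"
    using assms x by (intro filterlim_tendsto_add_at_top[OF tendsto_const]) (auto simp: mem_X)
  moreover have "- (pi + 1) + height n s t \<le> Re ((E \<kappa> ^^ n) (g_lim \<kappa> x))" for n
  proof -
    let ?y = "(model_map ^^ n) x"
    have "norm (g_lim \<kappa> ?y - Z ?y) \<le> pi + 1" using assms by (intro g_lim_near model_map_iter_mem) auto
    hence "\<bar>Re (g_lim \<kappa> ?y - Z ?y)\<bar> \<le> pi + 1" using order_trans[OF abs_Re_le_cmod] by blast
    moreover have "Re (Z ?y) = height n s t" unfolding x model_map_iter by (simp add: Z_def)
    moreover have "(E \<kappa> ^^ n) (g_lim \<kappa> x) = g_lim \<kappa> ?y" using assms by (intro g_lim_E_iter) auto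
    ultimately show ?thesis by (simp add: abs_le_iff)
  qed
  ultimately show ?thesis unfolding escaping_iff_Re
    by (auto intro: filterlim_at_top_mono always_eventually)
qed

lemma g_lim_upd0:
  assumes "(s, t) \<in> Y K"
  shows "g_lim \<kappa> (s(0 := j), t) = g_lim \<kappa> (s, t) + 2 * pi * \<i> * of_int (j - s 0)"
proof -
  have "(s(0 := j), t) \<in> Y K" using assms by (simp add: Y_upd0)
  from g_lim_eq_L[OF this] g_lim_eq_L[OF assms] show ?thesis
    by (simp add: model_map_upd0 L_def algebra_simps)
qed

end

section \<open>Extension along rays\<close>

lemma E_iter_lift_unique:
  fixes u v :: "'a::topological_space \<Rightarrow> complex"
  assumes "connected S" "continuous_on S u" "continuous_on S v"
    and "\<And>x. x \<in> S \<Longrightarrow> (E \<kappa> ^^ m) (u x) = (E \<kappa> ^^ m) (v x)"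
    and "a \<in> S" "u a = v a" "x \<in> S"
  shows "u x = v x"
  using assms
proof (induction m arbitrary: u v x)
  case (Suc m)
  have E: "E \<kappa> (u y) = E \<kappa> (v y)" if "y \<in> S" for y
  proof (rule Suc.IH[OF \<open>connected S\<close> _ _ _ \<open>a \<in> S\<close> _ that])
    show "continuous_on S (\<lambda>y. E \<kappa> (u y))" "continuous_on S (\<lambda>y. E \<kappa> (v y))"
      unfolding E_def using Suc.prems by (auto intro!: continuous_intros)
    show "(E \<kappa> ^^ m) (E \<kappa> (u x)) = (E \<kappa> ^^ m) (E \<kappa> (v x))" if "x \<in> S" for x
      using Suc.prems(4)[OF that] by (simp add: funpow_swap1)
  qed (use Suc.prems in simp)
  show ?case
    by (rule exp_lift_unique[OF Suc.prems(1-3) _ Suc.prems(5-7)]) (use E in \<open>auto simp: E_def\<close>)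
qed simp

lemma height_mono:
  assumes "\<And>n. 0 \<le> height n s t" "t \<le> t'"
  shows "height n s t \<le> height n s t'"
  using height_plus_ge[OF assms(1), of "t' - t" n] assms(2) by simp

lemma ray_subset_X: "(s, t) \<in> X \<Longrightarrow> t \<le> t' \<Longrightarrow> (s, t') \<in> X"
  using X_plus[of s t "t' - t"] by simp

context exp_parameter
begin

text \<open>The orbit is required to be high only from time \<open>n\<close> on. These sets are
  closed upwards, hence intervals on which lifts are unique, and they exhaust the ray as
  \<open>n\<close> grows; \<open>n = 0\<close> is the part in \<open>Y\<close>.\<close>

definition ray_part :: "nat \<Rightarrow> address \<Rightarrow> real set" where
  "ray_part n s = {t. (s, t) \<in> X \<and> (\<forall>m\<ge>n. Q K \<le> height m s t)}"

lemma ray_part_mono: "n \<le> m \<Longrightarrow> ray_part n s \<subseteq> ray_part m s"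
  by (auto simp: ray_part_def)

lemma ray_part_up: "t \<in> ray_part n s \<Longrightarrow> t \<le> t' \<Longrightarrow> t' \<in> ray_part n s"
  unfolding ray_part_def using height_mono[of s t t'] ray_subset_X[of s t t']
  by (auto simp: mem_X intro: order_trans)

lemma convex_ray_part: "convex (ray_part n s)"
  unfolding is_interval_convex_1[symmetric] is_interval_1 using ray_part_up by blast

lemma ray_part_0: "t \<in> ray_part 0 s \<longleftrightarrow> (s, t) \<in> Y K \<inter> X"
  by (auto simp: ray_part_def mem_Y_iff)

lemma ray_part_shift: "t \<in> ray_part (Suc n) s \<Longrightarrow> F t - 2 * pi * \<bar>real_of_int (s 1)\<bar> \<in> ray_part n (shift s)"
  using X_model_map[of "(s, t)"]
  by (auto simp: ray_part_def model_map_pair height_shift simp del: One_nat_def)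

lemma ray_part_shift_0: "t \<in> ray_part 0 s \<Longrightarrow> F t - 2 * pi * \<bar>real_of_int (s 1)\<bar> \<in> ray_part 0 (shift s)"
  using ray_part_shift[of t 0 s] ray_part_mono[of 0 1 s] by auto

lemma ray_part_iter: "t \<in> ray_part n s \<Longrightarrow> (model_map ^^ n) (s, t) \<in> Y K \<inter> X"
  using model_map_iter_mem(1)[of "(s, t)" n]
  by (auto simp: ray_part_def model_map_iter mem_Y_iff height_add)

lemma ray_part_nonempty: assumes "t \<in> ray_part n s" obtains a where "a \<in> ray_part 0 s"
  using X_plus_Y[of s t K "Q K"] assms ray_part_0 by (auto simp: ray_part_def)

lemma X_ray_part: assumes "(s, t) \<in> X" obtains n where "t \<in> ray_part n s"
  using X_eventually_high[OF assms, of "Q K"] assms unfolding ray_part_def by blast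

text \<open>The lift for \<open>Suc n\<close> is a logarithm of the lift for the shifted address
  minus \<kappa>. It exists because the values escape and \<kappa> does not; prescribing it at one
  point of \<open>Y\<close> makes it agree with \<open>g_lim\<close> on the whole of
  \<open>ray_part 0 s\<close>.\<close>

lemma ray_lift_exists:
  assumes "\<kappa> \<notin> escaping_set (E \<kappa>)"
  shows "\<exists>h. continuous_on (ray_part n s) h \<and>
      (\<forall>t \<in> ray_part n s. (E \<kappa> ^^ n) (h t) = g_lim \<kappa> ((model_map ^^ n) (s, t))) \<and>
      (\<forall>t \<in> ray_part 0 s. h t = g_lim \<kappa> (s, t))"
proof (induction n arbitrary: s)
  case 0
  have "continuous_on (ray_part 0 s) (\<lambda>t. g_lim \<kappa> (s, t))"
    by (rule continuous_on_subset[OF g_lim_continuous]) (auto simp: ray_part_0)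
  thus ?case by (intro exI[of _ "\<lambda>t. g_lim \<kappa> (s, t)"]) auto
next
  case (Suc n)
  show ?case
  proof (cases "ray_part (Suc n) s = {}")
    case True
    thus ?thesis using ray_part_mono[of 0 "Suc n" s] by auto
  next
    case False
    then obtain a where a: "a \<in> ray_part 0 s" using ray_part_nonempty by blast
    have a': "a \<in> ray_part (Suc n) s" using a ray_part_mono[of 0 "Suc n" s] by auto
    define f where "f t = F t - 2 * pi * \<bar>real_of_int (s 1)\<bar>" for t
    obtain h' where h': "continuous_on (ray_part n (shift s)) h'"
      "\<And>t. t \<in> ray_part n (shift s) \<Longrightarrow> (E \<kappa> ^^ n) (h' t) = g_lim \<kappa> ((model_map ^^ n) (shift s, t))"
      "\<And>t. t \<in> ray_part 0 (shift s) \<Longrightarrow> h' t = g_lim \<kappa> (shift s, t)"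
      using Suc.IH[of "shift s"] by blast
    have f: "f t \<in> ray_part n (shift s)" if "t \<in> ray_part (Suc n) s" for t
      using ray_part_shift[OF that] by (simp add: f_def)
    have "continuous_on (ray_part (Suc n) s) f" unfolding f_def F_def by (intro continuous_intros)
    hence cont: "continuous_on (ray_part (Suc n) s) (\<lambda>t. h' (f t))"
      by (rule continuous_on_compose2[OF h'(1)]) (auto simp: f)
    have esc: "h' t \<in> escaping_set (E \<kappa>)" if "t \<in> ray_part n (shift s)" for t
      using g_lim_escaping[OF ray_part_iter[OF that]] h'(2)[OF that] escaping_E_iter_iff by metis
    have low: "E \<kappa> (g_lim \<kappa> (s, t)) = h' (f t)" if "t \<in> ray_part 0 s" for t
      using g_lim_E[of "(s, t)"] that ray_part_shift_0[OF that] h'(3)[of "f t"]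
      by (simp add: ray_part_0 model_map_pair f_def)
    obtain v where v: "continuous_on (ray_part (Suc n) s) v"
      "\<And>t. t \<in> ray_part (Suc n) s \<Longrightarrow> exp (v t) = h' (f t) - \<kappa>" "v a = g_lim \<kappa> (s, a)"
    proof (rule log_lift_exists[of "ray_part (Suc n) s" "\<lambda>t. h' (f t) - \<kappa>" a "g_lim \<kappa> (s, a)"])
      show "continuous_on (ray_part (Suc n) s) (\<lambda>t. h' (f t) - \<kappa>)" by (intro continuous_intros cont)
      show "h' (f t) - \<kappa> \<noteq> 0" if "t \<in> ray_part (Suc n) s" for t
        using esc[OF f[OF that]] assms by auto
      show "exp (g_lim \<kappa> (s, a)) = h' (f a) - \<kappa>" using low[OF a] by (simp add: E_def eq_diff_eq)
    qed (auto simp: convex_ray_part a')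
    have Ev: "E \<kappa> (v t) = h' (f t)" if "t \<in> ray_part (Suc n) s" for t
      using v(2)[OF that] by (simp add: E_def)
    show ?thesis
    proof (intro exI conjI ballI)
      fix t assume t: "t \<in> ray_part (Suc n) s"
      have "(E \<kappa> ^^ Suc n) (v t) = (E \<kappa> ^^ n) (h' (f t))" unfolding funpow_Suc_right o_def Ev[OF t] ..
      also have "\<dots> = g_lim \<kappa> ((model_map ^^ n) (model_map (s, t)))"
        using h'(2)[OF f[OF t]] by (simp add: model_map_pair f_def)
      finally show "(E \<kappa> ^^ Suc n) (v t) = g_lim \<kappa> ((model_map ^^ Suc n) (s, t))" by (simp add: funpow_swap1)
    next
      fix t assume t: "t \<in> ray_part 0 s"
      show "v t = g_lim \<kappa> (s, t)"
      proof (rule exp_lift_unique[where u = v and v = "\<lambda>t. g_lim \<kappa> (s, t)", OF _ _ _ _ a v(3) t])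
        show "continuous_on (ray_part 0 s) v"
          by (rule continuous_on_subset[OF v(1) ray_part_mono]) simp
        show "continuous_on (ray_part 0 s) (\<lambda>t. g_lim \<kappa> (s, t))"
          by (rule continuous_on_subset[OF g_lim_continuous]) (auto simp: ray_part_0)
        fix t assume t: "t \<in> ray_part 0 s"
        hence "t \<in> ray_part (Suc n) s" using ray_part_mono[of 0 "Suc n" s] by auto
        from Ev[OF this] low[OF t] have "E \<kappa> (v t) = E \<kappa> (g_lim \<kappa> (s, t))" by simp
        thus "exp (v t) = exp (g_lim \<kappa> (s, t))" by (simp add: E_def)
      qed (intro convex_connected convex_ray_part)
    qed (rule v(1))
  qed
qed

text \<open>Lifts for different \<open>n\<close> agree at a point of \<open>Y\<close>, hence on the
  smaller interval, so they glue. The functional equation follows in the same way: both of its sides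
  lift the same curve and agree at a point of \<open>Y\<close>.\<close>

lemma g_extension_exists:
  assumes "\<kappa> \<notin> escaping_set (E \<kappa>)"
  shows "\<exists>h. is_g_extension \<kappa> K h"
proof -
  define P where "P s n h \<longleftrightarrow> continuous_on (ray_part n s) h \<and>
      (\<forall>t \<in> ray_part n s. (E \<kappa> ^^ n) (h t) = g_lim \<kappa> ((model_map ^^ n) (s, t))) \<and>
      (\<forall>t \<in> ray_part 0 s. h t = g_lim \<kappa> (s, t))" for s n h
  define H where "H s n = (SOME h. P s n h)" for s n
  have "\<exists>h. P s n h" for s n unfolding P_def by (rule ray_lift_exists[OF assms])
  hence "P s n (H s n)" for s n
    unfolding H_def by (rule someI_ex)
  hence H_cont: "\<And>s n. continuous_on (ray_part n s) (H s n)"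
    and H_E: "\<And>s n t. t \<in> ray_part n s \<Longrightarrow> (E \<kappa> ^^ n) (H s n t) = g_lim \<kappa> ((model_map ^^ n) (s, t))"
    and H_0: "\<And>s n t. t \<in> ray_part 0 s \<Longrightarrow> H s n t = g_lim \<kappa> (s, t)"
    unfolding P_def by blast+
  have conn: "connected (ray_part n s)" for n s by (intro convex_connected convex_ray_part)
  have H_mono: "H s n t = H s m t" if nm: "n \<le> m" and tn: "t \<in> ray_part n s" for s n m t
  proof -
    obtain a where a: "a \<in> ray_part 0 s" using ray_part_nonempty tn by blast
    have sub: "ray_part n s \<subseteq> ray_part m s" using nm by (rule ray_part_mono)
    show ?thesis
    proof (rule E_iter_lift_unique[OF conn H_cont _ _ _ _ tn])
      show "continuous_on (ray_part n s) (H s m)" by (rule continuous_on_subset[OF H_cont sub])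
      show "a \<in> ray_part n s" using a ray_part_mono[of 0 n s] by auto
      show "H s n a = H s m a" using a by (simp add: H_0)
      fix t assume t: "t \<in> ray_part n s"
      have "(E \<kappa> ^^ m) (H s n t) = (E \<kappa> ^^ (m - n)) ((E \<kappa> ^^ n) (H s n t))"
        using nm by (simp flip: funpow_add[unfolded o_def fun_eq_iff, rule_format])
      also have "\<dots> = g_lim \<kappa> ((model_map ^^ (m - n)) ((model_map ^^ n) (s, t)))"
        unfolding H_E[OF t] using ray_part_iter[OF t] by (intro g_lim_E_iter) auto
      also have "(model_map ^^ (m - n)) ((model_map ^^ n) (s, t)) = (model_map ^^ m) (s, t)"
        using nm by (simp flip: funpow_add[unfolded o_def fun_eq_iff, rule_format])
      also have "g_lim \<kappa> \<dots> = (E \<kappa> ^^ m) (H s m t)" using H_E[of t m s] t sub by auto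
      finally show "(E \<kappa> ^^ m) (H s n t) = (E \<kappa> ^^ m) (H s m t)" .
    qed
  qed
  define N where "N x = (SOME n. snd x \<in> ray_part n (fst x))" for x
  define h where "h x = H (fst x) (N x) (snd x)" for x
  have h_eq: "h (s, t) = H s n t" if t: "t \<in> ray_part n s" for s t n
  proof -
    have N: "t \<in> ray_part (N (s, t)) s" using someI[of "\<lambda>n. t \<in> ray_part n s", OF t] by (simp add: N_def)
    have "H s (N (s, t)) t = H s n t"
    proof (cases "n \<le> N (s, t)")
      case True
      show ?thesis using H_mono[OF True t] by (rule sym)
    next
      case False
      thus ?thesis by (intro H_mono[OF _ N]) simp
    qed
    thus ?thesis by (simp add: h_def)
  qed
  have "is_g_extension \<kappa> K h"
    unfolding is_g_extension_def
  proof (intro conjI ballI allI)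
    fix x assume x: "x \<in> Y K \<inter> X"
    obtain s t where st: "x = (s, t)" by (cases x)
    have "t \<in> ray_part 0 s" using x st by (simp add: ray_part_0)
    thus "h x = g_lim \<kappa> x" using h_eq[of t 0 s] H_0 st by simp
  next
    show "h ` X \<subseteq> escaping_set (E \<kappa>)"
    proof (rule image_subsetI)
      fix x assume x: "x \<in> X"
      obtain s t where st: "x = (s, t)" by (cases x)
      obtain n where n: "t \<in> ray_part n s" using X_ray_part x st by blast
      show "h x \<in> escaping_set (E \<kappa>)"
        using g_lim_escaping[OF ray_part_iter[OF n]] H_E[OF n] h_eq[OF n] st escaping_E_iter_iff by metis
    qed
  next
    fix x assume x: "x \<in> X"
    obtain s t where st: "x = (s, t)" by (cases x)
    obtain n where n: "t \<in> ray_part n s" using X_ray_part x st by blast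
    have n': "t \<in> ray_part (Suc n) s" using n ray_part_mono[of n "Suc n" s] by auto
    obtain a where a: "a \<in> ray_part 0 s" using ray_part_nonempty n by blast
    define f where "f t = F t - 2 * pi * \<bar>real_of_int (s 1)\<bar>" for t
    have f: "f t \<in> ray_part n (shift s)" if "t \<in> ray_part (Suc n) s" for t
      using ray_part_shift[OF that] by (simp add: f_def)
    have "H (shift s) n (f t) = E \<kappa> (H s (Suc n) t)"
    proof (rule E_iter_lift_unique[OF conn _ _ _ _ _ n'])
      have "continuous_on (ray_part (Suc n) s) f" unfolding f_def F_def by (intro continuous_intros)
      thus "continuous_on (ray_part (Suc n) s) (\<lambda>t. H (shift s) n (f t))"
        by (rule continuous_on_compose2[OF H_cont]) (auto simp: f)
      show "continuous_on (ray_part (Suc n) s) (\<lambda>t. E \<kappa> (H s (Suc n) t))"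
        unfolding E_def by (intro continuous_intros H_cont)
      show "a \<in> ray_part (Suc n) s" using a ray_part_mono[of 0 "Suc n" s] by auto
      have "f a \<in> ray_part 0 (shift s)" using ray_part_shift_0[OF a] by (simp add: f_def)
      thus "H (shift s) n (f a) = E \<kappa> (H s (Suc n) a)"
        using a g_lim_E[of "(s, a)"] by (simp add: H_0 ray_part_0 model_map_pair f_def)
      fix t assume t: "t \<in> ray_part (Suc n) s"
      have "(E \<kappa> ^^ n) (H (shift s) n (f t)) = g_lim \<kappa> ((model_map ^^ n) (model_map (s, t)))"
        using H_E[OF f[OF t]] by (simp add: model_map_pair f_def)
      also have "\<dots> = g_lim \<kappa> ((model_map ^^ Suc n) (s, t))" by (simp add: funpow_swap1)
      also have "\<dots> = (E \<kappa> ^^ n) (E \<kappa> (H s (Suc n) t))" using H_E[OF t] by (simp add: funpow_swap1)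
      finally show "(E \<kappa> ^^ n) (H (shift s) n (f t)) = (E \<kappa> ^^ n) (E \<kappa> (H s (Suc n) t))" .
    qed
    thus "h (model_map x) = E \<kappa> (h x)"
      using h_eq[OF n'] h_eq[OF f[OF n']] st by (simp add: model_map_pair f_def)
  next
    fix s
    have cn: "continuous_on (ray_part n s) (\<lambda>t. h (s, t))" for n
      using H_cont by (rule continuous_on_eq) (simp add: h_eq)
    show "continuous_on {t. (s, t) \<in> X} (\<lambda>t. h (s, t))"
      unfolding continuous_on_eq_continuous_within
    proof
      fix t0 assume t0: "t0 \<in> {t. (s, t) \<in> X}"
      \<comment> \<open>Continuity is local, so it suffices that a relative neighbourhood of
        \<open>t0\<close> in the ray lies in one \<open>ray_part\<close>. If the ray continues below
        \<open>t0\<close>, any lower point provides it; otherwise \<open>t0\<close> is the endpoint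
        and the whole ray lies in one part.\<close>
      have "\<exists>t1 n. {t. (s, t) \<in> X} \<inter> {t1<..} \<subseteq> ray_part n s \<and> t1 < t0"
      proof (cases "\<exists>t<t0. (s, t) \<in> X")
        case True
        then obtain t1 where t1: "t1 < t0" "(s, t1) \<in> X" by blast
        obtain n where "t1 \<in> ray_part n s" using X_ray_part t1(2) by blast
        hence "{t1<..} \<subseteq> ray_part n s" using ray_part_up by fastforce
        thus ?thesis using t1(1) by blast
      next
        case False
        obtain n where n: "t0 \<in> ray_part n s" using X_ray_part t0 by blast
        have "{t. (s, t) \<in> X} \<subseteq> ray_part n s"
        proof
          fix t assume "t \<in> {t. (s, t) \<in> X}"
          hence "t0 \<le> t" using False by (metis mem_Collect_eq not_less)
          thus "t \<in> ray_part n s" by (rule ray_part_up[OF n])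
        qed
        thus ?thesis by (intro exI[of _ "t0 - 1"] exI[of _ n]) auto
      qed
      then obtain t1 n where n: "{t. (s, t) \<in> X} \<inter> {t1<..} \<subseteq> ray_part n s" "t1 < t0" by blast
      have "ray_part n s \<subseteq> {t. (s, t) \<in> X}" by (auto simp: ray_part_def)
      hence "{t. (s, t) \<in> X} \<inter> {t1<..} = ray_part n s \<inter> {t1<..}" using n(1) by blast
      hence "at t0 within {t. (s, t) \<in> X} = at t0 within ray_part n s"
        using n(2) by (intro at_within_nhd[of _ "{t1<..}"]) auto
      moreover have "t0 \<in> ray_part n s" using n t0 by auto
      ultimately show "continuous (at t0 within {t. (s, t) \<in> X}) (\<lambda>t. h (s, t))"
        using cn[of n] unfolding continuous_on_eq_continuous_within by metis
    qed
  qed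
  thus ?thesis by blast
qed

lemma is_g_extension_g: "\<kappa> \<notin> escaping_set (E \<kappa>) \<Longrightarrow> is_g_extension \<kappa> K (g \<kappa> K)"
  unfolding g_def by (rule someI_ex[OF g_extension_exists])

end

section \<open>The extension stays close to the model\<close>

lemma exp_add_2pi_int: "exp (z + 2 * pi * \<i> * of_int k) = exp z"
  using exp_integer_2pi[of "of_int k"] by (simp add: exp_add mult_ac)

lemma escaping_add_2pi_int:
  "z + 2 * pi * \<i> * of_int k \<in> escaping_set (E \<kappa>) \<longleftrightarrow> z \<in> escaping_set (E \<kappa>)"
proof -
  have "E \<kappa> (z + 2 * pi * \<i> * of_int k) = E \<kappa> z" by (simp only: E_def exp_add_2pi_int)
  thus ?thesis using escaping_E_iff by metis
qed

locale tame_extension = exp_parameter +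
  fixes h :: "address \<times> real \<Rightarrow> complex"
  assumes tame: "tame \<kappa>" and extension: "is_g_extension \<kappa> K h"
begin

lemma h_Y: "x \<in> Y K \<Longrightarrow> x \<in> X \<Longrightarrow> h x = g_lim \<kappa> x"
  and h_escaping: "x \<in> X \<Longrightarrow> h x \<in> escaping_set (E \<kappa>)"
  and h_model_map: "x \<in> X \<Longrightarrow> h (model_map x) = E \<kappa> (h x)"
  and h_continuous: "continuous_on {t. (s, t) \<in> X} (\<lambda>t. h (s, t))"
  using extension by (auto simp: is_g_extension_def)

lemma h_iter: "x \<in> X \<Longrightarrow> h ((model_map ^^ n) x) = (E \<kappa> ^^ n) (h x)"
  by (induction n) (auto simp: h_model_map model_map_iter_mem)

lemma h_ray_continuous: "(s, t) \<in> X \<Longrightarrow> continuous_on {0..} (\<lambda>\<tau>. h (s, t + \<tau>))"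
  by (rule continuous_on_compose2[OF h_continuous])
     (auto intro!: continuous_intros intro: ray_subset_X)

text \<open>The two rays have the same image under \<open>E\<close>, so they differ by a constant
  multiple of 2 pi i. It is read off at height \<open>t + Q K\<close>, where \<open>g_lim\<close>
  shows it explicitly.\<close>

lemma h_upd0:
  assumes "(s, t) \<in> X"
  shows "h (s(0 := j), t) = h (s, t) + 2 * pi * \<i> * of_int (j - s 0)"
proof -
  have X': "(s(0 := j), t) \<in> X" using assms by (simp add: X_upd0)
  have Q: "0 \<le> Q K" using Q_pos(2)[of K] by simp
  have "h (s(0 := j), t + 0) = h (s, t + 0) + 2 * pi * \<i> * of_int (j - s 0)"
  proof (rule exp_lift_unique[where S = "{0..}" and a = "Q K" and u = "\<lambda>\<tau>. h (s(0 := j), t + \<tau>)"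
        and v = "\<lambda>\<tau>. h (s, t + \<tau>) + 2 * pi * \<i> * of_int (j - s 0)"])
    show "continuous_on {0..} (\<lambda>\<tau>. h (s(0 := j), t + \<tau>))" using X' by (rule h_ray_continuous)
    show "continuous_on {0..} (\<lambda>\<tau>. h (s, t + \<tau>) + 2 * pi * \<i> * of_int (j - s 0))"
      by (intro continuous_intros h_ray_continuous assms)
    show "exp (h (s(0 := j), t + \<tau>)) = exp (h (s, t + \<tau>) + 2 * pi * \<i> * of_int (j - s 0))" if "\<tau> \<in> {0..}" for \<tau>
    proof -
      have "E \<kappa> (h (s(0 := j), t + \<tau>)) = E \<kappa> (h (s, t + \<tau>))"
        using that X_plus[OF assms, of \<tau>] X_plus[OF X', of \<tau>]
        by (simp add: model_map_upd0 flip: h_model_map)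
      thus ?thesis unfolding exp_add_2pi_int by (simp add: E_def)
    qed
    have YX: "(s, t + Q K) \<in> Y K \<inter> X" by (rule X_plus_Y[OF assms order_refl])
    hence "(s(0 := j), t + Q K) \<in> Y K \<inter> X" by (simp add: Y_upd0 X_upd0)
    thus "h (s(0 := j), t + Q K) = h (s, t + Q K) + 2 * pi * \<i> * of_int (j - s 0)"
      using YX g_lim_upd0[of s "t + Q K" j] h_Y by auto
  qed (use Q in auto)
  thus ?thesis by simp
qed

text \<open>Only the piece of length \<open>Q K\<close> above the point matters: its upper end is
  within pi + 1 of the model, so a large deviation at the lower end forces it across a translated
  barrier.\<close>

lemma h_bounds:
  obtains A C where "0 \<le> A" "0 \<le> C" "\<And>x. x \<in> X \<Longrightarrow> - A \<le> Re (h x)"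
    "\<And>s t. (s, t) \<in> X \<Longrightarrow> \<bar>Im (h (s, t)) - 2 * pi * s 0\<bar> \<le> C"
proof -
  obtain \<delta> H :: real and G :: "real \<Rightarrow> complex"
    where \<delta>: "\<delta> > 0" "ball \<kappa> \<delta> \<inter> escaping_set (E \<kappa>) = {}"
      and G: "continuous_on {0..} G" "Re (G 0) < ln \<delta>" "\<And>t. t \<ge> 0 \<Longrightarrow> G t \<notin> escaping_set (E \<kappa>)"
      "\<And>t. t \<ge> 0 \<Longrightarrow> \<bar>Im (G t)\<bar> \<le> H" "filterlim (\<lambda>t. Re (G t)) at_top at_top"
    using tame_barrier[OF tame] by metis
  have Re_esc: "ln \<delta> \<le> Re z" if "z \<in> escaping_set (E \<kappa>)" for z
  proof -
    have "E \<kappa> z \<notin> ball \<kappa> \<delta>" using \<delta>(2) that escaping_E_iff by blast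
    hence "\<delta> \<le> norm (E \<kappa> z - \<kappa>)" by (simp add: dist_norm norm_minus_commute)
    also have "\<dots> = exp (Re z)" by (simp add: E_comp_eq)
    finally have "ln \<delta> \<le> ln (exp (Re z))" using \<delta>(1) by (subst ln_le_cancel_iff) auto
    thus ?thesis by simp
  qed
  have H0: "0 \<le> H" using G(4)[of 0] by linarith
  have no_crossing: False
    if u: "continuous_on {0..1} u" "\<And>t. t \<in> {0..1} \<Longrightarrow> u t \<in> escaping_set (E \<kappa>)"
      and u0: "Im (u 0) \<le> 2 * pi * of_int k - H - 1" and u1: "2 * pi * of_int k + H + 1 \<le> Im (u 1)"
    for u :: "real \<Rightarrow> complex" and k :: int
  proof -
    \<comment> \<open>The left side of the rectangle separates the starting point of the barrier
      from all escaping points.\<close>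
    define a where "a = (Re (G 0) + ln \<delta>) / 2"
    have a: "Re (G 0) \<le> a" "a < ln \<delta>" using G(2) by (auto simp: a_def)
    have "compact (u ` {0..1})" by (intro compact_continuous_image u) auto
    hence "bounded (u ` {0..1})" by (rule compact_imp_bounded)
    then obtain R where "\<forall>x \<in> u ` {0..1}. norm x \<le> R" unfolding bounded_iff by blast
    hence R: "Re (u t) < R + 1" if "t \<in> {0..1}" for t
    proof -
      have "norm (u t) \<le> R" using \<open>\<forall>x \<in> u ` {0..1}. norm x \<le> R\<close> that by blast
      thus ?thesis using complex_Re_le_cmod[of "u t"] by linarith
    qed
    have "eventually (\<lambda>t. R + 1 \<le> Re (G t) \<and> 0 \<le> t) at_top"
      using G(5) unfolding filterlim_at_top by (intro eventually_conj eventually_ge_at_top) blast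
    then obtain T1 where T1: "R + 1 \<le> Re (G T1)" "0 \<le> T1"
      unfolding eventually_at_top_linorder by (metis order_refl)
    define v where "v t = G (T1 * t) + 2 * pi * \<i> * of_int k" for t
    have Imv: "Im (v t) = Im (G (T1 * t)) + 2 * pi * of_int k" for t by (simp add: v_def)
    have Rev: "Re (v t) = Re (G (T1 * t))" for t by (simp add: v_def)
    have contv: "continuous_on {0..1} v" unfolding v_def
      by (intro continuous_intros continuous_on_compose2[OF G(1)]) (use T1 in auto)
    obtain s t where st: "s \<in> {0..1}" "t \<in> {0..1}" "u s = v t"
    proof (rule crossing_paths_meet[OF u(1) contv])
      show "a < Re (u t) \<and> Re (u t) < R + 1" if "t \<in> {0..1}" for t
        using R[OF that] Re_esc[OF u(2)[OF that]] a by linarith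
      show "2 * pi * of_int k - H - 1 < Im (v t) \<and> Im (v t) < 2 * pi * of_int k + H + 1"
        if "t \<in> {0..1}" for t
      proof -
        have "\<bar>Im (G (T1 * t))\<bar> \<le> H" using that T1 by (intro G(4)) auto
        thus ?thesis unfolding Imv by (simp add: abs_le_iff)
      qed
      show "Re (v 0) \<le> a" "R + 1 \<le> Re (v 1)" unfolding Rev using a T1 by auto
    qed (use u0 u1 in auto)
    have "G (T1 * t) \<notin> escaping_set (E \<kappa>)" using st T1 by (intro G(3)) auto
    hence "v t \<notin> escaping_set (E \<kappa>)" unfolding v_def using escaping_add_2pi_int by blast
    thus False using u(2)[OF st(1)] st(3) by simp
  qed
  \<comment> \<open>The strip of half-width \<open>H + 1\<close> around the \<open>k\<close>-th
    translate then lies above all points with imaginary part at most pi + 1.\<close>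
  define k :: int where "k = \<lceil>H + pi + 2\<rceil>"
  have "1 * of_int k \<le> 2 * pi * of_int k"
    using H0 pi_gt3 unfolding k_def by (intro mult_right_mono) auto
  hence k: "H + pi + 2 \<le> 2 * pi * of_int k" unfolding k_def by linarith
  show thesis
  proof (rule that[of "\<bar>ln \<delta>\<bar>" "2 * pi * of_int k + H + 1"])
    show "- \<bar>ln \<delta>\<bar> \<le> Re (h x)" if "x \<in> X" for x
      using Re_esc[OF h_escaping[OF that]] by linarith
    show "0 \<le> 2 * pi * of_int k + H + 1" using k H0 pi_gt_zero by linarith
    fix s t assume st: "(s, t) \<in> X"
    define \<rho> where "\<rho> \<tau> = h (s, t + \<tau>) + 2 * pi * \<i> * of_int (- s 0)" for \<tau>
    have cont: "continuous_on {0..} \<rho>" unfolding \<rho>_def by (intro continuous_intros h_ray_continuous st)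
    have esc: "\<rho> \<tau> \<in> escaping_set (E \<kappa>)" if "0 \<le> \<tau>" for \<tau>
      unfolding \<rho>_def escaping_add_2pi_int using X_plus[OF st that] by (rule h_escaping)
    have Qp: "0 < Q K" by (rule Q_pos)
    have far: "\<bar>Im (\<rho> (Q K))\<bar> \<le> pi + 1"
    proof -
      have YX: "(s, t + Q K) \<in> Y K \<inter> X" by (rule X_plus_Y[OF st order_refl])
      hence "norm (h (s, t + Q K) - Z (s, t + Q K)) \<le> pi + 1" using g_lim_near h_Y by auto
      hence "\<bar>Im (h (s, t + Q K) - Z (s, t + Q K))\<bar> \<le> pi + 1" by (rule order_trans[OF abs_Im_le_cmod])
      moreover have "Im (h (s, t + Q K) - Z (s, t + Q K)) = Im (\<rho> (Q K))" by (simp add: \<rho>_def Z_def)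
      ultimately show ?thesis by simp
    qed
    have "Im (\<rho> 0) \<le> 2 * pi * of_int k + H + 1"
    proof (rule ccontr)
      assume *: "\<not> ?thesis"
      show False
      proof (rule no_crossing[of "\<lambda>\<tau>. \<rho> (Q K * (1 - \<tau>))" k])
        show "continuous_on {0..1} (\<lambda>\<tau>. \<rho> (Q K * (1 - \<tau>)))"
          by (intro continuous_on_compose2[OF cont] continuous_intros) (use Qp in auto)
        show "Im (\<rho> (Q K * (1 - 0))) \<le> 2 * pi * of_int k - H - 1"
          using far k unfolding diff_zero mult_1_right by linarith
        show "2 * pi * of_int k + H + 1 \<le> Im (\<rho> (Q K * (1 - 1)))" using * by simp
      qed (use Qp in \<open>auto intro!: esc\<close>)
    qed
    moreover have "- (2 * pi * of_int k + H + 1) \<le> Im (\<rho> 0)"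
    proof (rule ccontr)
      assume *: "\<not> ?thesis"
      show False
      proof (rule no_crossing[of "\<lambda>\<tau>. \<rho> (Q K * \<tau>)" "- k"])
        show "continuous_on {0..1} (\<lambda>\<tau>. \<rho> (Q K * \<tau>))"
          by (intro continuous_on_compose2[OF cont] continuous_intros) (use Qp in auto)
        show "Im (\<rho> (Q K * 0)) \<le> 2 * pi * of_int (- k) - H - 1" using * by simp
        show "2 * pi * of_int (- k) + H + 1 \<le> Im (\<rho> (Q K * 1))"
          using far k unfolding mult_1_right of_int_minus by linarith
      qed (use Qp in \<open>auto intro!: esc\<close>)
    qed
    moreover have "Im (\<rho> 0) = Im (h (s, t)) - 2 * pi * s 0" by (simp add: \<rho>_def)
    ultimately show "\<bar>Im (h (s, t)) - 2 * pi * s 0\<bar> \<le> 2 * pi * of_int k + H + 1" by (simp add: abs_le_iff)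
  qed simp
qed

text \<open>Induction on the time of entry into \<open>Y\<close>, with bounds \<open>D\<close> above
  and \<open>D'\<close> below that one pullback reproduces. Taking logarithms turns additive errors
  into bounded factors of \<open>exp t\<close>, which \<open>exp D\<close> absorbs. The lower bound
  uses this only for large \<open>t\<close>; for small \<open>t\<close> the bound
  \<open>- A \<le> Re (h x)\<close> is enough.\<close>

lemma h_near_exists: "\<exists>C\<ge>0. \<forall>x \<in> X. norm (h x - Z x) \<le> C"
proof -
  obtain A C where A: "0 \<le> A" "\<And>x. x \<in> X \<Longrightarrow> - A \<le> Re (h x)" and C: "0 \<le> C"
    "\<And>s t. (s, t) \<in> X \<Longrightarrow> \<bar>Im (h (s, t)) - 2 * pi * s 0\<bar> \<le> C"
    using h_bounds by metis
  note K0 = K_nonneg and pi0 = pi_gt_zero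
  \<comment> \<open>Both constants are so large that the exponentials in \<open>expD\<close> and
    \<open>expD'\<close> beat the linear terms; a quadratic Taylor bound suffices for this.\<close>
  define D where "D = A + C + K + pi + 2"
  define D' where "D' = A + (8 + 2 * (A + C + 2 * K) + pi)"
  have D: "pi + 1 \<le> D" "2 \<le> D" using A C K0 pi0 by (auto simp: D_def)
  have expD: "1 + A + D + C + K \<le> exp D"
  proof -
    have "D * 2 \<le> D * D" using D by (intro mult_left_mono) auto
    moreover have "1 + D + D * D / 2 \<le> exp D"
      using exp_lower_Taylor_quadratic[of D] D by (simp add: power2_eq_square)
    moreover have "A + C + K \<le> D" using pi0 by (simp add: D_def)
    ultimately show ?thesis by linarith
  qed
  have D': "pi + 1 \<le> D'" "2 \<le> D'" using A C K0 pi0 by (auto simp: D'_def)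
  have expD': "2 * (1 + D' + C + 2 * K) \<le> exp (D' - A)"
  proof -
    define y where "y = D' - A"
    have y: "y \<ge> 8" "y \<ge> 8 + 2 * (A + C + 2 * K)" using A C K0 pi0 by (auto simp: y_def D'_def)
    have "y * 8 \<le> y * y" using y by (intro mult_left_mono) auto
    moreover have "1 + y + y * y / 2 \<le> exp y"
      using exp_lower_Taylor_quadratic[of y] y by (simp add: power2_eq_square)
    ultimately have "1 + y + 4 * y \<le> exp y" by linarith
    thus ?thesis using y K0 C(1) A(1) unfolding y_def by argo
  qed
  have base: "\<bar>Re (h x) - T x\<bar> \<le> pi + 1" if "x \<in> Y K" "x \<in> X" for x
  proof -
    have "\<bar>Re (h x - Z x)\<bar> \<le> pi + 1"
      using order_trans[OF abs_Re_le_cmod g_lim_near[OF that(1)]] h_Y[OF that] by simp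
    thus ?thesis by (simp add: Z_def T_def)
  qed
  have step: "Re (h x) - T x \<le> D \<and> - D' \<le> Re (h x) - T x" if "x \<in> X" "(model_map ^^ n) x \<in> Y K" for n x
    using that
  proof (induction n arbitrary: x)
    case 0
    thus ?case using base[of x] D D' by auto
  next
    case (Suc n)
    obtain s t where x: "x = (s, t)" by (cases x)
    define t1 where "t1 = F t - 2 * pi * \<bar>real_of_int (s 1)\<bar>"
    define b where "b = 2 * pi * \<bar>real_of_int (s 1)\<bar>"
    define z where "z = h (shift s, t1)"
    have y: "model_map x = (shift s, t1)" by (simp add: x model_map_pair t1_def)
    have yX: "(shift s, t1) \<in> X" using X_model_map[OF Suc.prems(1)] y by simp
    have IH: "Re z - t1 \<le> D" "- D' \<le> Re z - t1"
      using Suc.IH[OF X_model_map[OF Suc.prems(1)]] Suc.prems(2) by (simp_all add: funpow_swap1 y z_def T_def)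
    have t1: "0 \<le> t1" using yX by (rule X_nonneg)
    have t: "0 \<le> t" using Suc.prems(1) unfolding x by (rule X_nonneg)
    have b: "0 \<le> b" by (simp add: b_def)
    have sum: "exp t = 1 + t1 + b" by (simp add: t1_def b_def F_def)
    have Im_z: "\<bar>Im z - 2 * pi * s 1\<bar> \<le> C" using C(2)[OF yX] by (simp add: z_def shift_def)
    have "\<bar>2 * pi * s 1\<bar> = b" by (simp add: b_def abs_mult)
    hence Im_le: "\<bar>Im z\<bar> \<le> b + C" and Im_ge: "b - C \<le> \<bar>Im z\<bar>" using Im_z by linarith+
    have Re_ge: "- A \<le> Re z" unfolding z_def by (rule A(2)[OF yX])
    have "z = E \<kappa> (h x)" using h_model_map[OF Suc.prems(1)] by (simp add: y z_def)
    hence ez: "exp (Re (h x)) = norm (z - \<kappa>)" by (simp add: E_comp_eq)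
    have "\<bar>Re z\<bar> \<le> A + t1 + D" using Re_ge IH(1) t1 A(1) D pi0 by linarith
    hence "norm z \<le> (A + t1 + D) + (b + C)" using cmod_le[of z] Im_le by linarith
    hence "norm (z - \<kappa>) \<le> exp t + (A + D + C + K)" using norm_triangle_ineq4[of z \<kappa>] norm_le_K sum by linarith
    also have "\<dots> \<le> exp t + exp t * (A + D + C + K)"
      using t A C D K0 mult_right_mono[of 1 "exp t" "A + D + C + K"] by simp
    also have "\<dots> = exp t * (1 + A + D + C + K)" by (simp add: algebra_simps)
    also have "\<dots> \<le> exp t * exp D" by (intro mult_left_mono expD) simp
    finally have "exp (Re (h x)) \<le> exp (t + D)" by (simp add: ez exp_add)
    hence upper: "Re (h x) - t \<le> D" by simp
    have "Re z + \<bar>Im z\<bar> \<le> 2 * norm z" using complex_Re_le_cmod[of z] abs_Im_le_cmod[of z] by linarith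
    moreover have "norm z - K \<le> norm (z - \<kappa>)" using norm_triangle_ineq2[of z \<kappa>] norm_le_K by linarith
    ultimately have low: "(exp t - 1 - D' - C - 2 * K) / 2 \<le> exp (Re (h x))"
      unfolding ez using IH(2) Im_ge sum by argo
    have "- D' \<le> Re (h x) - t"
    \<comment> \<open>For large \<open>t\<close> the estimate \<open>low\<close> leaves at least a
      quarter of \<open>exp t\<close>, a loss of at most 2 in the exponent, and \<open>D'\<close> is
      at least 2.\<close>
    proof (cases "2 * (1 + D' + C + 2 * K) \<le> exp t")
      case True
      have e2: "4 \<le> exp (2::real)" using exp_lower_Taylor_quadratic[of "2::real"] by (simp add: power2_eq_square)
      have "exp (t - 2) = exp t / exp 2" by (simp add: exp_diff)
      also have "\<dots> \<le> exp t / 4" using e2 by (intro divide_left_mono) auto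
      also have "\<dots> \<le> exp (Re (h x))" using low True by argo
      finally show ?thesis using D' by simp
    next
      case False
      hence "exp t < exp (D' - A)" using expD' by linarith
      hence "t < D' - A" by simp
      thus ?thesis using A(2)[OF Suc.prems(1)] by linarith
    qed
    thus ?case using upper by (simp add: x T_def)
  qed
  show ?thesis
  proof (intro exI[of _ "D + D' + C"] conjI ballI)
    show "0 \<le> D + D' + C" using D D' C by linarith
    fix x assume x: "x \<in> X"
    obtain s t where st: "x = (s, t)" by (cases x)
    obtain n where "(model_map ^^ n) x \<in> Y K" using X_eventually_Y[OF x] .
    hence "\<bar>Re (h x) - T x\<bar> \<le> D + D'" using step[OF x] D D' by fastforce
    moreover have "\<bar>Im (h x) - 2 * pi * s 0\<bar> \<le> C" using C(2) x st by simp
    moreover have "Re (h x - Z x) = Re (h x) - T x" "Im (h x - Z x) = Im (h x) - 2 * pi * s 0"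
      by (simp_all add: Z_def T_def st)
    ultimately show "norm (h x - Z x) \<le> D + D' + C" using cmod_le[of "h x - Z x"] by linarith
  qed
qed

definition model_dist :: real where
  "model_dist = (SOME C. 0 \<le> C \<and> (\<forall>x \<in> X. norm (h x - Z x) \<le> C))"

lemma model_dist: "0 \<le> model_dist" "x \<in> X \<Longrightarrow> norm (h x - Z x) \<le> model_dist"
  using someI_ex[OF h_near_exists[unfolded Bex_def], folded model_dist_def] by auto

text \<open>At this height \<open>h\<close> has real part at least K + 3, one more than
  \<open>half_plane\<close> asks for.\<close>

definition far :: real where "far = model_dist + K + 3"

lemma far_Re: assumes "x \<in> X" "far \<le> snd x" shows "K + 3 \<le> Re (h x)"
proof -
  have "\<bar>Re (h x - Z x)\<bar> \<le> model_dist" using order_trans[OF abs_Re_le_cmod model_dist(2)[OF assms(1)]] .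
  thus ?thesis using assms(2) by (simp add: far_def Z_def abs_le_iff)
qed

lemma half_plane: assumes "K + 2 \<le> Re w" shows "w - \<kappa> \<notin> \<real>\<^sub>\<le>\<^sub>0" "2 \<le> norm (w - \<kappa>)" "0 < Re (w - \<kappa>)"
proof -
  have "Re \<kappa> \<le> K" using complex_Re_le_cmod[of \<kappa>] norm_le_K by linarith
  hence *: "2 \<le> Re (w - \<kappa>)" using assms by simp
  thus "0 < Re (w - \<kappa>)" "2 \<le> norm (w - \<kappa>)" using complex_Re_le_cmod[of "w - \<kappa>"] by linarith+
  show "w - \<kappa> \<notin> \<real>\<^sub>\<le>\<^sub>0" using * by (auto simp: complex_nonpos_Reals_iff)
qed

lemma half_plane_contraction:
  assumes "K + 2 \<le> Re w" "K + 2 \<le> Re w'"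
  shows "norm (L \<kappa> j w - L \<kappa> j w') \<le> (1 / 2) * norm (w - w')"
  by (rule log_branch_contraction[OF convex_halfspace_Re_ge[of "K + 2"]])
     (use assms half_plane in auto)

text \<open>Both sides lift the same curve along the ray above \<open>t\<close> and agree after an
  ascent by \<open>Q K\<close>. The right side is continuous because the images stay in a half-plane
  away from the branch cut.\<close>

lemma h_eq_L:
  assumes "x \<in> X" "far \<le> snd (model_map x)"
  shows "h x = L \<kappa> (fst x 0) (h (model_map x))"
proof -
  obtain s t where x: "x = (s, t)" by (cases x)
  have st: "(s, t) \<in> X" using assms x by simp
  have far: "K + 2 \<le> Re (h (model_map (s, t + \<tau>)))" if "0 \<le> \<tau>" for \<tau>
  proof -
    have "snd (model_map (s, t)) \<le> snd (model_map (s, t + \<tau>))"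
      using that by (simp add: model_map_pair F_def)
    hence "K + 3 \<le> Re (h (model_map (s, t + \<tau>)))"
      using assms(2) x X_plus[OF st that] by (intro far_Re X_model_map) auto
    thus ?thesis by simp
  qed
  have hE: "h (model_map (s, t + \<tau>)) = E \<kappa> (h (s, t + \<tau>))" if "0 \<le> \<tau>" for \<tau>
    by (rule h_model_map[OF X_plus[OF st that]])
  have "h (s, t + 0) = L \<kappa> (s 0) (h (model_map (s, t + 0)))"
  proof (rule exp_lift_unique[where S = "{0..}" and a = "Q K" and u = "\<lambda>\<tau>. h (s, t + \<tau>)"
        and v = "\<lambda>\<tau>. L \<kappa> (s 0) (h (model_map (s, t + \<tau>)))"])
    show "continuous_on {0..} (\<lambda>\<tau>. h (s, t + \<tau>))" by (rule h_ray_continuous[OF st])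
    have "continuous_on {0..} (\<lambda>\<tau>. E \<kappa> (h (s, t + \<tau>)))"
      unfolding E_def by (intro continuous_intros h_ray_continuous[OF st])
    hence "continuous_on {0..} (\<lambda>\<tau>. h (model_map (s, t + \<tau>)))"
      by (rule continuous_on_eq) (simp add: hE)
    thus "continuous_on {0..} (\<lambda>\<tau>. L \<kappa> (s 0) (h (model_map (s, t + \<tau>))))"
      unfolding L_def using half_plane(1)[OF far] by (intro continuous_intros) auto
    show "exp (h (s, t + \<tau>)) = exp (L \<kappa> (s 0) (h (model_map (s, t + \<tau>))))" if "\<tau> \<in> {0..}" for \<tau>
    proof -
      have "h (model_map (s, t + \<tau>)) \<noteq> \<kappa>" using half_plane(2)[OF far[of \<tau>]] that by auto
      from E_L[OF this, of "s 0"] have "E \<kappa> (L \<kappa> (s 0) (h (model_map (s, t + \<tau>)))) = E \<kappa> (h (s, t + \<tau>))"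
        using hE[of \<tau>] that by simp
      thus ?thesis by (simp add: E_def)
    qed
    have YX: "(s, t + Q K) \<in> Y K" "(s, t + Q K) \<in> X" using X_plus_Y[OF st order_refl] by auto
    show "h (s, t + Q K) = L \<kappa> (s 0) (h (model_map (s, t + Q K)))"
      using g_lim_eq_L[OF YX(1)] h_Y[OF YX] h_Y[OF Y_model_map[OF YX(1)] X_model_map[OF YX(2)]] by simp
  qed (use Q_pos(2)[of K] in auto)
  thus ?thesis by (simp add: x)
qed

end

section \<open>Continuity of the extension\<close>

text \<open>For addresses, convergence in the lexicographic order topology means that every entry is
  eventually constant, because cylinders form neighbourhood bases.\<close>

definition model_tendsto :: "(nat \<Rightarrow> address \<times> real) \<Rightarrow> address \<times> real \<Rightarrow> bool" where
  "model_tendsto x x0 \<longleftrightarrow> (\<forall>n. \<forall>\<^sub>F j in sequentially. fst (x j) n = fst x0 n) \<and>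
     (\<lambda>j. snd (x j)) \<longlonglongrightarrow> snd x0"

lemma model_tendsto_model_map:
  assumes "model_tendsto x x0"
  shows "model_tendsto (\<lambda>j. model_map (x j)) (model_map x0)"
proof -
  have ev: "\<And>n. \<forall>\<^sub>F j in sequentially. fst (x j) n = fst x0 n"
    and lim: "(\<lambda>j. snd (x j)) \<longlonglongrightarrow> snd x0"
    using assms by (auto simp: model_tendsto_def)
  have "(\<lambda>j. F (snd (x j)) - 2 * pi * \<bar>real_of_int (fst x0 1)\<bar>) \<longlonglongrightarrow>
      F (snd x0) - 2 * pi * \<bar>real_of_int (fst x0 1)\<bar>"
    unfolding F_def by (intro tendsto_intros lim)
  moreover have "\<forall>\<^sub>F j in sequentially. F (snd (x j)) - 2 * pi * \<bar>real_of_int (fst x0 1)\<bar> =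
      F (snd (x j)) - 2 * pi * \<bar>real_of_int (fst (x j) 1)\<bar>"
    using ev[of 1] by eventually_elim simp
  ultimately have "(\<lambda>j. F (snd (x j)) - 2 * pi * \<bar>real_of_int (fst (x j) 1)\<bar>) \<longlonglongrightarrow>
      F (snd x0) - 2 * pi * \<bar>real_of_int (fst x0 1)\<bar>" by (rule Lim_transform_eventually)
  thus ?thesis using ev by (simp add: model_tendsto_def model_map_def shift_def)
qed

lemma model_tendsto_iter:
  "model_tendsto x x0 \<Longrightarrow> model_tendsto (\<lambda>j. (model_map ^^ n) (x j)) ((model_map ^^ n) x0)"
  by (induction n) (auto intro: model_tendsto_model_map)

lemma model_tendsto_subseq:
  assumes "model_tendsto x x0" "strict_mono r"
  shows "model_tendsto (\<lambda>i. x (r i)) x0"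
  using assms eventually_subseq[OF assms(2)] LIMSEQ_subseq_LIMSEQ[of "\<lambda>j. snd (x j)" "snd x0" r]
  unfolding model_tendsto_def o_def by blast

lemma fst_model_map_iter: "fst ((model_map ^^ n) x) k = fst x (k + n)"
  by (cases x) (simp add: model_map_iter)

context tame_extension
begin

lemma far_ge: "3 \<le> far"
  using model_dist(1) K_nonneg by (simp add: far_def)

lemma far_orbit_contraction:
  assumes "x \<in> X" "y \<in> X" "\<And>n. n < N \<Longrightarrow> fst x n = fst y n"
    and "\<And>n. \<lbrakk>0 < n; n \<le> N\<rbrakk> \<Longrightarrow> far \<le> snd ((model_map ^^ n) x) \<and> far \<le> snd ((model_map ^^ n) y)"
  shows "norm (h x - h y) \<le> (1 / 2) ^ N * norm (h ((model_map ^^ N) x) - h ((model_map ^^ N) y))"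
  using assms
proof (induction N arbitrary: x y)
  case (Suc N)
  have fx: "far \<le> snd (model_map x)" and fy: "far \<le> snd (model_map y)" using Suc.prems(4)[of 1] by auto
  have X': "model_map x \<in> X" "model_map y \<in> X" using Suc.prems by (auto intro: X_model_map)
  have "norm (h x - h y) = norm (L \<kappa> (fst y 0) (h (model_map x)) - L \<kappa> (fst y 0) (h (model_map y)))"
    using h_eq_L[OF Suc.prems(1) fx] h_eq_L[OF Suc.prems(2) fy] Suc.prems(3)[of 0] by simp
  also have "\<dots> \<le> (1 / 2) * norm (h (model_map x) - h (model_map y))"
    using far_Re[OF X'(1) fx] far_Re[OF X'(2) fy] by (intro half_plane_contraction) auto
  also have "norm (h (model_map x) - h (model_map y)) \<le> (1 / 2) ^ N *
      norm (h ((model_map ^^ N) (model_map x)) - h ((model_map ^^ N) (model_map y)))"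
  proof (rule Suc.IH[OF X'])
    show "fst (model_map x) n = fst (model_map y) n" if "n < N" for n
      using Suc.prems(3)[of "Suc n"] that by (simp add: model_map_def shift_def)
    show "far \<le> snd ((model_map ^^ n) (model_map x)) \<and> far \<le> snd ((model_map ^^ n) (model_map y))"
      if "0 < n" "n \<le> N" for n
      using Suc.prems(4)[of "Suc n"] that by (simp add: funpow_swap1)
  qed
  finally show ?case by (simp add: funpow_swap1)
qed simp

definition seq_cont_at :: "address \<times> real \<Rightarrow> bool" where
  "seq_cont_at x0 \<longleftrightarrow> (\<forall>x. (\<forall>j. x j \<in> X) \<longrightarrow> model_tendsto x x0 \<longrightarrow> (\<lambda>j. h (x j)) \<longlonglongrightarrow> h x0)"

text \<open>At time \<open>N\<close> nearby points share the current entry and have heights within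
  1, so their images are within 2 * model_dist + 1. Going back \<open>N\<close> steps multiplies
  this by at most (1/2)^N.\<close>

lemma seq_cont_at_far:
  assumes "x0 \<in> X" "\<And>n. far + 1 \<le> snd ((model_map ^^ n) x0)"
  shows "seq_cont_at x0"
  unfolding seq_cont_at_def
proof (intro allI impI)
  fix x assume xX: "\<forall>j. x j \<in> X" and lim: "model_tendsto x x0"
  show "(\<lambda>j. h (x j)) \<longlonglongrightarrow> h x0"
  proof (rule tendstoI)
    fix \<epsilon> :: real assume \<epsilon>: "\<epsilon> > 0"
    define B where "B = 2 * model_dist + 1"
    have "(\<lambda>N. (1 / 2) ^ N * B) \<longlonglongrightarrow> 0 * B" by (intro tendsto_intros LIMSEQ_power_zero) simp
    hence "eventually (\<lambda>N. (1 / 2) ^ N * B < \<epsilon>) sequentially" using \<epsilon> by (intro order_tendstoD) auto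
    then obtain N where N: "(1 / 2) ^ N * B < \<epsilon>" unfolding eventually_sequentially by blast
    have ev: "\<forall>\<^sub>F j in sequentially. fst (x j) n = fst x0 n \<and>
        dist (snd ((model_map ^^ n) (x j))) (snd ((model_map ^^ n) x0)) < 1" for n
      using lim model_tendsto_iter[OF lim, of n] unfolding model_tendsto_def
      by (intro eventually_conj tendstoD) auto
    have "\<forall>\<^sub>F j in sequentially. \<forall>n \<in> {..N}. fst (x j) n = fst x0 n \<and>
        dist (snd ((model_map ^^ n) (x j))) (snd ((model_map ^^ n) x0)) < 1"
      using ev by (simp add: eventually_ball_finite)
    thus "\<forall>\<^sub>F j in sequentially. dist (h (x j)) (h x0) < \<epsilon>"
    proof eventually_elim
      case (elim j)
      let ?y = "(model_map ^^ N) (x j)" and ?w = "(model_map ^^ N) x0"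
      have XN: "?y \<in> X" "?w \<in> X" using xX assms(1) by (auto intro: model_map_iter_mem)
      have "norm (h (x j) - h x0) \<le> (1 / 2) ^ N * norm (h ?y - h ?w)"
      proof (rule far_orbit_contraction)
        show "far \<le> snd ((model_map ^^ n) (x j)) \<and> far \<le> snd ((model_map ^^ n) x0)" if "0 < n" "n \<le> N" for n
          using assms(2)[of n] elim that by (auto simp: dist_real_def abs_less_iff)
             (smt (verit) atMost_iff)
      qed (use xX assms elim in auto)
      also have "norm (h ?y - h ?w) \<le> B"
      proof -
        have "fst ?y 0 = fst ?w 0" using elim by (simp add: fst_model_map_iter)
        hence "Z ?y - Z ?w = of_real (snd ?y - snd ?w)" by (simp add: Z_def)
        hence "norm (Z ?y - Z ?w) = \<bar>snd ?y - snd ?w\<bar>" by (simp only: norm_of_real)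
        hence "norm (Z ?y - Z ?w) \<le> 1" using bspec[OF elim, of N] by (simp add: dist_real_def)
        moreover have "norm (h ?y - h ?w) \<le> norm (h ?y - Z ?y) + norm (Z ?y - Z ?w) + norm (h ?w - Z ?w)"
          using norm_triangle_ineq[of "h ?y - Z ?y" "Z ?y - Z ?w"] norm_triangle_ineq4[of "h ?y - Z ?w" "h ?w - Z ?w"]
          by simp
        ultimately show ?thesis using model_dist(2)[OF XN(1)] model_dist(2)[OF XN(2)] by (simp add: B_def)
      qed
      finally have "norm (h (x j) - h x0) \<le> (1 / 2) ^ N * B" by simp
      thus ?case using N by (simp add: dist_norm)
    qed
  qed
qed

text \<open>The logarithm could only pick a wrong branch in the limit. As the branch is right at \<open>\<tau>0\<close>, the
  intermediate value theorem would then give parameters at which the difference of the two rays has a fixed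
  norm \<open>e \<le> 1\<close> although its exponential tends to 1.\<close>

lemma seq_cont_at_pullback:
  assumes st: "(s, t) \<in> X" and \<tau>0: "0 \<le> \<tau>0" and far: "seq_cont_at (s, t + \<tau>0)"
    and image: "\<And>\<tau>. 0 \<le> \<tau> \<Longrightarrow> seq_cont_at (model_map (s, t + \<tau>))"
  shows "seq_cont_at (s, t)"
  unfolding seq_cont_at_def
proof (intro allI impI, rule ccontr)
  fix x assume xX: "\<forall>j. x j \<in> X" and lim: "model_tendsto x (s, t)"
    and not: "\<not> (\<lambda>j. h (x j)) \<longlonglongrightarrow> h (s, t)"
  define y where "y j \<tau> = (fst (x j), snd (x j) + \<tau>)" for j \<tau>
  have yX: "y j \<tau> \<in> X" if "0 \<le> \<tau>" for j \<tau>
    using X_plus[of "fst (x j)" "snd (x j)" \<tau>] xX that by (simp add: y_def)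
  have y_lim: "model_tendsto (\<lambda>i. y (r i) (\<tau> i)) (s, t + \<tau>')" if "strict_mono r" "\<tau> \<longlonglongrightarrow> \<tau>'" for r \<tau> \<tau>'
    using model_tendsto_subseq[OF lim that(1)] that(2)
    by (auto simp: model_tendsto_def y_def intro!: tendsto_add)
  define d where "d j \<tau> = h (y j \<tau>) - h (s, t + \<tau>)" for j \<tau>
  obtain \<epsilon> where \<epsilon>: "\<epsilon> > 0" "\<not> eventually (\<lambda>j. dist (h (x j)) (h (s, t)) < \<epsilon>) sequentially"
    using not unfolding tendsto_iff by blast
  \<comment> \<open>The cap 1 < pi ensures that the difference of the rays is recovered from its
    exponential by the principal logarithm.\<close>
  define e where "e = min \<epsilon> 1"
  have e: "0 < e" "e \<le> 1" using \<epsilon> by (auto simp: e_def)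
  have "\<forall>\<^sub>F j in sequentially. norm (d j \<tau>0) < e"
  proof -
    have "model_tendsto (\<lambda>j. y j \<tau>0) (s, t + \<tau>0)" using y_lim[of id "\<lambda>_. \<tau>0" \<tau>0] by (simp add: strict_mono_def)
    hence "(\<lambda>j. h (y j \<tau>0)) \<longlonglongrightarrow> h (s, t + \<tau>0)"
      using far[unfolded seq_cont_at_def, rule_format, of "\<lambda>j. y j \<tau>0"] yX[OF \<tau>0] by simp
    from tendstoD[OF this e(1)] show ?thesis by (simp add: d_def dist_norm)
  qed
  then obtain M where M: "\<And>j. j \<ge> M \<Longrightarrow> norm (d j \<tau>0) < e" unfolding eventually_sequentially by blast
  have "\<not> eventually (\<lambda>j. j \<ge> M \<longrightarrow> norm (d j 0) < e) sequentially"
  proof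
    assume "eventually (\<lambda>j. j \<ge> M \<longrightarrow> norm (d j 0) < e) sequentially"
    hence "eventually (\<lambda>j. dist (h (x j)) (h (s, t)) < \<epsilon>) sequentially"
      using eventually_ge_at_top[of M] by eventually_elim (simp add: d_def y_def dist_norm e_def)
    thus False using \<epsilon>(2) by blast
  qed
  from not_eventually_sequentiallyD[OF this] obtain r :: "nat \<Rightarrow> nat"
    where r: "strict_mono r" "\<And>i. r i \<ge> M \<and> e \<le> norm (d (r i) 0)" by (auto simp: not_less)
  have d_cont: "continuous_on {0..\<tau>0} (d j)" for j
  proof -
    have "continuous_on {0..\<tau>0} (\<lambda>\<tau>. h (fst (x j), snd (x j) + \<tau>))"
      using xX by (intro continuous_on_subset[OF h_ray_continuous]) auto
    moreover have "continuous_on {0..\<tau>0} (\<lambda>\<tau>. h (s, t + \<tau>))"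
      by (intro continuous_on_subset[OF h_ray_continuous[OF st]]) auto
    ultimately show ?thesis unfolding d_def[abs_def] y_def by (rule continuous_on_diff)
  qed
  have "\<exists>\<tau>\<ge>0. \<tau> \<le> \<tau>0 \<and> norm (d (r i) \<tau>) = e" for i
    using r(2)[of i] M[of "r i"] \<tau>0 d_cont by (intro IVT2') (auto intro: continuous_on_norm)
  then obtain \<tau> where \<tau>: "\<And>i. 0 \<le> \<tau> i" "\<And>i. \<tau> i \<le> \<tau>0" "\<And>i. norm (d (r i) (\<tau> i)) = e" by metis
  obtain \<tau>' r' where \<tau>': "\<tau>' \<in> {0..\<tau>0}" "strict_mono r'" "(\<tau> \<circ> r') \<longlonglongrightarrow> \<tau>'"
    using compact_imp_seq_compact[OF compact_Icc[of 0 \<tau>0]] \<tau> unfolding seq_compact_def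
    by (metis atLeastAtMost_iff)
  define q where "q i = r (r' i)" for i
  define \<theta> where "\<theta> i = \<tau> (r' i)" for i
  have q: "strict_mono q" using strict_mono_o[OF r(1) \<tau>'(2)] by (simp add: q_def[abs_def] o_def)
  have \<theta>: "\<theta> \<longlonglongrightarrow> \<tau>'" "\<And>i. 0 \<le> \<theta> i" using \<tau>' \<tau> by (auto simp: \<theta>_def[abs_def] o_def)
  have "(\<lambda>i. h (model_map (y (q i) (\<theta> i)))) \<longlonglongrightarrow> h (model_map (s, t + \<tau>'))"
    using image[of \<tau>'] \<tau>'(1) model_tendsto_model_map[OF y_lim[OF q \<theta>(1)]] X_model_map[OF yX[OF \<theta>(2)]]
    unfolding seq_cont_at_def by auto
  hence 1: "(\<lambda>i. exp (h (y (q i) (\<theta> i)))) \<longlonglongrightarrow> exp (h (s, t + \<tau>'))"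
    using tendsto_diff[OF _ tendsto_const[of \<kappa>]] \<tau>'(1) yX[OF \<theta>(2)] X_plus[OF st, of \<tau>']
    by (simp add: h_model_map E_def) (fastforce dest: tendsto_diff[OF _ tendsto_const[of \<kappa>]])
  have "(\<lambda>i. h (s, t + \<theta> i)) \<longlonglongrightarrow> h (s, t + \<tau>')"
    by (rule continuous_on_tendsto_compose[OF h_ray_continuous[OF st] \<theta>(1)]) (use \<tau>' \<theta> in auto)
  hence 2: "(\<lambda>i. exp (h (s, t + \<theta> i))) \<longlonglongrightarrow> exp (h (s, t + \<tau>'))" by (rule tendsto_exp)
  have "(\<lambda>i. exp (d (q i) (\<theta> i))) \<longlonglongrightarrow> 1"
    using tendsto_divide[OF 1 2] by (simp add: d_def exp_diff)
  hence "(\<lambda>i. Ln (exp (d (q i) (\<theta> i)))) \<longlonglongrightarrow> Ln 1" by (rule tendsto_Ln) auto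
  moreover have "Ln (exp (d (q i) (\<theta> i))) = d (q i) (\<theta> i)" for i
  proof -
    have "\<bar>Im (d (q i) (\<theta> i))\<bar> \<le> 1" using abs_Im_le_cmod[of "d (q i) (\<theta> i)"] \<tau>(3)[of "r' i"] e by (simp add: q_def \<theta>_def)
    thus ?thesis using pi_gt3 by (intro Ln_exp) auto
  qed
  ultimately have "(\<lambda>i. norm (d (q i) (\<theta> i))) \<longlonglongrightarrow> 0" using tendsto_norm_zero by fastforce
  moreover have "norm (d (q i) (\<theta> i)) = e" for i using \<tau>(3)[of "r' i"] by (simp add: q_def \<theta>_def)
  ultimately have "(\<lambda>i::nat. e) \<longlonglongrightarrow> 0" by simp
  thus False using e by (simp add: LIMSEQ_const_iff)
qed

text \<open>Induction on the time after which the orbit stays high. Climbing the ray never lowers a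
  height, so the induction hypothesis covers the images of all points above, and an ascent by
  \<open>far + 1\<close> gives the point where continuity is already known.\<close>

lemma seq_cont_at_X:
  assumes "x0 \<in> X" shows "seq_cont_at x0"
proof -
  have "\<And>s t. (s, t) \<in> X \<Longrightarrow> (\<And>m. n \<le> m \<Longrightarrow> far + 1 \<le> height m s t) \<Longrightarrow> seq_cont_at (s, t)" for n
  proof (induction n)
    case 0
    thus ?case by (intro seq_cont_at_far) (auto simp: model_map_iter)
  next
    case (Suc n)
    have h0: "\<And>m. 0 \<le> height m s t" using Suc.prems(1) by (simp add: mem_X)
    have hp: "height m s t + \<tau> \<le> height m s (t + \<tau>)" if "0 \<le> \<tau>" for m \<tau>
      by (rule height_plus_ge[OF h0 that])
    have f0: "0 \<le> far + 1" using far_ge by simp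
    show ?case
    proof (rule seq_cont_at_pullback[OF Suc.prems(1) f0])
      show "seq_cont_at (s, t + (far + 1))"
      proof (rule seq_cont_at_far)
        fix m show "far + 1 \<le> snd ((model_map ^^ m) (s, t + (far + 1)))"
          using hp[OF f0, of m] h0[of m] by (simp add: model_map_iter)
      qed (rule X_plus[OF Suc.prems(1) f0])
      fix \<tau> :: real assume \<tau>: "0 \<le> \<tau>"
      show "seq_cont_at (model_map (s, t + \<tau>))"
        unfolding model_map_pair
      proof (rule Suc.IH)
        show "(shift s, F (t + \<tau>) - 2 * pi * \<bar>real_of_int (s 1)\<bar>) \<in> X"
          using X_model_map[OF X_plus[OF Suc.prems(1) \<tau>]] by (simp only: model_map_pair)
        show "far + 1 \<le> height m (shift s) (F (t + \<tau>) - 2 * pi * \<bar>real_of_int (s 1)\<bar>)" if "n \<le> m" for m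
          unfolding height_shift using Suc.prems(2)[of "Suc m"] hp[OF \<tau>, of "Suc m"] \<tau> that by simp
      qed
    qed
  qed
  thus ?thesis using assms X_eventually_high by (metis surj_pair)
qed

lemma h_tendsto:
  "\<lbrakk>\<And>j. x j \<in> X; x0 \<in> X; model_tendsto x x0\<rbrakk> \<Longrightarrow> (\<lambda>j. h (x j)) \<longlonglongrightarrow> h x0"
  using seq_cont_at_X unfolding seq_cont_at_def by blast

end

section \<open>Continuity of the inverse and surjectivity\<close>

context tame_extension
begin

definition seq_inverse_cont_at :: "address \<times> real \<Rightarrow> bool" where
  "seq_inverse_cont_at x0 \<longleftrightarrow>
     (\<forall>x. (\<forall>j. x j \<in> X) \<longrightarrow> (\<lambda>j. h (x j)) \<longlonglongrightarrow> h x0 \<longrightarrow> model_tendsto x x0)"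

text \<open>At heights above 1 the exponential has slope at least 2, so orbits with a common address
  separate geometrically; a bounded gap at time \<open>N\<close> was tiny at time 0.\<close>

lemma snd_expansion:
  assumes "\<And>n. n < N \<Longrightarrow> 1 \<le> snd ((model_map ^^ n) x) \<and> 1 \<le> snd ((model_map ^^ n) y)"
    and "\<And>n. n \<le> N \<Longrightarrow> fst x n = fst y n"
  shows "\<bar>snd x - snd y\<bar> \<le> (1 / 2) ^ N * \<bar>snd ((model_map ^^ N) x) - snd ((model_map ^^ N) y)\<bar>"
  using assms
proof (induction N arbitrary: x y)
  case (Suc N)
  have expand: "2 * (b - a) \<le> exp b - exp a" if "1 \<le> a" "a \<le> b" for a b :: real
  proof -
    have "2 \<le> exp a" using exp_ge_add_one_self[of a] that by linarith
    hence "2 * (b - a) \<le> exp a * (b - a)" using that by (intro mult_right_mono) auto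
    also have "b - a \<le> exp (b - a) - 1" using exp_ge_add_one_self[of "b - a"] by linarith
    hence "exp a * (b - a) \<le> exp a * (exp (b - a) - 1)" by (intro mult_left_mono) auto
    also have "\<dots> = exp b - exp a" by (simp add: algebra_simps flip: exp_add)
    finally show ?thesis .
  qed
  have "2 * \<bar>snd x - snd y\<bar> \<le> \<bar>exp (snd x) - exp (snd y)\<bar>"
    using expand[of "snd x" "snd y"] expand[of "snd y" "snd x"] Suc.prems(1)[of 0]
    by (cases "snd x \<le> snd y") auto
  also have "exp (snd x) - exp (snd y) = snd (model_map x) - snd (model_map y)"
    using Suc.prems(2)[of 1] by (simp add: model_map_def F_def)
  also have "\<bar>\<dots>\<bar> \<le> (1 / 2) ^ N * \<bar>snd ((model_map ^^ N) (model_map x)) - snd ((model_map ^^ N) (model_map y))\<bar>"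
  proof (rule Suc.IH)
    show "1 \<le> snd ((model_map ^^ n) (model_map x)) \<and> 1 \<le> snd ((model_map ^^ n) (model_map y))" if "n < N" for n
      using Suc.prems(1)[of "Suc n"] that by (simp add: funpow_swap1)
    show "fst (model_map x) n = fst (model_map y) n" if "n \<le> N" for n
      using Suc.prems(2)[of "Suc n"] that by (simp add: model_map_def shift_def)
  qed
  finally show ?case by (simp add: funpow_swap1)
qed simp

text \<open>Iterates of \<open>E\<close> are continuous, so at each fixed time the images are
  eventually within 1, and by \<open>model_dist\<close> the heights are within 2 * model_dist + 1.
  The margin in the hypothesis thus keeps the approximating orbits above \<open>far\<close>; then
  all entries can be recovered, and expansion settles the heights.\<close>

lemma seq_inverse_cont_at_far:
  assumes "x0 \<in> X" "\<And>n. far + 2 * model_dist + 1 \<le> snd ((model_map ^^ n) x0)"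
  shows "seq_inverse_cont_at x0"
  unfolding seq_inverse_cont_at_def
proof (intro allI impI)
  fix x assume xX: "\<forall>j. x j \<in> X" and lim: "(\<lambda>j. h (x j)) \<longlonglongrightarrow> h x0"
  have iterX: "(model_map ^^ n) (x j) \<in> X" "(model_map ^^ n) x0 \<in> X" for n j
    using xX assms(1) by (auto intro: model_map_iter_mem)
  have near: "\<forall>\<^sub>F j in sequentially. norm (h ((model_map ^^ n) (x j)) - h ((model_map ^^ n) x0)) < 1" for n
  proof -
    have "(\<lambda>j. (E \<kappa> ^^ n) (h (x j))) \<longlonglongrightarrow> (E \<kappa> ^^ n) (h x0)"
      by (rule continuous_on_tendsto_compose[OF continuous_on_E_iter[of UNIV] lim]) auto
    hence "(\<lambda>j. h ((model_map ^^ n) (x j))) \<longlonglongrightarrow> h ((model_map ^^ n) x0)"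
      using xX assms(1) by (simp add: h_iter)
    from tendstoD[OF this, of 1] show ?thesis by (simp add: dist_norm)
  qed
  have Re_near: "\<bar>Re (h y) - snd y\<bar> \<le> model_dist" if "y \<in> X" for y
    using order_trans[OF abs_Re_le_cmod model_dist(2)[OF that]] by (simp add: Z_def)
  have snd_near: "\<bar>snd ((model_map ^^ n) (x j)) - snd ((model_map ^^ n) x0)\<bar> \<le> 2 * model_dist + 1"
    if "norm (h ((model_map ^^ n) (x j)) - h ((model_map ^^ n) x0)) < 1" for n j
  proof -
    have "\<bar>Re (h ((model_map ^^ n) (x j))) - Re (h ((model_map ^^ n) x0))\<bar> \<le> 1"
      using abs_Re_le_cmod[of "h ((model_map ^^ n) (x j)) - h ((model_map ^^ n) x0)"] that by simp
    thus ?thesis using Re_near[OF iterX(1)[of n j]] Re_near[OF iterX(2)[of n]] by linarith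
  qed
  have high: "\<forall>\<^sub>F j in sequentially. far \<le> snd ((model_map ^^ n) (x j))" for n
    using near[of n]
  proof eventually_elim
    case (elim j)
    thus ?case using snd_near[OF elim] assms(2)[of n] by linarith
  qed
  \<comment> \<open>In the right half-plane the principal logarithm has imaginary part below pi/2.
    As pi/2 + pi/2 + 1 < 2 pi, values less than 1 apart belong to the same entry.\<close>
  have Im_L: "\<bar>Im (h y) - 2 * pi * fst y 0\<bar> < pi / 2" if "y \<in> X" "far \<le> snd (model_map y)" for y
  proof -
    let ?w = "h (model_map y) - \<kappa>"
    have pos: "0 < Re ?w" using far_Re[OF X_model_map[OF that(1)] that(2)] by (intro half_plane(3)) simp
    hence "?w \<noteq> 0" by auto
    hence "\<bar>Im (Ln ?w)\<bar> < pi / 2" using pos Re_Ln_pos_lt by blast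
    moreover have "Im (h y) - 2 * pi * fst y 0 = Im (Ln ?w)" unfolding h_eq_L[OF that] by (simp add: L_def)
    ultimately show ?thesis by simp
  qed
  have entry: "\<forall>\<^sub>F j in sequentially. fst (x j) n = fst x0 n" for n
    using near[of n] high[of "Suc n"]
  proof eventually_elim
    case (elim j)
    let ?y = "(model_map ^^ n) (x j)" and ?w = "(model_map ^^ n) x0"
    have "far \<le> snd (model_map ?y)" "far \<le> snd (model_map ?w)"
      using elim assms(2)[of "Suc n"] model_dist(1) by auto
    hence "\<bar>Im (h ?y) - 2 * pi * fst ?y 0\<bar> < pi / 2" "\<bar>Im (h ?w) - 2 * pi * fst ?w 0\<bar> < pi / 2"
      using Im_L iterX by blast+
    moreover have "\<bar>Im (h ?y) - Im (h ?w)\<bar> < 1" using abs_Im_le_cmod[of "h ?y - h ?w"] elim(1) by simp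
    ultimately have "\<bar>2 * pi * fst ?y 0 - 2 * pi * fst ?w 0\<bar> < 2 * pi * 1" using pi_gt3 by linarith
    moreover have "2 * pi * fst ?y 0 - 2 * pi * fst ?w 0 = 2 * pi * of_int (fst ?y 0 - fst ?w 0)"
      by (simp add: right_diff_distrib)
    ultimately have "\<bar>2 * pi * of_int (fst ?y 0 - fst ?w 0)\<bar> < 2 * pi * 1" by simp
    hence "2 * pi * \<bar>of_int (fst ?y 0 - fst ?w 0)\<bar> < 2 * pi * 1"
      unfolding abs_mult by simp
    hence "\<bar>of_int (fst ?y 0 - fst ?w 0)\<bar> < (1::real)" using pi_gt_zero by (simp only: mult_less_cancel_left_pos)
    hence "fst ?y 0 = fst ?w 0" by linarith
    thus ?case by (simp add: fst_model_map_iter)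
  qed
  have "(\<lambda>j. snd (x j)) \<longlonglongrightarrow> snd x0"
  proof (rule tendstoI)
    fix \<epsilon> :: real assume \<epsilon>: "\<epsilon> > 0"
    define B where "B = 2 * model_dist + 1"
    have "(\<lambda>N. (1 / 2) ^ N * B) \<longlonglongrightarrow> 0 * B" by (intro tendsto_intros LIMSEQ_power_zero) simp
    hence "eventually (\<lambda>N. (1 / 2) ^ N * B < \<epsilon>) sequentially" using \<epsilon> by (intro order_tendstoD) auto
    then obtain N where N: "(1 / 2) ^ N * B < \<epsilon>" unfolding eventually_sequentially by blast
    have "\<forall>\<^sub>F j in sequentially. \<forall>n \<in> {..N}. fst (x j) n = fst x0 n \<and> far \<le> snd ((model_map ^^ n) (x j))"
      using entry high by (simp add: eventually_ball_finite eventually_conj)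
    thus "\<forall>\<^sub>F j in sequentially. dist (snd (x j)) (snd x0) < \<epsilon>"
      using near[of N]
    proof eventually_elim
      case (elim j)
      have "\<bar>snd (x j) - snd x0\<bar> \<le> (1 / 2) ^ N * \<bar>snd ((model_map ^^ N) (x j)) - snd ((model_map ^^ N) x0)\<bar>"
      proof (rule snd_expansion)
        show "1 \<le> snd ((model_map ^^ n) (x j)) \<and> 1 \<le> snd ((model_map ^^ n) x0)" if "n < N" for n
        proof -
          have "far \<le> snd ((model_map ^^ n) (x j))" using bspec[OF elim(1), of n] that by simp
          thus ?thesis using assms(2)[of n] model_dist(1) far_ge by linarith
        qed
      qed (use bspec[OF elim(1)] in auto)
      also have "\<dots> \<le> (1 / 2) ^ N * B" unfolding B_def by (intro mult_left_mono snd_near elim(2)) auto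
      finally show ?case using N by (simp add: dist_real_def)
    qed
  qed
  thus "model_tendsto x x0" using entry by (simp add: model_tendsto_def)
qed

text \<open>The image determines the height and all entries but the zeroth. Replacing that entry by
  the one of \<open>x0\<close> gives a sequence \<open>x'\<close> along which \<open>h\<close>
  converges by \<open>h_tendsto\<close>; the difference from the original values is a multiple of 2
  pi i that tends to 0, hence eventually 0.\<close>

lemma seq_inverse_cont_at_pullback:
  assumes "x0 \<in> X" "seq_inverse_cont_at (model_map x0)"
  shows "seq_inverse_cont_at x0"
  unfolding seq_inverse_cont_at_def
proof (intro allI impI)
  fix x assume xX: "\<forall>j. x j \<in> X" and lim: "(\<lambda>j. h (x j)) \<longlonglongrightarrow> h x0"
  have "(\<lambda>j. E \<kappa> (h (x j))) \<longlonglongrightarrow> E \<kappa> (h x0)" unfolding E_def by (intro tendsto_intros lim)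
  hence "(\<lambda>j. h (model_map (x j))) \<longlonglongrightarrow> h (model_map x0)" using xX assms(1) by (simp add: h_model_map)
  hence "model_tendsto (\<lambda>j. model_map (x j)) (model_map x0)"
    using assms(2) xX X_model_map unfolding seq_inverse_cont_at_def by simp
  hence entry: "\<And>n. \<forall>\<^sub>F j in sequentially. fst (x j) (Suc n) = fst x0 (Suc n)"
    and snd_lim: "(\<lambda>j. snd (model_map (x j))) \<longlonglongrightarrow> snd (model_map x0)"
    by (auto simp: model_tendsto_def model_map_def shift_def)
  let ?b = "2 * pi * \<bar>real_of_int (fst x0 1)\<bar>"
  have "(\<lambda>j. snd (model_map (x j)) + 1 + ?b) \<longlonglongrightarrow> snd (model_map x0) + 1 + ?b"
    by (intro tendsto_intros snd_lim)
  moreover have "\<forall>\<^sub>F j in sequentially. snd (model_map (x j)) + 1 + ?b = exp (snd (x j))"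
    using entry[of 0] by eventually_elim (simp add: model_map_def F_def)
  ultimately have "(\<lambda>j. exp (snd (x j))) \<longlonglongrightarrow> snd (model_map x0) + 1 + ?b"
    by (rule Lim_transform_eventually)
  hence "(\<lambda>j. exp (snd (x j))) \<longlonglongrightarrow> exp (snd x0)" by (simp add: model_map_def F_def)
  hence "(\<lambda>j. ln (exp (snd (x j)))) \<longlonglongrightarrow> ln (exp (snd x0))" by (rule tendsto_ln) simp
  hence t_lim: "(\<lambda>j. snd (x j)) \<longlonglongrightarrow> snd x0" by simp
  define x' where "x' j = ((fst (x j))(0 := fst x0 0), snd (x j))" for j
  have x'X: "x' j \<in> X" for j using xX by (simp add: x'_def X_upd0)
  have "\<forall>\<^sub>F j in sequentially. fst (x' j) n = fst x0 n" for n
  proof (cases n)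
    case (Suc m)
    show ?thesis using entry[of m] unfolding Suc by eventually_elim (simp add: x'_def)
  qed (simp add: x'_def)
  hence "model_tendsto x' x0" using t_lim by (simp add: model_tendsto_def x'_def)
  hence "(\<lambda>j. h (x' j)) \<longlonglongrightarrow> h x0" using x'X assms(1) by (intro h_tendsto)
  from tendsto_diff[OF this lim] have "(\<lambda>j. h (x' j) - h (x j)) \<longlonglongrightarrow> 0" by simp
  moreover have diff: "h (x' j) - h (x j) = complex_of_real (2 * pi * of_int (fst x0 0 - fst (x j) 0)) * \<i>" for j
    using h_upd0[of "fst (x j)" "snd (x j)" "fst x0 0"] xX by (simp add: x'_def)
  ultimately have "\<forall>\<^sub>F j in sequentially. norm (complex_of_real (2 * pi * of_int (fst x0 0 - fst (x j) 0)) * \<i>) < 1"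
    using tendstoD[of _ 0 sequentially 1] by fastforce
  hence entry0: "\<forall>\<^sub>F j in sequentially. fst (x j) 0 = fst x0 0"
  proof eventually_elim
    case (elim j)
    hence "2 * pi * \<bar>of_int (fst x0 0 - fst (x j) 0)\<bar> < 1"
      by (simp only: norm_mult norm_of_real norm_ii abs_mult) simp
    also have "1 < 2 * pi" using pi_gt3 by simp
    finally have "2 * pi * \<bar>of_int (fst x0 0 - fst (x j) 0)\<bar> < 2 * pi * 1" by simp
    hence "\<bar>of_int (fst x0 0 - fst (x j) 0)\<bar> < (1::real)" using pi_gt_zero by (simp only: mult_less_cancel_left_pos)
    thus ?case by linarith
  qed
  have "\<forall>\<^sub>F j in sequentially. fst (x j) n = fst x0 n" for n
    using entry entry0 by (cases n) auto
  thus "model_tendsto x x0" using t_lim by (simp add: model_tendsto_def)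
qed

lemma seq_inverse_cont_at_X:
  assumes "x0 \<in> X" shows "seq_inverse_cont_at x0"
proof -
  let ?B = "far + 2 * model_dist + 1"
  have main: "\<And>x. x \<in> X \<Longrightarrow> (\<And>m. n \<le> m \<Longrightarrow> ?B \<le> snd ((model_map ^^ m) x)) \<Longrightarrow> seq_inverse_cont_at x" for n
  proof (induction n)
    case 0
    thus ?case by (intro seq_inverse_cont_at_far) auto
  next
    case (Suc n)
    show ?case
    proof (rule seq_inverse_cont_at_pullback[OF Suc.prems(1) Suc.IH[OF X_model_map[OF Suc.prems(1)]]])
      show "?B \<le> snd ((model_map ^^ m) (model_map x))" if "n \<le> m" for m
        using Suc.prems(2)[of "Suc m"] that by (simp add: funpow_swap1)
    qed
  qed
  obtain s t where x0: "x0 = (s, t)" by (cases x0)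
  obtain n where n: "\<And>m. m \<ge> n \<Longrightarrow> ?B \<le> height m s t" using X_eventually_high assms x0 by metis
  show ?thesis by (rule main[OF assms, of n]) (simp add: x0 model_map_iter n)
qed

lemma model_tendsto_if_h_tendsto:
  "\<lbrakk>\<And>j. x j \<in> X; x0 \<in> X; (\<lambda>j. h (x j)) \<longlonglongrightarrow> h x0\<rbrakk> \<Longrightarrow> model_tendsto x x0"
  using seq_inverse_cont_at_X unfolding seq_inverse_cont_at_def by blast

text \<open>Injectivity is continuity of the inverse applied to a constant sequence.\<close>

lemma inj_on_h: "inj_on h X"
proof (rule inj_onI)
  fix x y assume xy: "x \<in> X" "y \<in> X" "h x = h y"
  hence "model_tendsto (\<lambda>_. x) y" by (intro model_tendsto_if_h_tendsto) auto
  thus "x = y" by (simp add: model_tendsto_def LIMSEQ_const_iff prod_eq_iff fun_eq_iff)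
qed

text \<open>The height is built backwards from time \<open>n\<close>. An error of 1 reproduces
  itself because \<open>exp t\<close> and \<open>norm (v - \<kappa>)\<close> agree up to a factor
  5/2 < e.\<close>

lemma height_shadow:
  assumes "\<And>k. 6 * K + 20 \<le> Re ((E \<kappa> ^^ k) w)" "\<And>k. \<bar>Im ((E \<kappa> ^^ k) w) - 2 * pi * s k\<bar> \<le> pi"
  shows "\<exists>t. \<forall>k\<le>n. \<bar>height k s t - Re ((E \<kappa> ^^ k) w)\<bar> \<le> 1"
  using assms
proof (induction n arbitrary: w s)
  case 0
  show ?case by (intro exI[of _ "Re w"]) simp
next
  case (Suc n)
  have "\<exists>t. \<forall>k\<le>n. \<bar>height k (shift s) t - Re ((E \<kappa> ^^ k) (E \<kappa> w))\<bar> \<le> 1"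
  proof (rule Suc.IH)
    show "6 * K + 20 \<le> Re ((E \<kappa> ^^ k) (E \<kappa> w))" for k using Suc.prems(1)[of "Suc k"] by (simp add: funpow_swap1)
    show "\<bar>Im ((E \<kappa> ^^ k) (E \<kappa> w)) - 2 * pi * shift s k\<bar> \<le> pi" for k
      using Suc.prems(2)[of "Suc k"] by (simp add: funpow_swap1 shift_def)
  qed
  then obtain t' where t': "\<And>k. k \<le> n \<Longrightarrow> \<bar>height k (shift s) t' - Re ((E \<kappa> ^^ k) (E \<kappa> w))\<bar> \<le> 1" by blast
  define v where "v = E \<kappa> w"
  define b where "b = 2 * pi * \<bar>real_of_int (s 1)\<bar>"
  define t where "t = ln (1 + t' + b)"
  have Re_v: "6 * K + 20 \<le> Re v" using Suc.prems(1)[of 1] by (simp add: v_def)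
  have t'v: "\<bar>t' - Re v\<bar> \<le> 1" using t'[of 0] by (simp add: v_def)
  have Im_v: "\<bar>Im v - 2 * pi * s 1\<bar> \<le> pi" using Suc.prems(2)[of 1] by (simp add: v_def)
  have b0: "0 \<le> b" by (simp add: b_def)
  have "\<bar>2 * pi * s 1\<bar> = b" by (simp add: b_def abs_mult)
  hence bv: "b \<le> \<bar>Im v\<bar> + pi" "\<bar>Im v\<bar> \<le> b + pi" using Im_v by linarith+
  have pos: "0 < 1 + t' + b" using t'v Re_v b0 K_nonneg by linarith
  hence et: "exp t = 1 + t' + b" by (simp add: t_def)
  have ew: "exp (Re w) = norm (v - \<kappa>)" by (simp add: v_def E_comp_eq)
  have v1: "norm v - K \<le> norm (v - \<kappa>)" "norm (v - \<kappa>) \<le> norm v + K"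
    using norm_triangle_ineq2[of v \<kappa>] norm_triangle_ineq4[of v \<kappa>] norm_le_K by linarith+
  have v2: "Re v \<le> norm v" "\<bar>Im v\<bar> \<le> norm v" "norm v \<le> Re v + \<bar>Im v\<bar>"
    using complex_Re_le_cmod[of v] abs_Im_le_cmod[of v] cmod_le[of v] Re_v K_nonneg by auto
  have e1: "(5/2::real) \<le> exp 1" using exp_lower_Taylor_quadratic[of "1::real"] by simp
  \<comment> \<open>\<open>exp t\<close> is at most 2 * norm v + 2 + pi; the remaining half of
    \<open>norm v\<close> absorbs 2 + pi + 5/2 * K because \<open>Re v\<close> is at least 6 * K +
    20.\<close>
  have "exp t \<le> norm (v - \<kappa>) * (5/2)" unfolding et using t'v bv v1 v2 Re_v K_nonneg pi_less_4 by argo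
  also have "\<dots> \<le> norm (v - \<kappa>) * exp 1" by (intro mult_left_mono e1) simp
  finally have "exp t \<le> exp (Re w + 1)" by (simp add: ew exp_add)
  moreover have "norm (v - \<kappa>) \<le> exp t * (5/2)" unfolding et using t'v bv v1 v2 Re_v K_nonneg pi_less_4 by argo
  hence "norm (v - \<kappa>) \<le> exp t * exp 1" by (rule order_trans) (intro mult_left_mono e1, simp)
  hence "exp (Re w) \<le> exp (t + 1)" by (simp add: ew exp_add)
  ultimately have tw: "\<bar>t - Re w\<bar> \<le> 1" by simp
  have "F t - 2 * pi * \<bar>real_of_int (s 1)\<bar> = t'" by (simp add: F_def et b_def)
  hence hs: "height (Suc k) s t = height k (shift s) t'" for k using height_shift[of k s t] by simp
  show ?case
  proof (intro exI[of _ t] allI impI)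
    fix k assume "k \<le> Suc n"
    thus "\<bar>height k s t - Re ((E \<kappa> ^^ k) w)\<bar> \<le> 1"
      using tw t'[of "k - 1"] hs[of "k - 1"] by (cases k) (auto simp: funpow_swap1)
  qed
qed

text \<open>The heights that work up to time \<open>n\<close> form nested nonempty compact sets, so
  one height works for all times.\<close>

lemma height_shadow_all:
  assumes "\<And>k. 6 * K + 20 \<le> Re ((E \<kappa> ^^ k) w)" "\<And>k. \<bar>Im ((E \<kappa> ^^ k) w) - 2 * pi * s k\<bar> \<le> pi"
  shows "\<exists>t. \<forall>k. \<bar>height k s t - Re ((E \<kappa> ^^ k) w)\<bar> \<le> 1"
proof -
  define S where "S n = {Re w - 1..Re w + 1} \<inter> (\<Inter>k\<in>{..n}. {t. \<bar>height k s t - Re ((E \<kappa> ^^ k) w)\<bar> \<le> 1})" for n :: nat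
  have "\<Inter> (range S) \<noteq> {}"
  proof (rule compact_nest)
    show "compact (S n)" for n
      unfolding S_def
      by (intro compact_Int_closed compact_Icc closed_INT ballI closed_Collect_le continuous_intros continuous_on_height)
    show "S n \<noteq> {}" for n
    proof -
      obtain t where t: "\<And>k. k \<le> n \<Longrightarrow> \<bar>height k s t - Re ((E \<kappa> ^^ k) w)\<bar> \<le> 1"
        using height_shadow[OF assms, of n] by blast
      moreover have "t \<in> {Re w - 1..Re w + 1}" using t[of 0] by (auto simp: abs_le_iff)
      ultimately have "t \<in> S n" by (auto simp: S_def)
      thus ?thesis by blast
    qed
    show "S n \<subseteq> S m" if "m \<le> n" for m n using that by (auto simp: S_def)
  qed
  then obtain t where "\<And>n. t \<in> S n" by blast
  thus ?thesis by (intro exI[of _ t]) (auto simp: S_def)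
qed

text \<open>Entries are read off from the horizontal strips visited, and the height comes from
  shadowing. The orbit of \<open>w\<close> and the image of the model orbit then follow the same
  inverse branches at bounded distance, so contraction makes them equal.\<close>

lemma escaping_far_in_image:
  assumes esc: "w \<in> escaping_set (E \<kappa>)"
    and Re_w: "\<And>k. 6 * K + 20 + far + Q K \<le> Re ((E \<kappa> ^^ k) w)"
  shows "w \<in> h ` X"
proof -
  define z where "z k = (E \<kappa> ^^ k) w" for k
  \<comment> \<open>The ceiling selects the half-open strip (-pi, pi], the range of imaginary parts
    of the principal logarithm.\<close>
  define s :: address where "s k = \<lceil>Im (z k) / (2 * pi) - 1 / 2\<rceil>" for k
  have s: "- pi < Im (z k) - 2 * pi * s k" "Im (z k) - 2 * pi * s k \<le> pi" for k
  proof -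
    have "Im (z k) / (2 * pi) - 1 / 2 \<le> s k" "s k < Im (z k) / (2 * pi) + 1 / 2" unfolding s_def by linarith+
    thus "- pi < Im (z k) - 2 * pi * s k" "Im (z k) - 2 * pi * s k \<le> pi" by (auto simp: field_simps)
  qed
  have Qp: "0 < Q K" by (rule Q_pos)
  have Re_z: "6 * K + 20 \<le> Re (z k)" "far + 1 \<le> Re (z k)" "Q K + 1 \<le> Re (z k)" for k
    using Re_w[of k] far_ge Qp K_nonneg unfolding z_def by linarith+
  have "\<exists>t. \<forall>k. \<bar>height k s t - Re ((E \<kappa> ^^ k) w)\<bar> \<le> 1"
  proof (rule height_shadow_all)
    show "\<bar>Im ((E \<kappa> ^^ k) w) - 2 * pi * s k\<bar> \<le> pi" for k using s[of k] by (auto simp: z_def abs_le_iff)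
  qed (use Re_z in \<open>auto simp: z_def\<close>)
  then obtain t where t: "\<And>k. \<bar>height k s t - Re (z k)\<bar> \<le> 1" by (auto simp: z_def)
  have "filterlim (\<lambda>k. Re (z k)) at_top sequentially" using esc by (simp add: escaping_iff_Re z_def)
  hence "filterlim (\<lambda>k. - 1 + Re (z k)) at_top sequentially"
    by (rule filterlim_tendsto_add_at_top[OF tendsto_const])
  hence lim: "filterlim (\<lambda>k. height k s t) at_top sequentially"
  proof (rule filterlim_at_top_mono)
    have "- 1 + Re (z k) \<le> height k s t" for k using t[of k] by linarith
    thus "\<forall>\<^sub>F k in sequentially. - 1 + Re (z k) \<le> height k s t" by simp
  qed
  have height_ge: "far \<le> height k s t" for k using t[of k] Re_z(2)[of k] by (simp add: abs_le_iff)
  have "0 \<le> height k s t" for k using height_ge[of k] far_ge by simp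
  hence stX: "(s, t) \<in> X" using lim by (simp add: mem_X)
  define y where "y k = (model_map ^^ k) (s, t)" for k
  have yX: "y k \<in> X" for k unfolding y_def by (rule model_map_iter_mem(1)[OF stX])
  have y_eq: "y k = (\<lambda>i. s (i + k), height k s t)" for k by (simp add: y_def model_map_iter)
  have yS: "model_map (y k) = y (Suc k)" for k by (simp add: y_def)
  have hL: "h (y k) = L \<kappa> (s k) (h (y (Suc k)))" for k
    using h_eq_L[OF yX[of k]] height_ge[of "Suc k"] unfolding yS by (simp add: y_eq)
  have zL: "z k = L \<kappa> (s k) (z (Suc k))" for k
  proof -
    define c where "c = z k - 2 * pi * \<i> * of_int (s k)"
    have zc: "z k = c + 2 * pi * \<i> * of_int (s k)" by (simp add: c_def)
    have "z (Suc k) - \<kappa> = exp (z k)" by (simp add: z_def E_comp_eq)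
    also have "\<dots> = exp c" unfolding zc by (rule exp_add_2pi_int)
    also have "Ln (exp c) = c" using s[of k] by (intro Ln_exp) (auto simp: c_def)
    finally show ?thesis by (simp add: L_def zc)
  qed
  have near: "norm (h (y k) - z k) \<le> model_dist + 1 + pi" for k
  proof -
    have "norm (Z (y k) - z k) \<le> \<bar>Re (Z (y k) - z k)\<bar> + \<bar>Im (Z (y k) - z k)\<bar>" by (rule cmod_le)
    also have "Re (Z (y k) - z k) = height k s t - Re (z k)" by (simp add: Z_def y_eq)
    also have "Im (Z (y k) - z k) = - (Im (z k) - 2 * pi * s k)" by (simp add: Z_def y_eq)
    also have "\<bar>height k s t - Re (z k)\<bar> + \<bar>- (Im (z k) - 2 * pi * s k)\<bar> \<le> 1 + pi"
      using t[of k] s[of k] by (intro add_mono) (auto simp: abs_le_iff)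
    finally have "norm (Z (y k) - z k) \<le> 1 + pi" .
    thus ?thesis using model_dist(2)[OF yX[of k]] norm_triangle_ineq[of "h (y k) - Z (y k)" "Z (y k) - z k"] by simp
  qed
  have step: "norm (h (y k) - z k) \<le> (1 / 2) * norm (h (y (Suc k)) - z (Suc k))" for k
    unfolding hL[of k] zL[of k]
    using far_Re[OF yX[of "Suc k"]] height_ge[of "Suc k"] Re_z(1)[of "Suc k"] K_nonneg
    by (intro half_plane_contraction) (auto simp: y_eq)
  have "norm (h (y 0) - z 0) \<le> (1 / 2) ^ k * norm (h (y k) - z k)" for k
  proof (induction k)
    case (Suc k)
    note Suc.IH
    also have "(1 / 2) ^ k * norm (h (y k) - z k) \<le> (1 / 2) ^ k * ((1 / 2) * norm (h (y (Suc k)) - z (Suc k)))"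
      by (intro mult_left_mono step) simp
    finally show ?case by simp
  qed simp
  hence bound: "norm (h (y 0) - z 0) \<le> (1 / 2) ^ k * (model_dist + 1 + pi)" for k
    using mult_left_mono[OF near[of k], of "(1 / 2) ^ k"] by (meson order_trans zero_le_divide_1_iff zero_le_numeral zero_le_power)
  have "(\<lambda>k. (1 / 2) ^ k * (model_dist + 1 + pi)) \<longlonglongrightarrow> 0 * (model_dist + 1 + pi)"
    by (intro tendsto_intros LIMSEQ_power_zero) simp
  hence "norm (h (y 0) - z 0) \<le> 0 * (model_dist + 1 + pi)"
    by (rule LIMSEQ_le_const) (use bound in blast)
  hence "h (s, t) = w" by (simp add: y_def z_def)
  thus ?thesis using stX by blast
qed

text \<open>A preimage in the model is found by prepending an arbitrary entry; its value differs
  from \<open>z\<close> by a multiple of 2 pi i, which a change of that entry corrects.\<close>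

lemma image_pullback:
  assumes "E \<kappa> z \<in> h ` X" shows "z \<in> h ` X"
proof -
  obtain s t where st: "(s, t) \<in> X" "h (s, t) = E \<kappa> z" using assms by auto
  let ?t = "ln (1 + t + 2 * pi * \<bar>real_of_int (s 0)\<bar>)"
  have X0: "(prepend 0 s, ?t) \<in> X" using st(1) by (rule X_prepend)
  have "E \<kappa> (h (prepend 0 s, ?t)) = E \<kappa> z"
    using h_model_map[OF X0] unfolding model_map_prepend[OF X_nonneg[OF st(1)]] st(2) by simp
  hence "exp z = exp (h (prepend 0 s, ?t))" by (simp add: E_def)
  then obtain k :: int where k: "z = h (prepend 0 s, ?t) + (of_int (2 * k) * pi) * \<i>"
    unfolding exp_eq by blast
  have "h ((prepend 0 s)(0 := k), ?t) = z"
    unfolding h_upd0[OF X0] k by (simp add: prepend_def)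
  moreover have "((prepend 0 s)(0 := k), ?t) \<in> X" using X0 by (simp add: X_upd0)
  ultimately show ?thesis by force
qed

lemma h_image: "h ` X = escaping_set (E \<kappa>)"
proof
  show "h ` X \<subseteq> escaping_set (E \<kappa>)" using h_escaping by blast
  show "escaping_set (E \<kappa>) \<subseteq> h ` X"
  proof
    fix z assume z: "z \<in> escaping_set (E \<kappa>)"
    hence "eventually (\<lambda>n. 6 * K + 20 + far + Q K \<le> Re ((E \<kappa> ^^ n) z)) sequentially"
      unfolding escaping_iff_Re filterlim_at_top by blast
    then obtain N where N: "\<And>n. n \<ge> N \<Longrightarrow> 6 * K + 20 + far + Q K \<le> Re ((E \<kappa> ^^ n) z)"
      unfolding eventually_sequentially by blast
    have "(E \<kappa> ^^ N) z \<in> h ` X"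
    proof (rule escaping_far_in_image)
      show "6 * K + 20 + far + Q K \<le> Re ((E \<kappa> ^^ k) ((E \<kappa> ^^ N) z))" for k
        using N[of "k + N"] by (simp add: funpow_add)
    qed (simp add: escaping_E_iter_iff z)
    thus "z \<in> h ` X"
      by (induction N) (auto intro: image_pullback)
  qed
qed

end

text \<open>The disc in \<open>tame\<close> shows that \<kappa> does not escape, so an extension
  exists and the choice in \<open>g\<close> really selects one.\<close>

lemma tame_extension_g:
  assumes "attracting_parameter \<kappa> \<or> parabolic_parameter \<kappa>" "norm \<kappa> \<le> K"
  shows "tame_extension \<kappa> K (g \<kappa> K)"
proof -
  interpret exp_parameter \<kappa> K by unfold_locales (rule assms)
  have "tame \<kappa>" using assms(1) attracting_imp_tame parabolic_imp_tame by blast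
  moreover from this have "\<kappa> \<notin> escaping_set (E \<kappa>)"
    unfolding tame_def by (metis centre_in_ball disjoint_iff)
  ultimately show ?thesis by unfold_locales (auto intro: is_g_extension_g)
qed

lemma Phi_continuous:
  assumes "tame_extension \<kappa>1 K1 (g \<kappa>1 K1)" "tame_extension \<kappa>2 K2 (g \<kappa>2 K2)"
  shows "continuous_on (escaping_set (E \<kappa>1)) (Phi \<kappa>1 K1 \<kappa>2 K2)"
proof -
  interpret t1: tame_extension \<kappa>1 K1 "g \<kappa>1 K1" by (rule assms)
  interpret t2: tame_extension \<kappa>2 K2 "g \<kappa>2 K2" by (rule assms)
  let ?i = "inv_into X (g \<kappa>1 K1)"
  have i: "?i z \<in> X" "g \<kappa>1 K1 (?i z) = z" if "z \<in> escaping_set (E \<kappa>1)" for z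
    using that t1.h_image by (auto intro: inv_into_into f_inv_into_f)
  show ?thesis
    unfolding continuous_on_sequentially
  proof (intro allI ballI impI)
    fix z a assume a: "a \<in> escaping_set (E \<kappa>1)" and z: "(\<forall>n. z n \<in> escaping_set (E \<kappa>1)) \<and> z \<longlonglongrightarrow> a"
    have "model_tendsto (\<lambda>n. ?i (z n)) (?i a)"
      using a z i by (intro t1.model_tendsto_if_h_tendsto) auto
    hence "(\<lambda>n. g \<kappa>2 K2 (?i (z n))) \<longlonglongrightarrow> g \<kappa>2 K2 (?i a)"
      using a z i by (intro t2.h_tendsto) auto
    thus "(Phi \<kappa>1 K1 \<kappa>2 K2 \<circ> z) \<longlonglongrightarrow> Phi \<kappa>1 K1 \<kappa>2 K2 a" by (simp add: Phi_def o_def)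
  qed
qed

lemma Phi_inverse:
  assumes "tame_extension \<kappa>1 K1 (g \<kappa>1 K1)" "tame_extension \<kappa>2 K2 (g \<kappa>2 K2)"
    and z: "z \<in> escaping_set (E \<kappa>1)"
  shows "Phi \<kappa>1 K1 \<kappa>2 K2 z \<in> escaping_set (E \<kappa>2)" "Phi \<kappa>2 K2 \<kappa>1 K1 (Phi \<kappa>1 K1 \<kappa>2 K2 z) = z"
    "Phi \<kappa>1 K1 \<kappa>2 K2 (E \<kappa>1 z) = E \<kappa>2 (Phi \<kappa>1 K1 \<kappa>2 K2 z)"
proof -
  interpret t1: tame_extension \<kappa>1 K1 "g \<kappa>1 K1" by (rule assms)
  interpret t2: tame_extension \<kappa>2 K2 "g \<kappa>2 K2" by (rule assms)
  obtain x where x: "x \<in> X" "z = g \<kappa>1 K1 x" using z t1.h_image by blast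
  have Phi1: "Phi \<kappa>1 K1 \<kappa>2 K2 (g \<kappa>1 K1 y) = g \<kappa>2 K2 y" if "y \<in> X" for y
    using that t1.inj_on_h by (simp add: Phi_def)
  have Phi2: "Phi \<kappa>2 K2 \<kappa>1 K1 (g \<kappa>2 K2 y) = g \<kappa>1 K1 y" if "y \<in> X" for y
    using that t2.inj_on_h by (simp add: Phi_def)
  show "Phi \<kappa>1 K1 \<kappa>2 K2 z \<in> escaping_set (E \<kappa>2)" "Phi \<kappa>2 K2 \<kappa>1 K1 (Phi \<kappa>1 K1 \<kappa>2 K2 z) = z"
    using x t2.h_escaping by (auto simp: Phi1 Phi2)
  show "Phi \<kappa>1 K1 \<kappa>2 K2 (E \<kappa>1 z) = E \<kappa>2 (Phi \<kappa>1 K1 \<kappa>2 K2 z)"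
    using x Phi1[OF X_model_map[OF x(1)]] by (simp add: Phi1 t1.h_model_map t2.h_model_map)
qed

theorem theorem1p2:
  fixes \<kappa>1 \<kappa>2 :: complex and K1 K2 :: real
  assumes "attracting_parameter \<kappa>1 \<or> parabolic_parameter \<kappa>1"
    and "attracting_parameter \<kappa>2 \<or> parabolic_parameter \<kappa>2"
    and "K1 > 2 * pi + 6" and "norm \<kappa>1 \<le> K1"
    and "K2 > 2 * pi + 6" and "norm \<kappa>2 \<le> K2"
  shows "(\<exists>\<Psi>. homeomorphism (escaping_set (E \<kappa>1)) (escaping_set (E \<kappa>2)) (Phi \<kappa>1 K1 \<kappa>2 K2) \<Psi>) \<and>
    (\<forall>z \<in> escaping_set (E \<kappa>1). Phi \<kappa>1 K1 \<kappa>2 K2 (E \<kappa>1 z) = E \<kappa>2 (Phi \<kappa>1 K1 \<kappa>2 K2 z))"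
proof -
  have t1: "tame_extension \<kappa>1 K1 (g \<kappa>1 K1)" and t2: "tame_extension \<kappa>2 K2 (g \<kappa>2 K2)"
    using assms by (auto intro: tame_extension_g)
  have "homeomorphism (escaping_set (E \<kappa>1)) (escaping_set (E \<kappa>2)) (Phi \<kappa>1 K1 \<kappa>2 K2) (Phi \<kappa>2 K2 \<kappa>1 K1)"
    by (rule homeomorphismI)
       (use Phi_continuous[OF t1 t2] Phi_continuous[OF t2 t1] Phi_inverse[OF t1 t2] Phi_inverse[OF t2 t1] in auto)
  thus ?thesis using Phi_inverse(3)[OF t1 t2] by blast
qed

end
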